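(* Let $k$ be an algebraically closed field of characteristic zero and let $H$ be a finite dimensional Hopf algebra over $k$. Then the Hochschild cohomology ring $HH^*(H)$ is a Batalin-Vilkovisky algebra.
   Context: Hochschild cohomology of a $k$-algebra $A$: put $\overline{A}=A/(k\cdot 1_A)$, $C^r(A,A)=\mathrm{Hom}_k(\overline{A}^{\otimes r},A)$ for $r\ge 0$, with differential $b^r(f)(\overline{a_1}\otimes\cdots\otimes\overline{a_{r+1}})=(-1)^{r+1}a_1f(\overline{a_2}\otimes\cdots\otimes\overline{a_{r+1}})+\sum_{i=1}^r(-1)^{r+1-i}f(\overline{a_1}\otimes\cdots\otimes\overline{a_ia_{i+1}}\otimes\cdots\otimes\overline{a_{r+1}})+f(\overline{a_1}\otimes\cdots\otimes\overline{a_r})a_{r+1}$. Its cohomology is $HH^*(A)$. The cup product is induced by $(\alpha\cup\beta)(\overline{a_1}\otimes\cdots\otimes\overline{a_{p+q}})=(-1)^{pq}\alpha(\overline{a_1}\otimes\cdots\otimes\overline{a_p})\beta(\overline{a_{p+1}}\otimes\cdots\otimes\overline{a_{p+q}})$ for $\alpha\in C^p$, $\beta\in C^q$. The Lie bracket of degree $-1$ is induced, for $\alpha\in C^n$, $\beta\in C^m$, by $[\alpha,\beta]=\alpha\,\overline{\circ}\,\beta-(-1)^{(n-1)(m-1)}\beta\,\overline{\circ}\,\alpha$, where $\alpha\,\overline{\circ}\,\beta=\sum_{i=1}^n(-1)^{(m-1)(i-1)}\alpha\,\overline{\circ}_i\,\beta$ and $\alpha\,\overline{\circ}_i\,\beta$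 inserts $\beta$ (applied to the $i$-th through $(i+m-1)$-st arguments; the element $\beta\in A$ itself if $m=0$) into the $i$-th slot of $\alpha$; $\alpha\,\overline{\circ}\,\beta=0$ if $n=0$. With these operations $HH^*(A)$ is a Gerstenhaber algebra. Batalin-Vilkovisky algebras: a Gerstenhaber algebra $(\mathcal{H}^*,\cup,[\ ,\ ])$ is a Batalin-Vilkovisky algebra if it has a linear operator $\Delta$ of degree $-1$ with $\Delta\circ\Delta=0$, $\Delta(1)=0$ and $[\alpha,\beta]=(-1)^{|\alpha|+1}\big(\Delta(\alpha\cup\beta)-\Delta(\alpha)\cup\beta-(-1)^{|\alpha|}\alpha\cup\Delta(\beta)\big)$ for all homogeneous $\alpha,\beta$. *)

theory Defs
  imports
    "HOL-Algebra.Module"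
    "HOL-Algebra.Algebraic_Closure_Type"
    "HOL-Library.Function_Algebras"
    "HOL-Library.Set_Algebras"
    "HOL-Library.Poly_Mapping"
begin

section \<open>Hopf algebras\<close>

text \<open>
  An associative unital algebra over a field \<open>'k\<close> is a ring type \<open>'h\<close> with a scalar
  multiplication \<open>scale\<close>.
\<close>

locale k_algebra = vector_space scale
  for scale :: "'k::field \<Rightarrow> 'h::ring_1 \<Rightarrow> 'h" +
  assumes scale_mult_left: "scale c a * b = scale c (a * b)"
    and scale_mult_right: "a * scale c b = scale c (a * b)"

text \<open>
  Tensor powers over \<open>'k\<close> are quotients of free vector spaces: a list \<open>[x\<^sub>1, \<dots>, x\<^sub>n]\<close> is a basis
  vector of the free vector space and stands for \<open>x\<^sub>1 \<otimes> \<dots> \<otimes> x\<^sub>n\<close>; \<open>tensor_null\<close> is the subspace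
  spanned by the multilinearity relations. Each relation only involves lists of one length, so
  the quotient is the tensor algebra, and the classes of combinations of lists of length \<open>n\<close>
  form the \<open>n\<close>-th tensor power.
\<close>

definition tensor_relators ::
  "('k::field \<Rightarrow> 'h::ab_group_add \<Rightarrow> 'h) \<Rightarrow> ('h list \<Rightarrow>\<^sub>0 'k) set" where
  "tensor_relators scale =
     {Poly_Mapping.single (xs @ (a + b) # ys) 1
        - Poly_Mapping.single (xs @ a # ys) 1 - Poly_Mapping.single (xs @ b # ys) 1
      | xs a b ys. True}
   \<union> {Poly_Mapping.single (xs @ scale c a # ys) 1 - Poly_Mapping.single (xs @ a # ys) c
      | xs c a ys. True}"

definition tensor_null ::
  "('k::field \<Rightarrow> 'h::ab_group_add \<Rightarrow> 'h) \<Rightarrow> ('h list \<Rightarrow>\<^sub>0 'k) set" where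
  "tensor_null scale = module.span (\<lambda>c. Poly_Mapping.map ((*) c)) (tensor_relators scale)"

text \<open>The element \<open>\<Sum>\<^sub>i x\<^sub>i\<^sub>1 \<otimes> \<dots> \<otimes> x\<^sub>i\<^sub>n\<close> given by a list of pure tensors, as a coset.\<close>

definition tensor ::
  "('k::field \<Rightarrow> 'h::ab_group_add \<Rightarrow> 'h) \<Rightarrow> 'h list list \<Rightarrow> ('h list \<Rightarrow>\<^sub>0 'k) set" where
  "tensor scale xss = (\<Sum>xs\<leftarrow>xss. Poly_Mapping.single xs 1) +o tensor_null scale"

abbreviation tensor2 ::
  "('k::field \<Rightarrow> 'h::ab_group_add \<Rightarrow> 'h) \<Rightarrow> ('h \<times> 'h) list \<Rightarrow> ('h list \<Rightarrow>\<^sub>0 'k) set" where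
  "tensor2 scale ps \<equiv> tensor scale (map (\<lambda>(x, y). [x, y]) ps)"

text \<open>
  The comultiplication takes values in \<open>H \<otimes> H\<close>, and the axioms are read off from arbitrary
  expressions \<open>\<Sum> a\<^sub>1 \<otimes> a\<^sub>2\<close> of \<open>comult a\<close> as a sum of pure tensors (Sweedler notation). In
  \<open>coassoc\<close>, \<open>D x\<close> is any such expression of \<open>comult x\<close>. Bijectivity of the antipode is not
  assumed.
\<close>

locale hopf_algebra = k_algebra scale
  for scale :: "'k::field \<Rightarrow> 'h::ring_1 \<Rightarrow> 'h" +
  fixes comult :: "'h \<Rightarrow> ('h list \<Rightarrow>\<^sub>0 'k) set"
    and counit :: "'h \<Rightarrow> 'k"
    and antipode :: "'h \<Rightarrow> 'h"
  assumes comult_tensor: "\<exists>ps. comult a = tensor2 scale ps"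
    and comult_add: "comult a = tensor2 scale ps \<Longrightarrow> comult b = tensor2 scale qs \<Longrightarrow>
      comult (a + b) = tensor2 scale (ps @ qs)"
    and comult_scale: "comult a = tensor2 scale ps \<Longrightarrow>
      comult (scale c a) = tensor2 scale (map (\<lambda>(x, y). (scale c x, y)) ps)"
    and comult_one: "comult 1 = tensor2 scale [(1, 1)]"
    and comult_mult: "comult a = tensor2 scale ps \<Longrightarrow> comult b = tensor2 scale qs \<Longrightarrow>
      comult (a * b) = tensor2 scale [(x * x', y * y'). (x, y) \<leftarrow> ps, (x', y') \<leftarrow> qs]"
    and coassoc: "comult a = tensor2 scale ps \<Longrightarrow> (\<And>x. comult x = tensor2 scale (D x)) \<Longrightarrow>
      tensor scale [[x1, x2, y]. (x, y) \<leftarrow> ps, (x1, x2) \<leftarrow> D x] =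
      tensor scale [[x, y1, y2]. (x, y) \<leftarrow> ps, (y1, y2) \<leftarrow> D y]"
    and counit_linear: "Vector_Spaces.linear scale (*) counit"
    and counit_one: "counit 1 = 1"
    and counit_mult: "counit (a * b) = counit a * counit b"
    and counit_left: "comult a = tensor2 scale ps \<Longrightarrow> (\<Sum>(x, y)\<leftarrow>ps. scale (counit x) y) = a"
    and counit_right: "comult a = tensor2 scale ps \<Longrightarrow> (\<Sum>(x, y)\<leftarrow>ps. scale (counit y) x) = a"
    and antipode_linear: "Vector_Spaces.linear scale scale antipode"
    and antipode_left: "comult a = tensor2 scale ps \<Longrightarrow>
      (\<Sum>(x, y)\<leftarrow>ps. antipode x * y) = scale (counit a) 1"
    and antipode_right: "comult a = tensor2 scale ps \<Longrightarrow>
      (\<Sum>(x, y)\<leftarrow>ps. x * antipode y) = scale (counit a) 1"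


section \<open>Hochschild cohomology\<close>

text \<open>
  An element of \<open>C\<^sup>n = Hom\<^sub>k((A/k1)\<^sup>\<otimes>\<^sup>n, A)\<close> is a multilinear function of \<open>n\<close> arguments from \<open>A\<close>
  that vanishes as soon as one argument is in \<open>k1\<close>. It is represented as a function on lists
  that is \<open>0\<close> off the lists of length \<open>n\<close>, so the remaining conditions need no length
  restriction. Degrees are integers so that operations of degree \<open>-1\<close> have a target; for
  \<open>n < 0\<close> there are no lists of length \<open>n\<close>, and \<open>C\<^sup>n = 0\<close>.
\<close>

definition cochains ::
  "('k::field \<Rightarrow> 'h::ring_1 \<Rightarrow> 'h) \<Rightarrow> int \<Rightarrow> ('h list \<Rightarrow> 'h) set" where
  "cochains scale n = {f.
     (\<forall>xs. int (length xs) \<noteq> n \<longrightarrow> f xs = 0) \<and>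
     (\<forall>xs a b ys. f (xs @ (a + b) # ys) = f (xs @ a # ys) + f (xs @ b # ys)) \<and>
     (\<forall>xs c a ys. f (xs @ scale c a # ys) = scale c (f (xs @ a # ys))) \<and>
     (\<forall>xs c ys. f (xs @ scale c 1 # ys) = 0)}"

text \<open>Lists are indexed from \<open>0\<close>, so \<open>a\<^sub>i\<close> is \<open>as ! (i - 1)\<close>.\<close>

definition hochschild_diff ::
  "('k::field \<Rightarrow> 'h::ring_1 \<Rightarrow> 'h) \<Rightarrow> int \<Rightarrow> ('h list \<Rightarrow> 'h) \<Rightarrow> 'h list \<Rightarrow> 'h" where
  "hochschild_diff scale r f as =
     (if int (length as) = r + 1 then
        scale ((-1) powi (r + 1)) (hd as * f (tl as))
        + (\<Sum>i = 1..nat r. scale ((-1) powi (r + 1 - int i))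
            (f (take (i - 1) as @ (as ! (i - 1) * as ! i) # drop (i + 1) as)))
        + f (butlast as) * last as
      else 0)"

definition cochain_cup ::
  "('k::field \<Rightarrow> 'h::ring_1 \<Rightarrow> 'h) \<Rightarrow> int \<Rightarrow> int \<Rightarrow>
     ('h list \<Rightarrow> 'h) \<Rightarrow> ('h list \<Rightarrow> 'h) \<Rightarrow> 'h list \<Rightarrow> 'h" where
  "cochain_cup scale p q \<alpha> \<beta> as =
     (if int (length as) = p + q then
        scale ((-1) powi (p * q)) (\<alpha> (take (nat p) as) * \<beta> (drop (nat p) as))
      else 0)"

definition cochain_circ_at ::
  "int \<Rightarrow> int \<Rightarrow> nat \<Rightarrow> ('h list \<Rightarrow> 'h::ring_1) \<Rightarrow> ('h list \<Rightarrow> 'h) \<Rightarrow> 'h list \<Rightarrow> 'h" where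
  "cochain_circ_at n m i \<alpha> \<beta> as =
     (if int (length as) = n + m - 1 then
        \<alpha> (take (i - 1) as @ \<beta> (take (nat m) (drop (i - 1) as)) # drop (i - 1 + nat m) as)
      else 0)"

definition cochain_circ ::
  "('k::field \<Rightarrow> 'h::ring_1 \<Rightarrow> 'h) \<Rightarrow> int \<Rightarrow> int \<Rightarrow>
     ('h list \<Rightarrow> 'h) \<Rightarrow> ('h list \<Rightarrow> 'h) \<Rightarrow> 'h list \<Rightarrow> 'h" where
  "cochain_circ scale n m \<alpha> \<beta> as =
     (\<Sum>i = 1..nat n. scale ((-1) powi ((m - 1) * (int i - 1))) (cochain_circ_at n m i \<alpha> \<beta> as))"

definition cochain_bracket ::
  "('k::field \<Rightarrow> 'h::ring_1 \<Rightarrow> 'h) \<Rightarrow> int \<Rightarrow> int \<Rightarrow>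
     ('h list \<Rightarrow> 'h) \<Rightarrow> ('h list \<Rightarrow> 'h) \<Rightarrow> 'h list \<Rightarrow> 'h" where
  "cochain_bracket scale n m \<alpha> \<beta> as =
     cochain_circ scale n m \<alpha> \<beta> as
     - scale ((-1) powi ((n - 1) * (m - 1))) (cochain_circ scale m n \<beta> \<alpha> as)"

definition cocycles ::
  "('k::field \<Rightarrow> 'h::ring_1 \<Rightarrow> 'h) \<Rightarrow> int \<Rightarrow> ('h list \<Rightarrow> 'h) set" where
  "cocycles scale n = {f \<in> cochains scale n. \<forall>as. hochschild_diff scale n f as = 0}"

definition coboundaries ::
  "('k::field \<Rightarrow> 'h::ring_1 \<Rightarrow> 'h) \<Rightarrow> int \<Rightarrow> ('h list \<Rightarrow> 'h) set" where
  "coboundaries scale n = hochschild_diff scale (n - 1) ` cochains scale (n - 1)"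

definition HH_class ::
  "('k::field \<Rightarrow> 'h::ring_1 \<Rightarrow> 'h) \<Rightarrow> int \<Rightarrow> ('h list \<Rightarrow> 'h) \<Rightarrow> ('h list \<Rightarrow> 'h) set" where
  "HH_class scale n f = f +o coboundaries scale n"

text \<open>
  \<open>HH\<^sup>n = Z\<^sup>n / B\<^sup>n\<close> as a vector space of cosets. An induced operation is the union, over all
  choices of representatives, of the class of the result; when the operation is well defined
  all these classes coincide. The fields \<open>mult\<close> and \<open>one\<close> of the module record carry no
  meaning for a module.
\<close>

definition HH ::
  "('k::field \<Rightarrow> 'h::ring_1 \<Rightarrow> 'h) \<Rightarrow> int \<Rightarrow> ('k, ('h list \<Rightarrow> 'h) set) module" where
  "HH scale n =
     \<lparr>carrier = HH_class scale n ` cocycles scale n,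
      monoid.mult = undefined,
      monoid.one = undefined,
      ring.zero = coboundaries scale n,
      ring.add = (\<lambda>U W. \<Union>f\<in>U. \<Union>g\<in>W. HH_class scale n (f + g)),
      module.smult = (\<lambda>c U. \<Union>f\<in>U. HH_class scale n (\<lambda>as. scale c (f as)))\<rparr>"

definition HH_unit :: "('k::field \<Rightarrow> 'h::ring_1 \<Rightarrow> 'h) \<Rightarrow> ('h list \<Rightarrow> 'h) set" where
  "HH_unit scale = HH_class scale 0 (\<lambda>as. if as = [] then 1 else 0)"

definition HH_cup ::
  "('k::field \<Rightarrow> 'h::ring_1 \<Rightarrow> 'h) \<Rightarrow> int \<Rightarrow> int \<Rightarrow>
     ('h list \<Rightarrow> 'h) set \<Rightarrow> ('h list \<Rightarrow> 'h) set \<Rightarrow> ('h list \<Rightarrow> 'h) set" where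
  "HH_cup scale p q U W =
     (\<Union>\<alpha>\<in>U. \<Union>\<beta>\<in>W. HH_class scale (p + q) (cochain_cup scale p q \<alpha> \<beta>))"

definition HH_bracket ::
  "('k::field \<Rightarrow> 'h::ring_1 \<Rightarrow> 'h) \<Rightarrow> int \<Rightarrow> int \<Rightarrow>
     ('h list \<Rightarrow> 'h) set \<Rightarrow> ('h list \<Rightarrow> 'h) set \<Rightarrow> ('h list \<Rightarrow> 'h) set" where
  "HH_bracket scale n m U W =
     (\<Union>\<alpha>\<in>U. \<Union>\<beta>\<in>W. HH_class scale (n + m - 1) (cochain_bracket scale n m \<alpha> \<beta>))"


section \<open>Gerstenhaber and Batalin-Vilkovisky algebras\<close>

text \<open>
  A graded vector space is a family \<open>V\<close> of vector spaces indexed by the integers. An operation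
  on homogeneous elements takes their degrees as additional arguments.
\<close>

definition linear_map ::
  "('k, 'v, 'm) module_scheme \<Rightarrow> ('k, 'v, 'n) module_scheme \<Rightarrow> ('v \<Rightarrow> 'v) \<Rightarrow> bool" where
  "linear_map V W f \<longleftrightarrow>
     f \<in> carrier V \<rightarrow> carrier W \<and>
     (\<forall>x\<in>carrier V. \<forall>y\<in>carrier V. f (x \<oplus>\<^bsub>V\<^esub> y) = f x \<oplus>\<^bsub>W\<^esub> f y) \<and>
     (\<forall>c. \<forall>x\<in>carrier V. f (c \<odot>\<^bsub>V\<^esub> x) = c \<odot>\<^bsub>W\<^esub> f x)"

text \<open>
  The signs in the last three axioms are those of a graded Lie algebra with respect to the
  shifted degree \<open>p - 1\<close>, acting by graded derivations of the cup product.
\<close>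

locale gerstenhaber_algebra =
  fixes V :: "int \<Rightarrow> ('k::field, 'v) module"
    and cup :: "int \<Rightarrow> int \<Rightarrow> 'v \<Rightarrow> 'v \<Rightarrow> 'v"
    and unit :: 'v
    and bracket :: "int \<Rightarrow> int \<Rightarrow> 'v \<Rightarrow> 'v \<Rightarrow> 'v"
  assumes vector_space: "Module.module (ring_of_type_algebra :: 'k ring) (V n)"
    and unit_closed: "unit \<in> carrier (V 0)"
    and cup_linear_left: "y \<in> carrier (V q) \<Longrightarrow> linear_map (V p) (V (p + q)) (\<lambda>x. cup p q x y)"
    and cup_linear_right: "x \<in> carrier (V p) \<Longrightarrow> linear_map (V q) (V (p + q)) (cup p q x)"
    and cup_unit: "x \<in> carrier (V p) \<Longrightarrow> cup 0 p unit x = x"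
    and cup_assoc: "x \<in> carrier (V p) \<Longrightarrow> y \<in> carrier (V q) \<Longrightarrow> z \<in> carrier (V r) \<Longrightarrow>
      cup (p + q) r (cup p q x y) z = cup p (q + r) x (cup q r y z)"
    and cup_commute: "x \<in> carrier (V p) \<Longrightarrow> y \<in> carrier (V q) \<Longrightarrow>
      cup p q x y = (-1) powi (p * q) \<odot>\<^bsub>V (p + q)\<^esub> cup q p y x"
    and bracket_linear_left: "y \<in> carrier (V q) \<Longrightarrow>
      linear_map (V p) (V (p + q - 1)) (\<lambda>x. bracket p q x y)"
    and bracket_linear_right: "x \<in> carrier (V p) \<Longrightarrow>
      linear_map (V q) (V (p + q - 1)) (bracket p q x)"
    and bracket_antisym: "x \<in> carrier (V p) \<Longrightarrow> y \<in> carrier (V q) \<Longrightarrow>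
      bracket p q x y = (- ((-1) powi ((p - 1) * (q - 1)))) \<odot>\<^bsub>V (p + q - 1)\<^esub> bracket q p y x"
    and jacobi: "x \<in> carrier (V p) \<Longrightarrow> y \<in> carrier (V q) \<Longrightarrow> z \<in> carrier (V r) \<Longrightarrow>
      bracket p (q + r - 1) x (bracket q r y z) =
        bracket (p + q - 1) r (bracket p q x y) z
        \<oplus>\<^bsub>V (p + q + r - 2)\<^esub> (-1) powi ((p - 1) * (q - 1))
          \<odot>\<^bsub>V (p + q + r - 2)\<^esub> bracket q (p + r - 1) y (bracket p r x z)"
    and poisson: "x \<in> carrier (V p) \<Longrightarrow> y \<in> carrier (V q) \<Longrightarrow> z \<in> carrier (V r) \<Longrightarrow>
      bracket p (q + r) x (cup q r y z) =
        cup (p + q - 1) r (bracket p q x y) z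
        \<oplus>\<^bsub>V (p + q + r - 1)\<^esub> (-1) powi ((p - 1) * q)
          \<odot>\<^bsub>V (p + q + r - 1)\<^esub> cup q (p + r - 1) y (bracket p r x z)"

text \<open>The component of \<open>\<Delta>\<close> in degree \<open>p\<close> is \<open>\<Delta> p\<close>, with values in degree \<open>p - 1\<close>.\<close>

locale bv_algebra = gerstenhaber_algebra V cup unit bracket
  for V :: "int \<Rightarrow> ('k::field, 'v) module"
    and cup :: "int \<Rightarrow> int \<Rightarrow> 'v \<Rightarrow> 'v \<Rightarrow> 'v"
    and unit :: 'v
    and bracket :: "int \<Rightarrow> int \<Rightarrow> 'v \<Rightarrow> 'v \<Rightarrow> 'v" +
  assumes bv_operator: "\<exists>\<Delta>.
    (\<forall>p. linear_map (V p) (V (p - 1)) (\<Delta> p)) \<and>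
    (\<forall>p. \<forall>x\<in>carrier (V p). \<Delta> (p - 1) (\<Delta> p x) = \<zero>\<^bsub>V (p - 2)\<^esub>) \<and>
    \<Delta> 0 unit = \<zero>\<^bsub>V (-1)\<^esub> \<and>
    (\<forall>p q. \<forall>x\<in>carrier (V p). \<forall>y\<in>carrier (V q).
      bracket p q x y =
        (-1) powi (p + 1) \<odot>\<^bsub>V (p + q - 1)\<^esub>
          (\<Delta> (p + q) (cup p q x y)
           \<ominus>\<^bsub>V (p + q - 1)\<^esub> cup (p - 1) q (\<Delta> p x) y
           \<ominus>\<^bsub>V (p + q - 1)\<^esub>
             (-1) powi p \<odot>\<^bsub>V (p + q - 1)\<^esub> cup p (q - 1) x (\<Delta> q y)))"

end

theory Submission
  imports Defs
begin

text \<open>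
  A nonzero left integral on \<open>H\<close> is a Frobenius form. Its Nakayama automorphism \<open>\<nu>\<close> satisfies
  Radford's formula: \<open>\<nu>\<^sup>2\<close> is built from windings by the modular character and conjugation by the
  distinguished group-like element, which have finite order and commute. So \<open>\<nu>\<close> has finite order,
  and in characteristic \<open>0\<close> averaging over its powers projects cochains onto \<open>\<nu>\<close>-invariant ones;
  since \<open>\<nu>\<close> acts trivially on cohomology, these compute \<open>HH\<^sup>*(H)\<close>. On invariant cochains, the
  adjoint under the Frobenius form of Connes' operator twisted by \<open>\<nu>\<close> commutes with the
  differential up to sign and induces \<open>\<Delta>\<close>. The BV identity, as well as the Poisson identity and the
  commutativity of the cup product, hold on cochains up to explicit homotopies.
\<close>

section \<open>Sums over deconcatenations of words\<close>

text \<open>The obstacle is that an integral is in general not a trace: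
  \<open>\<phi> (a * b) = \<phi> (b * \<nu> a)\<close>. Identifying H with its dual through
  \<open>\<phi>\<close> therefore twists letters by \<open>\<nu>\<close>, and the dual of Connes'
  operator fails to be a chain map by exactly \<open>f - twist f\<close> (\<open>bvd_dif\<close>).
  The same formula is what shows that \<open>\<nu>\<close> acts trivially on cohomology, with the
  operator itself as homotopy; what is then missing is an invariant representative of each class,
  and only for this is the finite order of \<open>\<nu>\<close> needed. The order is bounded without
  computing \<open>\<nu>\<close>. One formula expresses the square of the antipode by
  \<open>\<nu>\<close>; the same formula for the co-opposite Hopf algebra expresses its inverse by
  the same \<open>\<nu>\<close>. Composing the two eliminates the antipode and leaves
  \<open>\<nu>\<close> twice, together with maps of finite order. On the cochain side, the
  differential is the bracket with the multiplication, so its formal properties are consequences of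
  identities between insertions.\<close>

definition sg :: "int \<Rightarrow> 'a::ab_group_add \<Rightarrow> 'a" where
  "sg n x = (if even n then x else - x)"

lemma sg_add: "sg n (x + y) = sg n x + sg n y"
  by (simp add: sg_def)

lemma sg_minus: "sg n (- x) = - sg n x"
  by (simp add: sg_def)

lemma sg_diff: "sg n (x - y) = sg n x - sg n y"
  by (simp add: sg_def)

lemma sg_zero [simp]: "sg n 0 = 0"
  by (simp add: sg_def)

lemma sg_0 [simp]: "sg 0 x = x"
  by (simp add: sg_def)

lemma sg_sg [simp]: "sg m (sg n x) = sg (m + n) x"
  by (simp add: sg_def)

text \<open>Signs matter only through the parity of the exponent, so comparing two signs in the long
  computations becomes a parity goal. Keeping signs as an operation on abelian groups makes this
  available before any field is fixed.\<close>

lemma sg_cong: "even (m + n) \<Longrightarrow> sg m x = sg n x"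
  by (auto simp: sg_def)

lemma sg_cong_uminus: "odd (m + n) \<Longrightarrow> sg m x = - sg n x"
  by (auto simp: sg_def)

lemma sg_fun: "sg n f x = sg n (f x)"
  by (simp add: sg_def)

lemma sg_mult_left: "sg n (x::'a::ring) * y = sg n (x * y)"
  by (simp add: sg_def)

lemma sg_mult_right: "(x::'a::ring) * sg n y = sg n (x * y)"
  by (simp add: sg_def)

text \<open>The coproduct of the tensor coalgebra, evaluated by \<open>F\<close>: a sum over all
  cuts \<open>w = u @ v\<close>. Recursion on the word, in place of an indexed sum, makes
  reassociation and exchange of cuts provable by induction without index shifts;
  \<open>splitsum_eq_sum\<close> converts at the end.\<close>

primrec splitsum :: "('a list \<Rightarrow> 'a list \<Rightarrow> 'b::comm_monoid_add) \<Rightarrow> 'a list \<Rightarrow> 'b" where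
  "splitsum F [] = F [] []"
| "splitsum F (c # w) = F [] (c # w) + splitsum (\<lambda>u v. F (c # u) v) w"

lemma splitsum_cong:
  "(\<And>u v. w = u @ v \<Longrightarrow> F u v = G u v) \<Longrightarrow> splitsum F w = splitsum G w"
proof (induction w arbitrary: F G)
  case (Cons c w)
  have "splitsum (\<lambda>u v. F (c # u) v) w = splitsum (\<lambda>u v. G (c # u) v) w"
    by (rule Cons.IH) (rule Cons.prems, simp)
  moreover have "F [] (c # w) = G [] (c # w)"
    by (rule Cons.prems) simp
  ultimately show ?case
    by (simp only: splitsum.simps)
qed simp

lemma splitsum_add: "splitsum (\<lambda>u v. F u v + G u v) w = splitsum F w + splitsum G w"
  by (induction w arbitrary: F G) (auto simp: algebra_simps)

lemma splitsum_0 [simp]: "splitsum (\<lambda>u v. 0) w = 0"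
  by (induction w) auto

lemma splitsum_hom:
  "h 0 = 0 \<Longrightarrow> (\<And>x y. h (x + y) = h x + h y) \<Longrightarrow> h (splitsum F w) = splitsum (\<lambda>u v. h (F u v)) w"
  by (induction w arbitrary: F) auto

lemma splitsum_sg: "splitsum (\<lambda>u v. sg n (F u v)) w = sg n (splitsum F w)"
  by (rule splitsum_hom [symmetric]) (auto simp: sg_add)

lemma splitsum_minus: "splitsum (\<lambda>u v. - F u v :: 'b::ab_group_add) w = - splitsum F w"
  by (rule splitsum_hom [symmetric]) auto

lemma splitsum_diff:
  "splitsum (\<lambda>u v. F u v - G u v :: 'b::ab_group_add) w = splitsum F w - splitsum G w"
  using splitsum_add [of F "\<lambda>u v. - G u v" w] by (simp add: splitsum_minus)

lemma splitsum_mult_left: "splitsum F w * (c::'b::ring) = splitsum (\<lambda>u v. F u v * c) w"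
  by (rule splitsum_hom) (auto simp: distrib_right)

lemma splitsum_mult_right: "(c::'b::ring) * splitsum F w = splitsum (\<lambda>u v. c * F u v) w"
  by (rule splitsum_hom) (auto simp: distrib_left)

text \<open>Coassociativity: both sides run over the ways to cut \<open>w\<close> into three
  consecutive words.\<close>

lemma splitsum_assoc:
  "splitsum (\<lambda>y x. splitsum (\<lambda>u v. G u v x) y) w = splitsum (\<lambda>u r. splitsum (\<lambda>v x. G u v x) r) w"
  by (induction w arbitrary: G) (auto simp: splitsum_add algebra_simps)

lemma splitsum_commute:
  "splitsum (\<lambda>a b. splitsum (\<lambda>c d. F a b c d) w) v = splitsum (\<lambda>c d. splitsum (\<lambda>a b. F a b c d) v) w"
proof (induction v arbitrary: F)
  case (Cons c v)
  show ?case
    by (simp only: splitsum.simps splitsum_add Cons.IH [of "\<lambda>a. F (c # a)"])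
qed simp

text \<open>A cut of \<open>p @ c # q\<close> falls on exactly one side of the letter
  \<open>c\<close>. All later lemmas about a marked letter start from this.\<close>

lemma splitsum_append:
  "splitsum F (p @ c # q) = splitsum (\<lambda>u v. F u (v @ c # q)) p + splitsum (\<lambda>u v. F (p @ c # u) v) q"
  by (induction p arbitrary: F) (auto simp: algebra_simps)

lemma splitsum_Nil_right: "splitsum (\<lambda>u v. if v = [] then Z u else 0) w = Z w"
  by (induction w arbitrary: Z) auto

lemma splitsum_Nil_left: "splitsum (\<lambda>u v. if u = [] then Z v else 0) w = Z w"
  by (cases w) auto

lemma splitsum_map: "splitsum F (map h w) = splitsum (\<lambda>u v. F (map h u) (map h v)) w"
  by (induction w arbitrary: F) auto

lemma splitsum_eq_sum: "splitsum F w = (\<Sum>i\<le>length w. F (take i w) (drop i w))"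
proof (induction w arbitrary: F)
  case (Cons c w)
  have "(\<Sum>i\<le>length (c # w). F (take i (c # w)) (drop i (c # w)))
    = F [] (c # w) + (\<Sum>i\<le>length w. F (c # take i w) (drop i w))"
    by (simp add: sum.atMost_Suc_shift del: sum.atMost_Suc)
  then show ?case
    by (simp add: Cons.IH)
qed simp

text \<open>Additivity is kept apart from homogeneity and normalization: the identities between
  insertions hold for slot-additive functions over any ring, and so apply to the multiplication
  \<open>mul2\<close>, which is not normalized.\<close>

definition slot_additive :: "('a::ab_group_add list \<Rightarrow> 'b::ab_group_add) \<Rightarrow> bool" where
  "slot_additive F \<longleftrightarrow> (\<forall>u a b x. F (u @ (a + b) # x) = F (u @ a # x) + F (u @ b # x))"

lemma slot_additiveD:
  "slot_additive F \<Longrightarrow> F (u @ (a + b) # x) = F (u @ a # x) + F (u @ b # x)"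
  by (simp add: slot_additive_def)

lemma slot_zero: "slot_additive F \<Longrightarrow> F (u @ 0 # x) = 0"
  using slot_additiveD [of F u 0 0 x] by simp

lemma slot_minus: "slot_additive F \<Longrightarrow> F (u @ (- a) # x) = - F (u @ a # x)"
  using slot_additiveD [of F u a "- a" x] by (simp add: slot_zero eq_neg_iff_add_eq_0 add.commute)

lemma slot_sg: "slot_additive F \<Longrightarrow> F (u @ sg n a # x) = sg n (F (u @ a # x))"
  by (simp add: sg_def slot_minus)

lemma slot_splitsum:
  "slot_additive F \<Longrightarrow> F (u @ splitsum G w # x) = splitsum (\<lambda>a b. F (u @ G a b # x)) w"
  by (rule splitsum_hom [where h = "\<lambda>t. F (u @ t # x)"]) (auto simp: slot_zero slot_additiveD)

definition in_degree :: "int \<Rightarrow> ('a list \<Rightarrow> 'b::zero) \<Rightarrow> bool" where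
  "in_degree n f \<longleftrightarrow> (\<forall>w. int (length w) \<noteq> n \<longrightarrow> f w = 0)"

lemma in_degreeD: "in_degree n f \<Longrightarrow> int (length w) \<noteq> n \<Longrightarrow> f w = 0"
  by (simp add: in_degree_def)

section \<open>Insertion operators\<close>

text \<open>\<open>ins q g\<close> is dual to the coderivation of the tensor coalgebra defined by \<open>g\<close>.\<close>

definition ins :: "int \<Rightarrow> ('a list \<Rightarrow> 'a) \<Rightarrow> ('a list \<Rightarrow> 'b::ab_group_add) \<Rightarrow> 'a list \<Rightarrow> 'b" where
  "ins q g F w =
     splitsum (\<lambda>u r. splitsum (\<lambda>v x. sg ((q + 1) * int (length u)) (F (u @ g v # x))) r) w"

text \<open>The inserted block lies before the letter \<open>c\<close>, contains it, or lies after
  it. In the last case \<open>p\<close> and \<open>c\<close> both count for the sign.\<close>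

lemma ins_append:
  "ins q g F (p @ c # y) =
     ins q g (\<lambda>t. F (t @ c # y)) p
     + splitsum (\<lambda>u v. splitsum (\<lambda>v' x. sg ((q + 1) * int (length u)) (F (u @ g (v @ c # v') # x))) y) p
     + sg ((q + 1) * (int (length p) + 1)) (ins q g (\<lambda>t. F (p @ c # t)) y)"
  by (simp add: ins_def splitsum_append splitsum_add splitsum_sg [symmetric] algebra_simps)

lemma ins_add: "ins q g (\<lambda>w. F w + G w) w = ins q g F w + ins q g G w"
  by (simp add: ins_def sg_add splitsum_add)

lemma ins_minus: "ins q g (\<lambda>w. - F w) w = - ins q g F w"
  by (simp add: ins_def sg_minus splitsum_minus)

lemma ins_sg: "ins q g (\<lambda>w. sg n (F w)) w = sg n (ins q g F w)"
  by (simp add: ins_def splitsum_sg [symmetric] add.commute)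

lemma ins_arg_add: "slot_additive F \<Longrightarrow> ins q (\<lambda>v. g v + h v) F w = ins q g F w + ins q h F w"
  by (simp add: ins_def sg_add splitsum_add slot_additiveD)

lemma ins_arg_minus: "slot_additive F \<Longrightarrow> ins q (\<lambda>v. - g v) F w = - ins q g F w"
  by (simp add: ins_def sg_minus splitsum_minus slot_minus)

lemma ins_arg_sg: "slot_additive F \<Longrightarrow> ins q (\<lambda>v. sg n (g v)) F w = sg n (ins q g F w)"
  by (simp add: sg_def ins_arg_minus)

lemma ins_arg_diff: "slot_additive F \<Longrightarrow> ins q (\<lambda>v. g v - h v) F w = ins q g F w - ins q h F w"
  using ins_arg_add [of F q g "\<lambda>v. - h v" w] by (simp add: ins_arg_minus)

text \<open>Inserting into two slots at once gives the homotopy behind the Poisson identity.\<close>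

definition two_ins ::
  "int \<Rightarrow> int \<Rightarrow> ('a list \<Rightarrow> 'a) \<Rightarrow> ('a list \<Rightarrow> 'a) \<Rightarrow> ('a list \<Rightarrow> 'b::ab_group_add) \<Rightarrow> 'a list \<Rightarrow> 'b" where
  "two_ins q r g h F w =
     splitsum (\<lambda>U R. splitsum (\<lambda>v Z. sg ((r + 1) * int (length U)) (ins q g (\<lambda>t. F (t @ h v # Z)) U)) R) w"

text \<open>The block of \<open>h\<close> lies to the right of the value of \<open>g\<close>, inside
  its block, or to its left. The two outer cases change places, up to sign, when \<open>g\<close>
  and \<open>h\<close> do: this is Gerstenhaber's pre-Lie identity.\<close>

lemma ins_ins:
  fixes F :: "'a::ab_group_add list \<Rightarrow> 'b::ab_group_add"
  assumes F: "slot_additive F" and h: "in_degree r h"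
  shows "ins r h (ins q g F) w =
    two_ins q r g h F w + ins (q + r - 1) (ins r h g) F w
    + sg ((q - 1) * (r - 1)) (two_ins r q h g F w)"
proof -
  have 1: "ins (q + r - 1) (ins r h g) F w =
    splitsum (\<lambda>U R. splitsum (\<lambda>v Z. sg ((r + 1) * int (length U))
      (splitsum (\<lambda>u u2. splitsum (\<lambda>v' x. sg ((q + 1) * int (length u)) (F (u @ g (u2 @ h v # v') # x))) Z) U)) R) w"
  proof -
    have "ins (q + r - 1) (ins r h g) F w =
      splitsum (\<lambda>u R. splitsum (\<lambda>y x. splitsum (\<lambda>u2 R'. splitsum (\<lambda>v x1.
        sg ((q + r) * int (length u) + (r + 1) * int (length u2)) (F (u @ g (u2 @ h v # x1) # x))) R') y) R) w"
      by (simp add: ins_def slot_splitsum [OF F] slot_sg [OF F] splitsum_sg [symmetric])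
    also have "\<dots> = splitsum (\<lambda>u R. splitsum (\<lambda>u2 R1. splitsum (\<lambda>v R2. splitsum (\<lambda>x1 x.
        sg ((q + r) * int (length u) + (r + 1) * int (length u2)) (F (u @ g (u2 @ h v # x1) # x))) R2) R1) R) w"
      by (simp only: splitsum_assoc)
    also have "\<dots> = splitsum (\<lambda>U R. splitsum (\<lambda>u u2. splitsum (\<lambda>v R2. splitsum (\<lambda>x1 x.
        sg ((q + r) * int (length u) + (r + 1) * int (length u2)) (F (u @ g (u2 @ h v # x1) # x))) R2) R) U) w"
      by (rule splitsum_assoc [symmetric])
    also have "\<dots> = splitsum (\<lambda>U R. splitsum (\<lambda>v Z. splitsum (\<lambda>u u2. splitsum (\<lambda>v' x.
        sg ((q + r) * int (length u) + (r + 1) * int (length u2)) (F (u @ g (u2 @ h v # v') # x))) Z) U) R) w"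
      by (rule splitsum_cong, rule splitsum_commute)
    also have "\<dots> = splitsum (\<lambda>U R. splitsum (\<lambda>v Z. sg ((r + 1) * int (length U))
      (splitsum (\<lambda>u u2. splitsum (\<lambda>v' x. sg ((q + 1) * int (length u)) (F (u @ g (u2 @ h v # v') # x))) Z) U)) R) w"
      unfolding splitsum_sg [symmetric] sg_sg
      by (intro splitsum_cong sg_cong) auto
    finally show ?thesis .
  qed
  have 2: "sg ((q - 1) * (r - 1)) (two_ins r q h g F w) =
    splitsum (\<lambda>U R. splitsum (\<lambda>v Z. sg ((r + 1) * int (length U) + (q + 1) * (int (length U) + 1))
      (ins q g (\<lambda>t. F (U @ h v # t)) Z)) R) w"
  proof -
    have "sg ((q - 1) * (r - 1)) (two_ins r q h g F w) =
      splitsum (\<lambda>Y R. splitsum (\<lambda>v Z. splitsum (\<lambda>u R'. splitsum (\<lambda>v' x. sg ((q - 1) * (r - 1)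
        + (q + 1) * int (length Y) + (r + 1) * int (length u)) (F (u @ h v' # x @ g v # Z))) R') Y) R) w"
      by (simp add: two_ins_def ins_def splitsum_sg [symmetric] add.assoc)
    also have "\<dots> = splitsum (\<lambda>Y R. splitsum (\<lambda>v Z. splitsum (\<lambda>u R'. splitsum (\<lambda>v' x.
        sg ((r + 1) * int (length u) + (q + 1) * (int (length u) + 1) + (q + 1) * int (length x))
          (F (u @ h v' # x @ g v # Z))) R') Y) R) w"
    proof (intro splitsum_cong)
      \<comment> \<open>\<open>h v'\<close> is nonzero only if \<open>v'\<close> has length
        \<open>r\<close>. One side counts these \<open>r\<close> letters within \<open>Y\<close>,
        the other counts the single letter \<open>h v'\<close>; the discrepancy
        \<open>(q + 1) * (r - 1)\<close> is absorbed by the sign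
        \<open>(q - 1) * (r - 1)\<close>.\<close>
      fix Y R v Z u R' v' x :: "'a list"
      assume "Y = u @ R'" "R' = v' @ x"
      show "sg ((q - 1) * (r - 1) + (q + 1) * int (length Y) + (r + 1) * int (length u))
          (F (u @ h v' # x @ g v # Z)) =
        sg ((r + 1) * int (length u) + (q + 1) * (int (length u) + 1) + (q + 1) * int (length x))
          (F (u @ h v' # x @ g v # Z))"
      proof (cases "int (length v') = r")
        case True
        then show ?thesis
          unfolding \<open>Y = u @ R'\<close> \<open>R' = v' @ x\<close> by (intro sg_cong) auto
      qed (simp add: in_degreeD [OF h] slot_zero [OF F])
    qed
    also have "\<dots> = splitsum (\<lambda>Y R. splitsum (\<lambda>u R'. splitsum (\<lambda>v Z. splitsum (\<lambda>v' x.
        sg ((r + 1) * int (length u) + (q + 1) * (int (length u) + 1) + (q + 1) * int (length x))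
          (F (u @ h v' # x @ g v # Z))) R') R) Y) w"
      by (rule splitsum_cong, rule splitsum_commute)
    also have "\<dots> = splitsum (\<lambda>u T. splitsum (\<lambda>R' R. splitsum (\<lambda>v Z. splitsum (\<lambda>v' x.
        sg ((r + 1) * int (length u) + (q + 1) * (int (length u) + 1) + (q + 1) * int (length x))
          (F (u @ h v' # x @ g v # Z))) R') R) T) w"
      by (rule splitsum_assoc)
    also have "\<dots> = splitsum (\<lambda>u T. splitsum (\<lambda>R' R. splitsum (\<lambda>v' x. splitsum (\<lambda>v Z. 
        sg ((r + 1) * int (length u) + (q + 1) * (int (length u) + 1) + (q + 1) * int (length x))
          (F (u @ h v' # x @ g v # Z))) R) R') T) w"
      by (rule splitsum_cong, rule splitsum_cong, rule splitsum_commute)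
    also have "\<dots> = splitsum (\<lambda>u T. splitsum (\<lambda>v' T'. splitsum (\<lambda>x R. splitsum (\<lambda>v Z. 
        sg ((r + 1) * int (length u) + (q + 1) * (int (length u) + 1) + (q + 1) * int (length x))
          (F (u @ h v' # x @ g v # Z))) R) T') T) w"
      by (simp only: splitsum_assoc)
    also have "\<dots> = splitsum (\<lambda>U R. splitsum (\<lambda>v Z. sg ((r + 1) * int (length U) + (q + 1) * (int (length U) + 1))
      (ins q g (\<lambda>t. F (U @ h v # t)) Z)) R) w"
      by (simp add: ins_def splitsum_sg [symmetric])
    finally show ?thesis .
  qed
  have "ins r h (ins q g F) w =
    splitsum (\<lambda>U R. splitsum (\<lambda>v Z. sg ((r + 1) * int (length U)) (ins q g F (U @ h v # Z))) R) w"
    by (rule ins_def)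
  also have "\<dots> = two_ins q r g h F w + ins (q + r - 1) (ins r h g) F w
    + sg ((q - 1) * (r - 1)) (two_ins r q h g F w)"
    unfolding 1 2 two_ins_def [of q r g h F w] by (simp add: ins_append sg_add splitsum_add)
  finally show ?thesis .
qed

definition br :: "int \<Rightarrow> int \<Rightarrow> ('a list \<Rightarrow> 'a) \<Rightarrow> ('a list \<Rightarrow> 'a) \<Rightarrow> 'a list \<Rightarrow> 'a::ab_group_add" where
  "br p q f g w = ins q g f w - sg ((p - 1) * (q - 1)) (ins p f g w)"

text \<open>The outer terms of \<open>ins_ins\<close> cancel in the graded commutator, and the
  insertions of one argument into the other remain. Insertion thus represents the bracket by
  operators, which is why the Jacobi identity becomes formal.\<close>

lemma ins_commutator:
  assumes F: "slot_additive F" and g: "in_degree q g" and h: "in_degree r h"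
  shows "ins r h (ins q g F) w - sg ((q - 1) * (r - 1)) (ins q g (ins r h F) w) =
    ins (q + r - 1) (br q r g h) F w"
proof -
  have "ins (q + r - 1) (br q r g h) F w = ins (q + r - 1) (ins r h g) F w
    - sg ((q - 1) * (r - 1)) (ins (q + r - 1) (ins q g h) F w)"
    by (simp add: br_def [abs_def] ins_arg_diff [OF F] ins_arg_sg [OF F])
  moreover have "ins r h (ins q g F) w =
    two_ins q r g h F w + ins (q + r - 1) (ins r h g) F w
    + sg ((q - 1) * (r - 1)) (two_ins r q h g F w)"
    by (rule ins_ins [OF F h])
  moreover have "ins q g (ins r h F) w =
    two_ins r q h g F w + ins (q + r - 1) (ins q g h) F w
    + sg ((q - 1) * (r - 1)) (two_ins q r g h F w)"
    using ins_ins [OF F g, of r h w] by (simp add: mult.commute add.commute)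
  ultimately show ?thesis
    by (simp add: sg_def)
qed

lemma slot_additive_add: "slot_additive F \<Longrightarrow> slot_additive G \<Longrightarrow> slot_additive (F + G)"
  by (simp add: slot_additive_def algebra_simps)

lemma slot_additive_sg: "slot_additive F \<Longrightarrow> slot_additive (sg n F)"
  by (simp add: slot_additive_def sg_fun sg_add)

lemma slot_additive_diff: "slot_additive F \<Longrightarrow> slot_additive G \<Longrightarrow> slot_additive (F - G)"
  by (simp add: slot_additive_def algebra_simps)

lemma slot_additive_ins:
  assumes F: "slot_additive F" and g: "slot_additive g"
  shows "slot_additive (ins q g F)"
proof -
  have [simp]: "F (u @ a # x @ (b + c) # y) = F (u @ a # x @ b # y) + F (u @ a # x @ c # y)"
    for u a x b c y
    using slot_additiveD [OF F, of "u @ a # x" b c y] by simp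
  show ?thesis
    unfolding slot_additive_def
    by (simp add: ins_append ins_add sg_add splitsum_add slot_additiveD [OF F] slot_additiveD [OF g])
qed

lemma in_degree_add: "in_degree n F \<Longrightarrow> in_degree n G \<Longrightarrow> in_degree n (F + G :: 'a list \<Rightarrow> 'b::ab_group_add)"
  and in_degree_sg: "in_degree n F \<Longrightarrow> in_degree n (sg k F)"
  and in_degree_diff: "in_degree n F \<Longrightarrow> in_degree n G \<Longrightarrow> in_degree n (F - G)"
  by (simp_all add: in_degree_def sg_fun)

lemma in_degree_ins:
  assumes "slot_additive F" "in_degree p F" "in_degree q g"
  shows "in_degree (p + q - 1) (ins q g F)"
  unfolding in_degree_def
proof (intro allI impI)
  fix w :: "'a list"
  assume w: "int (length w) \<noteq> p + q - 1"
  have "ins q g F w = splitsum (\<lambda>u r. splitsum (\<lambda>v x. 0) r) w"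
    unfolding ins_def
  proof (intro splitsum_cong)
    fix u r v x :: "'a list"
    assume "w = u @ r" "r = v @ x"
    with w have "int (length (u @ g v # x)) \<noteq> p \<or> int (length v) \<noteq> q"
      by auto
    then show "sg ((q + 1) * int (length u)) (F (u @ g v # x)) = 0"
      using in_degreeD [OF assms(2)] in_degreeD [OF assms(3)] slot_zero [OF assms(1)] by auto
  qed
  then show "ins q g F w = 0"
    by simp
qed

definition dot :: "('a list \<Rightarrow> 'b) \<Rightarrow> ('a list \<Rightarrow> 'b) \<Rightarrow> 'a list \<Rightarrow> 'b::ring" where
  "dot f g w = splitsum (\<lambda>u v. f u * g v) w"

text \<open>The identity map as a 1-cochain. With it the multiplication is the 2-cochain
  \<open>mul2\<close>, and the outer terms of the differential are products with
  \<open>idc\<close>.\<close>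

definition idc :: "'a list \<Rightarrow> 'a::zero" where
  "idc w = (if length w = 1 then hd w else 0)"

abbreviation mul2 :: "'a list \<Rightarrow> 'a::ring" where
  "mul2 \<equiv> dot idc idc"

lemma idc_simps [simp]: "idc [] = 0" "idc [a] = a" "idc (a # b # w) = 0"
  by (simp_all add: idc_def)

lemma idc_append: "idc (u @ c # x) = (if x = [] then if u = [] then c else 0 else 0)"
  by (simp add: idc_def)

lemma dot_assoc: "dot (dot f g) h = dot f (dot g h)"
  by (rule ext) (simp add: dot_def splitsum_mult_left splitsum_mult_right mult.assoc splitsum_assoc)

lemma dot_add_left: "dot (f + g) h = dot f h + dot g h"
  and dot_add_right: "dot f (g + h) = dot f g + dot f h"
  and dot_diff_left: "dot (f - g) h = dot f h - dot g h"
  and dot_diff_right: "dot f (g - h) = dot f g - dot f h"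
  and dot_sg_left: "dot (sg n f) g = sg n (dot f g)"
  and dot_sg_right: "dot f (sg n g) = sg n (dot f g)"
  by (auto simp: fun_eq_iff dot_def sg_fun algebra_simps splitsum_add splitsum_diff splitsum_sg
      sg_mult_left sg_mult_right)

lemma dot_minus_left: "dot (- f) g = - dot f g"
  and dot_minus_right: "dot f (- g) = - dot f g"
  by (auto simp: fun_eq_iff dot_def splitsum_minus)

lemma dot_zero_left [simp]: "dot 0 g = 0" and dot_zero_right [simp]: "dot f 0 = 0"
  by (auto simp: fun_eq_iff dot_def)

lemma slot_additive_dot: "slot_additive f \<Longrightarrow> slot_additive g \<Longrightarrow> slot_additive (dot f g)"
  unfolding slot_additive_def
  by (simp add: dot_def splitsum_append algebra_simps splitsum_add)

lemma slot_additive_idc: "slot_additive idc"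
  by (simp add: slot_additive_def idc_append)

lemma in_degree_idc: "in_degree 1 idc"
  by (simp add: in_degree_def idc_def)

lemma in_degree_dot:
  assumes "in_degree p f" "in_degree q g"
  shows "in_degree (p + q) (dot f g)"
  unfolding in_degree_def
proof (intro allI impI)
  fix w :: "'a list"
  assume w: "int (length w) \<noteq> p + q"
  have "dot f g w = splitsum (\<lambda>u v. 0) w"
    unfolding dot_def
  proof (intro splitsum_cong)
    fix u v assume "w = u @ v"
    with w have "int (length u) \<noteq> p \<or> int (length v) \<noteq> q"
      by auto
    then show "f u * g v = 0"
      using in_degreeD [OF assms(1)] in_degreeD [OF assms(2)] by auto
  qed
  then show "dot f g w = 0"
    by simp
qed

lemma in_degree_mul2: "in_degree 2 mul2"
  using in_degree_dot [OF in_degree_idc in_degree_idc] by simp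

lemma slot_additive_mul2: "slot_additive mul2"
  by (intro slot_additive_dot slot_additive_idc)

lemma ins_plus: "ins q g (F + G) = ins q g F + ins q g G"
  by (rule ext) (simp add: plus_fun_def ins_add)

lemma ins_diff: "ins q g (F - G) = ins q g F - ins q g G"
proof (rule ext)
  fix w
  show "ins q g (F - G) w = (ins q g F - ins q g G) w"
    using ins_add [of q g F "\<lambda>w. - G w" w] by (simp add: fun_diff_def ins_minus)
qed

lemma ins_sg_fun: "ins q g (sg n F) = sg n (ins q g F)"
  by (rule ext) (simp add: sg_fun [abs_def] ins_sg)

lemma ins_zero [simp]: "ins q g 0 = 0"
  by (rule ext) (simp add: ins_def)

lemma ins_arg_plus: "slot_additive F \<Longrightarrow> ins q (g + h) F = ins q g F + ins q h F"
  and ins_arg_diff_fun: "slot_additive F \<Longrightarrow> ins q (g - h) F = ins q g F - ins q h F"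
  and ins_arg_sg_fun: "slot_additive F \<Longrightarrow> ins q (sg n g) F = sg n (ins q g F)"
  by (rule ext, simp add: plus_fun_def fun_diff_def sg_fun [abs_def] ins_arg_add ins_arg_diff ins_arg_sg)+

lemma ins_arg_zero [simp]: "slot_additive F \<Longrightarrow> ins q 0 F = 0"
  by (rule ext) (simp add: ins_def slot_zero)

lemma br_fun: "br p q f g = ins q g f - sg ((p - 1) * (q - 1)) (ins p f g)"
  by (rule ext) (simp add: br_def sg_fun)

text \<open>The cut of the word falls behind or before the inserted letter; in the second case the
  left part \<open>u\<close> is passed, which is the source of the sign.\<close>

lemma ins_splitsum:
  fixes G :: "'a list \<Rightarrow> 'a list \<Rightarrow> 'b::ab_group_add"
  shows "ins r h (splitsum G) w = splitsum (\<lambda>u v. ins r h (\<lambda>t. G t v) u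
    + sg ((r + 1) * int (length u)) (ins r h (G u) v)) w"
proof -
  have "splitsum (\<lambda>U R. splitsum (\<lambda>v x. sg ((r + 1) * int (length U))
      (splitsum (\<lambda>a b. G a (b @ h v # x)) U)) R) w =
    splitsum (\<lambda>U R. splitsum (\<lambda>v x. splitsum (\<lambda>a b.
      sg ((r + 1) * int (length a) + (r + 1) * int (length b)) (G a (b @ h v # x))) U) R) w"
    unfolding splitsum_sg [symmetric] by (intro splitsum_cong sg_cong) auto
  also have "\<dots> = splitsum (\<lambda>U R. splitsum (\<lambda>a b. splitsum (\<lambda>v x.
      sg ((r + 1) * int (length a) + (r + 1) * int (length b)) (G a (b @ h v # x))) R) U) w"
    by (rule splitsum_cong, rule splitsum_commute)
  also have "\<dots> = splitsum (\<lambda>a T. splitsum (\<lambda>b R. splitsum (\<lambda>v x.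
      sg ((r + 1) * int (length a) + (r + 1) * int (length b)) (G a (b @ h v # x))) R) T) w"
    by (rule splitsum_assoc)
  also have "\<dots> = splitsum (\<lambda>u v. sg ((r + 1) * int (length u)) (ins r h (G u) v)) w"
    by (simp add: ins_def splitsum_sg [symmetric])
  finally have 1: "splitsum (\<lambda>U R. splitsum (\<lambda>v x. sg ((r + 1) * int (length U))
      (splitsum (\<lambda>a b. G a (b @ h v # x)) U)) R) w =
    splitsum (\<lambda>u v. sg ((r + 1) * int (length u)) (ins r h (G u) v)) w" .
  have 2: "splitsum (\<lambda>u v. ins r h (\<lambda>t. G t v) u) w =
    splitsum (\<lambda>U R. splitsum (\<lambda>v x. sg ((r + 1) * int (length U))
      (splitsum (\<lambda>a b. G (U @ h v # a) b) x)) R) w"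
    by (simp add: ins_def splitsum_assoc splitsum_sg [symmetric])
  show ?thesis
    unfolding splitsum_add 1 [symmetric] 2
    by (simp add: ins_def splitsum_append sg_add splitsum_add add.commute)
qed

lemma ins_mult_left: "ins r h (\<lambda>t. f t * (c::'b::ring)) w = ins r h f w * c"
  by (simp add: ins_def splitsum_mult_left sg_mult_left)

lemma ins_mult_right: "ins r h (\<lambda>t. (c::'b::ring) * f t) w = c * ins r h f w"
  by (simp add: ins_def splitsum_mult_right sg_mult_right)

lemma splitsum_left_degree:
  assumes "\<And>u v. int (length u) \<noteq> p \<Longrightarrow> G u v = 0"
  shows "splitsum (\<lambda>u v. sg (k * int (length u)) (G u v)) w = sg (k * p) (splitsum G w)"
  unfolding splitsum_sg [symmetric]
proof (rule splitsum_cong)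
  fix u v :: "'a list"
  show "sg (k * int (length u)) (G u v) = sg (k * p) (G u v)"
    using assms [of u v] by (cases "int (length u) = p") auto
qed

text \<open>Insertion into a product is a graded derivation on the nose, so this half of the Poisson
  identity needs no homotopy.\<close>

lemma ins_dot:
  fixes f g :: "'a list \<Rightarrow> 'b::ring"
  assumes f: "in_degree p f"
  shows "ins r h (dot f g) = dot (ins r h f) g + sg ((r + 1) * p) (dot f (ins r h g))"
proof
  fix w :: "'a list"
  have "splitsum (\<lambda>u v. sg ((r + 1) * int (length u)) (f u * ins r h g v)) w =
    sg ((r + 1) * p) (dot f (ins r h g) w)"
    unfolding dot_def by (rule splitsum_left_degree) (simp add: in_degreeD [OF f])
  then show "ins r h (dot f g) w = (dot (ins r h f) g + sg ((r + 1) * p) (dot f (ins r h g))) w"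
    by (simp add: dot_def [of f g, abs_def] ins_splitsum ins_mult_left ins_mult_right splitsum_add
        sg_fun dot_def [of "ins r h f"])
qed

lemma ins_idc: "ins r h idc = h"
proof
  fix w
  have "ins r h idc w = splitsum (\<lambda>u R. if u = [] then
      splitsum (\<lambda>v x. if x = [] then h v else 0) R else 0) w"
    unfolding ins_def by (intro splitsum_cong) (auto simp: idc_append cong: if_cong intro!: splitsum_cong)
  then show "ins r h idc w = h w"
    by (simp only: splitsum_Nil_right splitsum_Nil_left)
qed

section \<open>The differential and its homotopies\<close>

text \<open>The Hochschild differential written with products and insertions: the inner terms, which
  multiply two neighbouring arguments, are the insertion of \<open>mul2\<close>. The agreement with
  the indexed formula is \<open>hochschild_diff_eq_dif\<close>.\<close>

definition dif :: "int \<Rightarrow> ('a list \<Rightarrow> 'a) \<Rightarrow> 'a list \<Rightarrow> 'a::ring" where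
  "dif p f = dot f idc + sg (p + 1) (dot idc f) + sg p (ins 2 mul2 f)"

lemma ins_mul2: "ins p f mul2 = dot f idc + sg (p + 1) (dot idc f)"
  by (simp add: ins_dot [OF in_degree_idc] ins_idc)

text \<open>Because the differential is the bracket with the multiplication, its compatibility with
  brackets is a case of the Jacobi identity.\<close>

lemma br_mul2: "br 2 p mul2 f = dif p f"
proof -
  have "sg ((2 - 1) * (p - 1)) (ins 2 mul2 f) = - sg p (ins 2 mul2 f)"
    by (rule sg_cong_uminus) auto
  then show ?thesis
    by (simp add: br_fun dif_def ins_mul2)
qed

lemma dif_add: "dif p (f + g) = dif p f + dif p g"
  by (simp add: dif_def dot_add_left dot_add_right ins_plus sg_add algebra_simps)

lemma dif_sg: "dif p (sg n f) = sg n (dif p f)"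
  by (simp add: dif_def dot_sg_left dot_sg_right ins_sg_fun sg_add algebra_simps)

lemma dif_diff: "dif p (f - g) = dif p f - dif p g"
  by (simp add: dif_def dot_diff_left dot_diff_right ins_diff sg_diff algebra_simps)

lemma dif_zero [simp]: "dif p 0 = 0"
  by (simp add: dif_def)

lemma slot_additive_dif: "slot_additive f \<Longrightarrow> slot_additive (dif p f)"
  unfolding dif_def
  by (intro slot_additive_add slot_additive_sg slot_additive_dot slot_additive_ins
      slot_additive_idc)

lemma in_degree_dif:
  assumes "slot_additive f" "in_degree p f"
  shows "in_degree (p + 1) (dif p f)"
  unfolding dif_def
  using in_degree_dot [OF assms(2) in_degree_idc] in_degree_dot [OF in_degree_idc assms(2)] in_degree_ins [OF assms in_degree_mul2]
  by (intro in_degree_add in_degree_sg) (simp_all add: add.commute)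

text \<open>In this sign convention the differential is a derivation acting from the right: it
  passes \<open>g\<close>, not \<open>f\<close>, to reach the other factor.\<close>

lemma dif_dot:
  assumes "in_degree p f"
  shows "dif (p + q) (dot f g) = dot f (dif q g) + sg q (dot (dif p f) g)"
  by (cases "even p"; cases "even q")
    (simp_all add: dif_def dot_add_left dot_add_right dot_diff_left dot_diff_right dot_sg_left dot_sg_right sg_add
      ins_dot [OF assms] dot_assoc sg_def)

lemma ins_commutator_fun:
  assumes "slot_additive F" "in_degree q g" "in_degree r h"
  shows "ins (q + r - 1) (br q r g h) F =
    ins r h (ins q g F) - sg ((q - 1) * (r - 1)) (ins q g (ins r h F))"
  by (rule ext) (simp add: ins_commutator [OF assms, symmetric] sg_fun)

lemma jacobi_br:
  fixes x y z :: "'a::ab_group_add list \<Rightarrow> 'a"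
  assumes x: "slot_additive x" "in_degree p x" and y: "slot_additive y" "in_degree q y"
    and z: "slot_additive z" "in_degree r z"
  shows "br p (q + r - 1) x (br q r y z) =
    br (p + q - 1) r (br p q x y) z + sg ((p - 1) * (q - 1)) (br q (p + r - 1) y (br p r x z))"
  unfolding br_fun [of p "q + r - 1"] br_fun [of "p + q - 1" r] br_fun [of q "p + r - 1"]
    ins_commutator_fun [OF x(1) y(2) z(2)] ins_commutator_fun [OF z(1) x(2) y(2)]
    ins_commutator_fun [OF y(1) x(2) z(2)]
  unfolding br_fun [of p q] br_fun [of q r] br_fun [of p r] ins_diff ins_sg_fun
  by (cases "even p"; cases "even q"; cases "even r") (simp_all add: sg_def)

text \<open>This is the associativity of the algebra.\<close>

lemma mul2_mul2: "ins 2 mul2 mul2 = (0 :: 'a::ring list \<Rightarrow> 'a)"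
  unfolding ins_mul2 by (simp add: dot_assoc sg_def)

lemma dif_br:
  fixes f g :: "'a::ring list \<Rightarrow> 'a"
  assumes f: "slot_additive f" "in_degree p f" and g: "slot_additive g" "in_degree q g"
  shows "dif (p + q - 1) (br p q f g) = br (p + 1) q (dif p f) g + sg (p - 1) (br p (q + 1) f (dif q g))"
  using jacobi_br [OF slot_additive_mul2 in_degree_mul2 f g]
  by (simp add: br_mul2 add.commute)

text \<open>The Jacobi identity alone gives only twice the square of the differential. The direct
  computation uses that in \<open>ins_ins\<close> with both arguments \<open>mul2\<close> the two
  outer terms are equal and have opposite signs, while the inner term vanishes by
  associativity.\<close>

lemma dif_dif:
  fixes f :: "'a::ring list \<Rightarrow> 'a"
  assumes f: "slot_additive f" "in_degree p f"
  shows "dif (p + 1) (dif p f) = 0"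
proof -
  have "ins (p + 1) (dif p f) mul2 = ins p f (ins 2 mul2 mul2) - sg (p - 1) (ins 2 mul2 (ins p f mul2))"
    using ins_commutator_fun [OF slot_additive_mul2 in_degree_mul2 f(2)] by (simp add: br_mul2 add.commute)
  then have 1: "ins (p + 1) (dif p f) mul2 = sg p (ins 2 mul2 (ins p f mul2))"
    by (simp add: mul2_mul2 sg_def)
  have 2: "ins 2 mul2 (ins 2 mul2 f) = 0"
    using ins_ins [OF f(1) in_degree_mul2, of 2 mul2] by (auto simp: fun_eq_iff mul2_mul2 sg_def f(1))
  have 3: "dif p f = ins p f mul2 + sg p (ins 2 mul2 f)"
    by (simp only: dif_def ins_mul2)
  have "dif (p + 1) (dif p f) = ins (p + 1) (dif p f) mul2 + sg (p + 1) (ins 2 mul2 (dif p f))"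
    by (simp only: dif_def [of "p + 1"] ins_mul2)
  also have "\<dots> = sg p (ins 2 mul2 (ins p f mul2)) + sg (p + 1) (ins 2 mul2 (ins p f mul2))"
    unfolding 1 by (simp only: 3 ins_plus ins_sg_fun 2 sg_zero add_0_right)
  finally show ?thesis
    by (simp add: sg_def)
qed

text \<open>Insertion of \<open>g\<close> is a homotopy between the two products of \<open>f\<close> and \<open>g\<close>.\<close>

lemma ins_dif:
  fixes f g :: "'a::ring list \<Rightarrow> 'a"
  assumes f: "slot_additive f" "in_degree p f" and g: "in_degree q g"
  shows "ins q g (dif p f) = dif (p + q - 1) (ins q g f) + sg ((q + 1) * p) (dot f g)
    + sg (p + 1) (dot g f) + sg p (ins (q + 1) (dif q g) f)"
proof -
  have "ins (q + 1) (dif q g) f = ins q g (ins 2 mul2 f) - sg (q - 1) (ins 2 mul2 (ins q g f))"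
    using ins_commutator_fun [OF f(1) in_degree_mul2 g] by (simp add: br_mul2 add.commute)
  then show ?thesis
    by (cases "even p"; cases "even q")
      (simp_all add: dif_def ins_plus ins_diff ins_sg_fun ins_dot [OF f(2)] ins_dot [OF in_degree_idc] ins_idc sg_add
        sg_def)
qed

section \<open>The differential on words with a marked letter\<close>

lemma ins_zero_arg [simp]: "ins q g (\<lambda>w. 0) w = 0"
  by (simp add: ins_def)

lemma sum_sg: "(\<Sum>i\<in>A. sg n (f i)) = sg n (\<Sum>i\<in>A. f i)"
  by (simp add: sg_def sum_negf)

lemma splitsum_add_fun:
  "splitsum (\<lambda>u v. F u v + G u v) = (\<lambda>w. splitsum F w + splitsum G w)"
  by (rule ext) (rule splitsum_add)

lemma ins_splitsum_param:
  "ins q g (\<lambda>t. splitsum (\<lambda>a b. G a b t) w) U = splitsum (\<lambda>a b. ins q g (G a b) U) w"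
  by (induction w arbitrary: G) (auto simp: ins_add)

lemma splitsum_idc_right:
  "(\<And>u. G u 0 = 0) \<Longrightarrow> splitsum (\<lambda>u v. G u (idc v)) w = (if w = [] then 0 else G (butlast w) (last w))"
proof (induction w arbitrary: G)
  case (Cons c w)
  have "splitsum (\<lambda>u v. G u (idc v)) (c # w) = G [] (idc (c # w)) + splitsum (\<lambda>u v. G (c # u) (idc v)) w"
    by (rule splitsum.simps)
  also have "splitsum (\<lambda>u v. G (c # u) (idc v)) w = (if w = [] then 0 else G (c # butlast w) (last w))"
    by (rule Cons.IH) (rule Cons.prems)
  finally show ?case
    by (cases w) (auto simp: Cons.prems)
qed simp

lemma splitsum_idc_left:
  "(\<And>v. G 0 v = 0) \<Longrightarrow> splitsum (\<lambda>u v. G (idc u) v) w = (if w = [] then 0 else G (hd w) (tl w))"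
proof (cases w)
  case (Cons c w')
  assume "\<And>v. G 0 v = 0"
  then show ?thesis
    unfolding Cons by (cases w') auto
qed simp

lemma mul2_append:
  "mul2 (b @ e # c) = (if c = [] then idc b * e else 0) + (if b = [] then e * idc c else (0::'a::ring))"
proof -
  have "mul2 (b @ e # c) = splitsum (\<lambda>u v. if v = [] then (if c = [] then idc u * e else 0) else 0) b
    + splitsum (\<lambda>u v. if u = [] then (if b = [] then e * idc v else 0) else 0) c"
    unfolding dot_def splitsum_append
    by (intro arg_cong2 [of _ _ _ _ "(+)"] splitsum_cong) (auto simp: idc_append)
  then show ?thesis
    by (simp only: splitsum_Nil_right splitsum_Nil_left)
qed

lemma dot_idc_append:
  "dot f idc (t @ e # c) = splitsum (\<lambda>a b. f (t @ e # a) * idc b) c + (if c = [] then f t * e else 0)"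
proof -
  have "dot f idc (t @ e # c) = splitsum (\<lambda>a b. if b = [] then (if c = [] then f a * e else 0) else 0) t
    + splitsum (\<lambda>a b. f (t @ e # a) * idc b) c"
    unfolding dot_def splitsum_append
    by (intro arg_cong2 [of _ _ _ _ "(+)"] splitsum_cong) (auto simp: idc_append)
  then show ?thesis
    by (simp only: splitsum_Nil_right add.commute)
qed

lemma idc_dot_append:
  "dot idc f (t @ e # c) = splitsum (\<lambda>a b. idc a * f (b @ e # c)) t + (if t = [] then e * f c else 0)"
proof -
  have "dot idc f (t @ e # c) = splitsum (\<lambda>a b. idc a * f (b @ e # c)) t
    + splitsum (\<lambda>a b. if a = [] then (if t = [] then e * f b else 0) else 0) c"
    unfolding dot_def splitsum_append
    by (intro arg_cong2 [of _ _ _ _ "(+)"] splitsum_cong) (auto simp: idc_append)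
  then show ?thesis
    by (simp only: splitsum_Nil_left)
qed

text \<open>A product of neighbouring letters happens left of the marked letter \<open>e\<close>,
  between \<open>e\<close> and its left neighbour, between \<open>e\<close> and its right neighbour,
  or right of \<open>e\<close>.\<close>

lemma ins_mul2_append:
  fixes F :: "'a::ring list \<Rightarrow> 'b::ab_group_add"
  assumes F: "slot_additive F"
  shows "ins 2 mul2 F (p @ e # y) = ins 2 mul2 (\<lambda>t. F (t @ e # y)) p
    + splitsum (\<lambda>a b. sg (int (length a)) (F (a @ (idc b * e) # y))) p
    + splitsum (\<lambda>c d. sg (int (length p)) (F (p @ (e * idc c) # d))) y
    + sg (int (length p) + 1) (ins 2 mul2 (\<lambda>t. F (p @ e # t)) y)"
proof -
  have "splitsum (\<lambda>u v. splitsum (\<lambda>v' x. sg ((2 + 1) * int (length u)) (F (u @ mul2 (v @ e # v') # x))) y) p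
    = splitsum (\<lambda>u v. splitsum (\<lambda>v' x. if v' = [] then sg (int (length u)) (F (u @ (idc v * e) # x)) else 0) y) p
    + splitsum (\<lambda>u v. if v = [] then splitsum (\<lambda>v' x. sg (int (length u)) (F (u @ (e * idc v') # x))) y else 0) p"
    unfolding splitsum_add [symmetric]
    by (intro splitsum_cong)
      (auto simp: mul2_append slot_additiveD [OF F] slot_zero [OF F] sg_add splitsum_add [symmetric]
        intro!: splitsum_cong sg_cong arg_cong2 [of _ _ _ _ "(+)"])
  also have "\<dots> = splitsum (\<lambda>a b. sg (int (length a)) (F (a @ (idc b * e) # y))) p
    + splitsum (\<lambda>c d. sg (int (length p)) (F (p @ (e * idc c) # d))) y"
    by (simp only: splitsum_Nil_right splitsum_Nil_left)
  finally have 1: "splitsum (\<lambda>u v. splitsum (\<lambda>v' x. sg ((2 + 1) * int (length u)) (F (u @ mul2 (v @ e # v') # x))) y) p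
    = splitsum (\<lambda>a b. sg (int (length a)) (F (a @ (idc b * e) # y))) p
    + splitsum (\<lambda>c d. sg (int (length p)) (F (p @ (e * idc c) # d))) y" .
  have 2: "sg ((2 + 1) * (int (length p) + 1)) x = sg (int (length p) + 1) x" for x :: 'b
    by (intro sg_cong) auto
  show ?thesis
    unfolding ins_append 1 2 by (simp add: add.assoc)
qed

lemma dot_idc_right: "dot f idc w = (if w = [] then 0 else f (butlast w) * last w)"
  unfolding dot_def by (rule splitsum_idc_right) simp

lemma dot_idc_left: "dot idc f w = (if w = [] then 0 else hd w * f (tl w))"
  unfolding dot_def by (rule splitsum_idc_left) simp

text \<open>The factor \<open>idc\<close> takes the last letter, which is either an original letter
  or the value of \<open>z\<close>; in the second case \<open>z\<close> splits off as a factor. In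
  \<open>two_ins_idc_dot\<close> the same happens with the first letter and
  \<open>y\<close>.\<close>

lemma two_ins_dot_idc:
  fixes x y z :: "'a::ring list \<Rightarrow> 'a"
  assumes x: "slot_additive x" "in_degree p x" and y: "in_degree q y"
  shows "two_ins q r y z (dot x idc) =
    dot (two_ins q r y z x) idc + sg ((r + 1) * (p + q - 1)) (dot (ins q y x) z)"
proof
  fix w
  have 2: "ins q y (\<lambda>t. dot x idc (t @ e # c)) U =
    splitsum (\<lambda>a b. ins q y (\<lambda>t. x (t @ e # a)) U * idc b) c + (if c = [] then ins q y x U * e else 0)"
    for e c U
    unfolding dot_idc_append ins_add ins_splitsum_param by (simp add: ins_mult_left)
  have "two_ins q r y z (dot x idc) w =
    splitsum (\<lambda>U R. splitsum (\<lambda>v c. splitsum (\<lambda>a b. sg ((r + 1) * int (length U))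
      (ins q y (\<lambda>t. x (t @ z v # a)) U * idc b)) c) R) w
    + splitsum (\<lambda>U R. splitsum (\<lambda>v c. if c = [] then sg ((r + 1) * int (length U)) (ins q y x U * z v) else 0) R) w"
    unfolding two_ins_def 2 sg_add splitsum_add splitsum_sg
    by (intro arg_cong2 [of _ _ _ _ "(+)"] splitsum_cong) (auto simp: splitsum_sg [symmetric] intro!: splitsum_cong)
  also have "splitsum (\<lambda>U R. splitsum (\<lambda>v c. if c = [] then sg ((r + 1) * int (length U)) (ins q y x U * z v) else 0) R) w
    = sg ((r + 1) * (p + q - 1)) (dot (ins q y x) z w)"
    unfolding splitsum_Nil_right dot_def
    by (rule splitsum_left_degree) (simp add: in_degreeD [OF in_degree_ins [OF x y]])
  finally show "two_ins q r y z (dot x idc) w =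
    (dot (two_ins q r y z x) idc + sg ((r + 1) * (p + q - 1)) (dot (ins q y x) z)) w"
    by (simp add: dot_def [of "two_ins q r y z x"] two_ins_def splitsum_mult_left splitsum_assoc sg_mult_left sg_fun)
qed

lemma two_ins_idc_dot:
  fixes x y z :: "'a::ring list \<Rightarrow> 'a"
  assumes y: "in_degree q y"
  shows "two_ins q r y z (dot idc x) =
    sg ((r + 1) * q) (dot y (ins r z x)) + sg (q + r) (dot idc (two_ins q r y z x))"
proof
  fix w
  have 1: "dot idc x (t @ e # c) = dot idc (\<lambda>t. x (t @ e # c)) t + (if t = [] then e * x c else 0)"
    for t e c
    by (simp only: idc_dot_append dot_def [of idc "\<lambda>t. x (t @ e # c)"])
  have 2: "ins q y (\<lambda>t. dot idc x (t @ e # c)) U =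
    dot y (\<lambda>t. x (t @ e # c)) U + sg (q + 1) (dot idc (ins q y (\<lambda>t. x (t @ e # c))) U)" for e c U
  proof -
    have "ins q y (\<lambda>t. if t = [] then e * x c else 0) U = 0"
      by (simp add: ins_def)
    then show ?thesis
      unfolding 1 ins_add
      by (simp add: ins_dot [OF in_degree_idc] ins_idc sg_fun)
  qed
  have "two_ins q r y z (dot idc x) w =
    splitsum (\<lambda>U R. splitsum (\<lambda>v c. sg ((r + 1) * int (length U)) (dot y (\<lambda>t. x (t @ z v # c)) U)) R) w
    + splitsum (\<lambda>U R. splitsum (\<lambda>v c. sg ((r + 1) * int (length U) + (q + 1))
        (dot idc (ins q y (\<lambda>t. x (t @ z v # c))) U)) R) w"
    unfolding two_ins_def 2 by (simp add: sg_add splitsum_add_fun)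
  also have "splitsum (\<lambda>U R. splitsum (\<lambda>v c. sg ((r + 1) * int (length U)) (dot y (\<lambda>t. x (t @ z v # c)) U)) R) w
    = splitsum (\<lambda>U R. splitsum (\<lambda>v c. splitsum (\<lambda>a b. sg ((r + 1) * int (length a) + (r + 1) * int (length b))
      (y a * x (b @ z v # c))) U) R) w"
    unfolding dot_def splitsum_sg [symmetric] by (intro splitsum_cong sg_cong) auto
  also have "\<dots> = splitsum (\<lambda>U R. splitsum (\<lambda>a b. splitsum (\<lambda>v c. sg ((r + 1) * int (length a) + (r + 1) * int (length b))
      (y a * x (b @ z v # c))) R) U) w"
    by (rule splitsum_cong, rule splitsum_commute)
  also have "\<dots> = splitsum (\<lambda>a T. sg ((r + 1) * int (length a)) (y a * ins r z x T)) w"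
    unfolding splitsum_assoc by (simp add: ins_def splitsum_mult_right sg_mult_right splitsum_sg [symmetric])
  also have "\<dots> = sg ((r + 1) * q) (dot y (ins r z x) w)"
    unfolding dot_def by (rule splitsum_left_degree) (simp add: in_degreeD [OF y])
  also have "splitsum (\<lambda>U R. splitsum (\<lambda>v c. sg ((r + 1) * int (length U) + (q + 1))
        (dot idc (ins q y (\<lambda>t. x (t @ z v # c))) U)) R) w
    = splitsum (\<lambda>U R. splitsum (\<lambda>v c. splitsum (\<lambda>a b. sg ((r + 1) * int (length a) + ((r + 1) * int (length b) + (q + 1)))
      (idc a * ins q y (\<lambda>t. x (t @ z v # c)) b)) U) R) w"
    unfolding dot_def splitsum_sg [symmetric] by (intro splitsum_cong sg_cong) auto
  also have "\<dots> = splitsum (\<lambda>U R. splitsum (\<lambda>a b. splitsum (\<lambda>v c. sg ((r + 1) * int (length a) + ((r + 1) * int (length b) + (q + 1)))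
      (idc a * ins q y (\<lambda>t. x (t @ z v # c)) b)) R) U) w"
    by (rule splitsum_cong, rule splitsum_commute)
  also have "\<dots> = splitsum (\<lambda>a T. sg ((r + 1) * int (length a)) (idc a * sg (q + 1) (two_ins q r y z x T))) w"
    unfolding splitsum_assoc
    by (simp add: two_ins_def splitsum_mult_right sg_mult_right splitsum_sg [symmetric] algebra_simps)
  also have "\<dots> = sg ((r + 1) * 1) (splitsum (\<lambda>a T. idc a * sg (q + 1) (two_ins q r y z x T)) w)"
    by (rule splitsum_left_degree) (simp add: in_degreeD [OF in_degree_idc])
  also have "\<dots> = sg (q + r) (dot idc (two_ins q r y z x) w)"
    unfolding sg_mult_right splitsum_sg dot_def sg_sg by (intro sg_cong) auto
  finally show "two_ins q r y z (dot idc x) w =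
    (sg ((r + 1) * q) (dot y (ins r z x)) + sg (q + r) (dot idc (two_ins q r y z x))) w"
    by (simp add: sg_fun)
qed

text \<open>Since \<open>g\<close> vanishes off length \<open>q\<close>, only the position of the
  block remains free. This connects the sums over cuts with the indexed sums in the given
  definitions.\<close>

lemma ins_eq_sum:
  assumes f: "slot_additive f" and g: "in_degree q g" and w: "int (length w) = p + q - 1"
  shows "ins q g f w = (\<Sum>i=1..nat p. sg ((q - 1) * (int i - 1))
    (f (take (i - 1) w @ g (take (nat q) (drop (i - 1) w)) # drop (i - 1 + nat q) w)))"
proof (cases "q \<ge> 0")
  case True
  let ?T = "\<lambda>i. sg ((q - 1) * int i) (f (take i w @ g (take (nat q) (drop i w)) # drop (i + nat q) w))"
  have inner: "splitsum (\<lambda>v x. sg ((q + 1) * int (length (take i w))) (f (take i w @ g v # x))) (drop i w)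
    = (if i < nat p then ?T i else 0)" if "i \<le> length w" for i
  proof -
    have "splitsum (\<lambda>v x. sg ((q + 1) * int (length (take i w))) (f (take i w @ g v # x))) (drop i w)
      = (\<Sum>j\<le>length w - i. if j = nat q then ?T i else 0)"
      unfolding splitsum_eq_sum length_drop
    proof (rule sum.cong [OF refl])
      fix j assume j: "j \<in> {..length w - i}"
      show "sg ((q + 1) * int (length (take i w))) (f (take i w @ g (take j (drop i w)) # drop j (drop i w)))
        = (if j = nat q then ?T i else 0)"
      proof (cases "j = nat q")
        case eq: True
        have "sg ((q + 1) * int (length (take i w))) y = sg ((q - 1) * int i) y" for y :: 'b
          using that by (intro sg_cong) auto
        then show ?thesis
          by (simp add: eq add.commute)
      next
        case False
        then have "g (take j (drop i w)) = 0"
          using True j by (intro in_degreeD [OF g]) auto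
        with False show ?thesis
          by (simp add: slot_zero [OF f])
      qed
    qed
    also have "\<dots> = (if nat q \<le> length w - i then ?T i else 0)"
      by simp
    also have "nat q \<le> length w - i \<longleftrightarrow> i < nat p"
      using that w True by auto
    finally show ?thesis .
  qed
  have "ins q g f w = (\<Sum>i\<le>length w. if i < nat p then ?T i else 0)"
    unfolding ins_def splitsum_eq_sum [of _ w] by (intro sum.cong refl inner) auto
  also have "\<dots> = (\<Sum>i\<in>{i\<in>{..length w}. i < nat p}. ?T i)"
    by (rule sum.inter_filter [symmetric]) simp
  also have "{i\<in>{..length w}. i < nat p} = {..<nat p}"
    using w True by auto
  also have "(\<Sum>i\<in>{..<nat p}. ?T i) = (\<Sum>i=1..nat p. ?T (i - 1))"
    by (simp add: sum.atLeast1_atMost_eq)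
  also have "\<dots> = (\<Sum>i=1..nat p. sg ((q - 1) * (int i - 1))
    (f (take (i - 1) w @ g (take (nat q) (drop (i - 1) w)) # drop (i - 1 + nat q) w)))"
    by (intro sum.cong refl) (auto simp: of_nat_diff)
  finally show ?thesis .
next
  \<comment> \<open>For negative \<open>q\<close> the expression \<open>nat q\<close> would pretend
    that \<open>g\<close> takes the empty word, but \<open>g\<close> is zero because no word has
    negative length.\<close>
  case False
  then have "g v = 0" for v
    by (intro in_degreeD [OF g]) auto
  then show ?thesis
    by (simp add: ins_def slot_zero [OF f])
qed

lemma neg_one_powi: "(- 1) powi n = (if even n then 1 else (- 1 :: 'a::field))"
  by (cases n rule: int_cases2) (auto simp: power_int_minus)

section \<open>Normalized cochains and the given operations in terms of \<open>dot\<close>,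
  \<open>ins\<close> and \<open>dif\<close>\<close>

context k_algebra
begin

definition homogeneous :: "('h list \<Rightarrow> 'h) \<Rightarrow> bool" where
  "homogeneous f \<longleftrightarrow> (\<forall>u c a x. f (u @ scale c a # x) = scale c (f (u @ a # x)))"

definition normalized :: "('h list \<Rightarrow> 'h) \<Rightarrow> bool" where
  "normalized f \<longleftrightarrow> (\<forall>u c x. f (u @ scale c 1 # x) = 0)"

lemma cochains_iff:
  "f \<in> cochains scale n \<longleftrightarrow> in_degree n f \<and> slot_additive f \<and> homogeneous f \<and> normalized f"
  by (auto simp: cochains_def in_degree_def slot_additive_def homogeneous_def normalized_def)

lemma scale_sg: "scale c (sg n x) = sg n (scale c x)"
  by (simp add: sg_def)

lemma powi_scale: "scale ((- 1) powi n) x = sg n x"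
  by (simp add: neg_one_powi sg_def)

lemma splitsum_scale: "splitsum (\<lambda>u v. scale c (F u v)) w = scale c (splitsum F w)"
  by (rule splitsum_hom [symmetric]) (auto simp: scale_right_distrib)

lemma ins_scale: "ins q g (\<lambda>w. scale c (F w)) w = scale c (ins q g F w)"
  by (simp add: ins_def scale_sg [symmetric] splitsum_scale)

lemma homogeneous_dot: "homogeneous f \<Longrightarrow> homogeneous g \<Longrightarrow> homogeneous (dot f g)"
  unfolding homogeneous_def
  by (simp add: dot_def splitsum_append scale_mult_left scale_mult_right splitsum_scale scale_right_distrib)

lemma normalized_dot: "normalized f \<Longrightarrow> normalized g \<Longrightarrow> normalized (dot f g)"
  unfolding normalized_def by (simp add: dot_def splitsum_append)

lemma homogeneous_idc: "homogeneous idc"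
  by (simp add: homogeneous_def idc_append)

lemma homogeneous_ins:
  assumes f: "homogeneous f" and g: "homogeneous g"
  shows "homogeneous (ins q g f)"
proof -
  have f': "f (u @ scale c a # x) = scale c (f (u @ a # x))" for u c a x
    using f by (simp add: homogeneous_def)
  have g': "g (u @ scale c a # x) = scale c (g (u @ a # x))" for u c a x
    using g by (simp add: homogeneous_def)
  show ?thesis
    unfolding homogeneous_def
    by (simp add: ins_append f' g' ins_scale scale_sg [symmetric] splitsum_scale scale_right_distrib
        f' [of "u @ a # x" for u a x, simplified])
qed

lemma normalized_ins:
  assumes s: "slot_additive f" and f: "normalized f" and g: "normalized g"
  shows "normalized (ins q g f)"
proof -
  have f': "f (u @ scale c 1 # x) = 0" for u c x
    using f by (simp add: normalized_def)
  have g': "g (u @ scale c 1 # x) = 0" for u c x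
    using g by (simp add: normalized_def)
  show ?thesis
    unfolding normalized_def
    by (simp add: ins_append f' g' slot_zero [OF s] f' [of "u @ a # x" for u a x, simplified])
qed

lemma homogeneous_add: "homogeneous f \<Longrightarrow> homogeneous g \<Longrightarrow> homogeneous (f + g)"
  by (simp add: homogeneous_def scale_right_distrib)

lemma homogeneous_diff: "homogeneous f \<Longrightarrow> homogeneous g \<Longrightarrow> homogeneous (f - g)"
  by (simp add: homogeneous_def scale_right_diff_distrib)

lemma homogeneous_sg: "homogeneous f \<Longrightarrow> homogeneous (sg n f)"
  by (simp add: homogeneous_def sg_fun scale_sg)

lemma normalized_add: "normalized f \<Longrightarrow> normalized g \<Longrightarrow> normalized (f + g)"
  by (simp add: normalized_def)

lemma normalized_diff: "normalized f \<Longrightarrow> normalized g \<Longrightarrow> normalized (f - g)"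
  by (simp add: normalized_def)

lemma normalized_sg: "normalized f \<Longrightarrow> normalized (sg n f)"
  by (simp add: normalized_def sg_fun)

lemma cochains_add: "f \<in> cochains scale n \<Longrightarrow> g \<in> cochains scale n \<Longrightarrow> f + g \<in> cochains scale n"
  by (simp add: cochains_iff in_degree_add slot_additive_add homogeneous_add normalized_add)

lemma cochains_diff: "f \<in> cochains scale n \<Longrightarrow> g \<in> cochains scale n \<Longrightarrow> f - g \<in> cochains scale n"
  by (simp add: cochains_iff in_degree_diff slot_additive_diff homogeneous_diff normalized_diff)

lemma cochains_sg: "f \<in> cochains scale n \<Longrightarrow> sg k f \<in> cochains scale n"
  by (simp add: cochains_iff in_degree_sg slot_additive_sg homogeneous_sg normalized_sg)

lemma cochains_zero: "0 \<in> cochains scale n"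
  by (simp add: cochains_def)

definition scale_fun :: "'k \<Rightarrow> ('h list \<Rightarrow> 'h) \<Rightarrow> 'h list \<Rightarrow> 'h" where
  "scale_fun c f = (\<lambda>as. scale c (f as))"

lemma cochains_scale_fun: "f \<in> cochains scale n \<Longrightarrow> scale_fun c f \<in> cochains scale n"
  by (auto simp: cochains_def scale_fun_def scale_right_distrib scale_left_commute)

lemma cochains_dot:
  "f \<in> cochains scale p \<Longrightarrow> g \<in> cochains scale q \<Longrightarrow> dot f g \<in> cochains scale (p + q)"
  by (simp add: cochains_iff in_degree_dot slot_additive_dot homogeneous_dot normalized_dot)

lemma cochains_ins:
  "f \<in> cochains scale p \<Longrightarrow> g \<in> cochains scale q \<Longrightarrow> ins q g f \<in> cochains scale (p + q - 1)"
  by (simp add: cochains_iff in_degree_ins slot_additive_ins homogeneous_ins normalized_ins)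

lemma cochains_br:
  "f \<in> cochains scale p \<Longrightarrow> g \<in> cochains scale q \<Longrightarrow> br p q f g \<in> cochains scale (p + q - 1)"
  unfolding br_fun using cochains_ins [of f p g q] cochains_ins [of g q f p]
  by (intro cochains_diff cochains_sg) (simp_all add: add.commute)

text \<open>As \<open>mul2\<close> is not normalized, \<open>normalized_ins\<close> does not apply.
  A scalar argument is multiplied with its left and its right neighbour, with opposite signs; at an
  end of the word an outer term of the differential replaces the missing neighbour.\<close>

lemma normalized_dif:
  assumes "slot_additive f" "homogeneous f" "normalized f" "in_degree p f"
  shows "normalized (dif p f)"
  unfolding normalized_def
proof (intro allI)
  fix u c x
  have n: "f (u @ scale c 1 # x) = 0" for u x
    using assms by (simp add: normalized_def)
  have h: "f (u @ scale c a # x) = scale c (f (u @ a # x))" for u a x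
    using assms by (simp add: homogeneous_def)
  have i: "ins 2 mul2 f (u @ scale c 1 # x) =
    splitsum (\<lambda>a b. sg (int (length a)) (f (a @ (idc b * scale c 1) # x))) u
    + splitsum (\<lambda>a b. sg (int (length u)) (f (u @ (scale c 1 * idc a) # b))) x"
    unfolding ins_mul2_append [OF assms(1)] by (simp add: n n [of "u @ a # x" for u a x, simplified])
  have 1: "splitsum (\<lambda>a b. sg (int (length a)) (f (a @ (idc b * scale c 1) # x))) u =
    (if u = [] then 0 else sg (int (length u) - 1) (scale c (f (u @ x))))"
  proof -
    have "splitsum (\<lambda>a b. sg (int (length a)) (f (a @ (idc b * scale c 1) # x))) u =
      (if u = [] then 0 else sg (int (length (butlast u))) (f (butlast u @ (last u * scale c 1) # x)))"
      by (rule splitsum_idc_right [where G = "\<lambda>a b. sg (int (length a)) (f (a @ (b * scale c 1) # x))"])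
        (simp add: slot_zero [OF assms(1)])
    also have "\<dots> = (if u = [] then 0 else sg (int (length u) - 1) (scale c (f (u @ x))))"
    proof (cases "u = []")
      case False
      then have "f (butlast u @ last u # x) = f (u @ x)"
        by (metis append.assoc append_Cons append_Nil append_butlast_last_id)
      then show ?thesis
        using False by (simp add: scale_mult_right h of_nat_diff Suc_leI)
    qed simp
    finally show ?thesis .
  qed
  have 2: "splitsum (\<lambda>a b. sg (int (length u)) (f (u @ (scale c 1 * idc a) # b))) x =
    (if x = [] then 0 else sg (int (length u)) (scale c (f (u @ x))))"
  proof -
    have "splitsum (\<lambda>a b. sg (int (length u)) (f (u @ (scale c 1 * idc a) # b))) x =
      (if x = [] then 0 else sg (int (length u)) (f (u @ (scale c 1 * hd x) # tl x)))"
      by (rule splitsum_idc_left [where G = "\<lambda>a b. sg (int (length u)) (f (u @ (scale c 1 * a) # b))"])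
        (simp add: slot_zero [OF assms(1)])
    then show ?thesis
      by (simp add: scale_mult_left h)
  qed
  have u: "f u = 0 \<or> p = int (length u)"
    using in_degreeD [OF assms(4), of u] by auto
  show "dif p f (u @ scale c 1 # x) = 0"
    unfolding dif_def plus_fun_apply sg_fun i 1 2 dot_idc_left dot_idc_right
    using n [of "tl u" x] n [of u "butlast x"] u
    by (cases "u = []"; cases "x = []"; cases "even p"; cases "even (int (length u))")
      (auto simp: butlast_append scale_mult_left scale_mult_right sg_def)
qed

lemma cochains_dif:
  assumes "f \<in> cochains scale p"
  shows "dif p f \<in> cochains scale (p + 1)"
proof -
  have f: "slot_additive f" "homogeneous f" "normalized f" "in_degree p f"
    using assms by (simp_all add: cochains_iff)
  have "homogeneous (dif p f)"
    unfolding dif_def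
    by (intro homogeneous_add homogeneous_sg homogeneous_dot homogeneous_ins homogeneous_idc f)
  then show ?thesis
    by (simp add: cochains_iff normalized_dif f in_degree_dif slot_additive_dif)
qed

lemma hochschild_diff_eq_dif:
  assumes f: "slot_additive f" "in_degree p f"
  shows "hochschild_diff scale p f = dif p f"
proof
  fix w :: "'h list"
  show "hochschild_diff scale p f w = dif p f w"
  proof (cases "int (length w) = p + 1")
    case True
    have m: "ins 2 mul2 f w = (\<Sum>i = 1..nat p. sg (int i - 1) (f (take (i - 1) w @ (w ! (i - 1) * w ! i) # drop (i + 1) w)))"
    proof -
      have "ins 2 mul2 f w = (\<Sum>i=1..nat p. sg ((2 - 1) * (int i - 1))
        (f (take (i - 1) w @ mul2 (take (nat 2) (drop (i - 1) w)) # drop (i - 1 + nat 2) w)))"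
        using True by (intro ins_eq_sum f in_degree_mul2) auto
      also have "\<dots> = (\<Sum>i = 1..nat p. sg (int i - 1) (f (take (i - 1) w @ (w ! (i - 1) * w ! i) # drop (i + 1) w)))"
      proof (intro sum.cong refl)
        fix i assume i: "i \<in> {1..nat p}"
        then obtain j where j: "i = Suc j"
          by (cases i) auto
        with i True have "Suc j < length w"
          by auto
        then have "take 2 (drop j w) = [w ! j, w ! Suc j]"
          by (simp add: Cons_nth_drop_Suc [symmetric] numeral_2_eq_2 take_Suc_conv_app_nth Suc_lessD)
        then show "sg ((2 - 1) * (int i - 1)) (f (take (i - 1) w @ mul2 (take (nat 2) (drop (i - 1) w)) # drop (i - 1 + nat 2) w))
          = sg (int i - 1) (f (take (i - 1) w @ (w ! (i - 1) * w ! i) # drop (i + 1) w))"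
          by (simp add: j dot_def)
      qed
      finally show ?thesis .
    qed
    have s: "sg (p + 1 - int i) x = sg p (sg (int i - 1) x)" for i and x :: 'h
      unfolding sg_sg by (intro sg_cong) auto
    \<comment> \<open>The empty word occurs only for \<open>p = -1\<close>, where \<open>hd\<close>,
      \<open>tl\<close>, \<open>butlast\<close> and \<open>last\<close> have no meaning; the outer
      terms vanish because \<open>f\<close> does.\<close>
    have e: "f [] = 0" if "w = []"
      using in_degreeD [OF f(2), of "[]"] True that by auto
    show ?thesis
      using True e
      by (simp add: hochschild_diff_def powi_scale s m dif_def sg_fun dot_idc_left dot_idc_right
          sum_sg del: sg_sg)
  next
    case False
    then show ?thesis
      using in_degreeD [OF in_degree_dif [OF f] False] by (simp add: hochschild_diff_def)
  qed
qed

lemma cochain_cup_eq_dot: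
  assumes f: "in_degree p f" and g: "in_degree q g"
  shows "cochain_cup scale p q f g = sg (p * q) (dot f g)"
proof
  fix w :: "'h list"
  show "cochain_cup scale p q f g w = sg (p * q) (dot f g) w"
  proof (cases "int (length w) = p + q")
    case True
    have "dot f g w = (\<Sum>i\<le>length w. f (take i w) * g (drop i w))"
      by (simp add: dot_def splitsum_eq_sum)
    also have "\<dots> = (\<Sum>i\<le>length w. if i = nat p then f (take i w) * g (drop i w) else 0)"
    proof (rule sum.cong [OF refl])
      fix i assume i: "i \<in> {..length w}"
      have "f (take i w) = 0" if "i \<noteq> nat p"
        using i that by (intro in_degreeD [OF f]) auto
      then show "f (take i w) * g (drop i w) = (if i = nat p then f (take i w) * g (drop i w) else 0)"
        by auto
    qed
    also have "\<dots> = f (take (nat p) w) * g (drop (nat p) w)"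
      using in_degreeD [OF g, of "drop (nat p) w"] True by auto
    finally show ?thesis
      using True by (simp add: cochain_cup_def powi_scale sg_fun)
  next
    case False
    then show ?thesis
      using in_degreeD [OF in_degree_dot [OF f g] False] by (simp add: cochain_cup_def sg_fun)
  qed
qed

lemma cochain_bracket_eq_br:
  assumes f: "slot_additive f" "in_degree p f" and g: "slot_additive g" "in_degree q g"
  shows "cochain_bracket scale p q f g = br p q f g"
proof -
  have c: "cochain_circ scale p q f g w = ins q g f w"
    if f: "slot_additive f" "in_degree p f" and g: "slot_additive g" "in_degree q g" for f g p q w
  proof (cases "int (length w) = p + q - 1")
    case True
    then show ?thesis
      by (simp add: cochain_circ_def cochain_circ_at_def ins_eq_sum [OF f(1) g(2) True] powi_scale)
  next
    case False
    then show ?thesis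
      using in_degreeD [OF in_degree_ins [OF f g(2)] False] by (simp add: cochain_circ_def cochain_circ_at_def)
  qed
  show ?thesis
    by (rule ext) (simp add: cochain_bracket_def br_def c f g powi_scale)
qed

end

section \<open>The boundary of the two-slot insertion\<close>

lemma ins_sg_length:
  assumes F: "slot_additive F" and y: "in_degree q y"
  shows "ins q y (\<lambda>t. sg (k * int (length t)) (F t)) U = sg (k * (int (length U) + q + 1)) (ins q y F U)"
  unfolding ins_def splitsum_sg [symmetric]
proof (intro splitsum_cong)
  fix u r v x assume *: "U = u @ r" "r = v @ x"
  show "sg ((q + 1) * int (length u)) (sg (k * int (length (u @ y v # x))) (F (u @ y v # x))) =
    sg (k * (int (length U) + q + 1)) (sg ((q + 1) * int (length u)) (F (u @ y v # x)))"
  proof (cases "int (length v) = q")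
    case True
    then show ?thesis
      unfolding sg_sg * by (intro sg_cong) (auto simp: algebra_simps)
  qed (simp add: in_degreeD [OF y] slot_zero [OF F])
qed

lemma ins_additive:
  assumes "\<And>a b. G (a + b) = G a + G b"
  shows "ins r h (\<lambda>v. G (z v)) w = G (ins r h z w)"
proof -
  have 0: "G 0 = 0"
    using assms [of 0 0] by simp
  have "G (- a) = - G a" for a
    using assms [of a "- a"] by (simp add: 0 eq_neg_iff_add_eq_0 add.commute)
  then have sg: "G (sg n a) = sg n (G a)" for n a
    by (simp add: sg_def)
  show ?thesis
    by (simp add: ins_def splitsum_hom [of G, OF 0 assms] sg)
qed

lemma ins_swap:
  "ins q y (\<lambda>t. ins r h (\<lambda>s. F t s) w) U = ins r h (\<lambda>s. ins q y (\<lambda>t. F t s) U) w"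
proof -
  have "ins q y (\<lambda>t. ins r h (\<lambda>s. F t s) w) U =
    splitsum (\<lambda>u R. splitsum (\<lambda>v x. ins q y (\<lambda>t. sg ((r + 1) * int (length u)) (F t (u @ h v # x))) U) R) w"
    by (simp add: ins_def [of r h] ins_splitsum_param)
  then show ?thesis
    by (simp add: ins_sg ins_def [of r h])
qed

text \<open>The commutator of the two insertions inserts \<open>br 2 q mul2 y = dif q y\<close>,
  which is 0 for a cocycle.\<close>

lemma ins_ins_mul2:
  assumes F: "slot_additive F" and y: "in_degree q y" "dif q y = 0"
  shows "ins q y (ins 2 mul2 F) = sg (q - 1) (ins 2 mul2 (ins q y F))"
  using ins_commutator_fun [OF F in_degree_mul2 y(1)] by (simp add: br_mul2 y(2) F)

text \<open>A product of two neighbouring letters can involve the value of \<open>y\<close>, the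
  value of \<open>z\<close>, both or neither. By the cocycle equations, products of one value with
  an original letter become products inside its block; the products of the two values with each
  other survive and give \<open>dot y z\<close>.\<close>

lemma two_ins_ins_mul2:
  fixes F :: "'a::ring list \<Rightarrow> 'b::ab_group_add"
  assumes F: "slot_additive F"
    and y: "slot_additive y" "in_degree q y" "dif q y = 0"
    and z: "in_degree r z" "dif r z = 0"
  shows "two_ins q r y z (ins 2 mul2 F) =
    sg (q + r) (ins 2 mul2 (two_ins q r y z F)) + sg ((r + 1) * q) (ins (q + r) (dot y z) F)"
proof
  fix w
  have slot: "slot_additive (\<lambda>t. F (t @ e # s))" for e s
    using slot_additiveD [OF F] by (simp add: slot_additive_def)
  \<comment> \<open>\<open>y\<close> is inserted to the left of a marked letter \<open>e\<close>,
    which later becomes the value of \<open>z\<close>.\<close>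
  define P where "P U e s = ins q y (\<lambda>t. F (t @ e # s)) U" for U e s
  have P_add: "P U (a + b) s = P U a s + P U b s" for U a b s
    by (simp add: P_def slot_additiveD [OF F] ins_add)
  have P_0: "P U 0 s = 0" for U s
    using P_add [of U 0 0 s] by simp
  have P_minus: "P U (- a) s = - P U a s" for U a s
    using P_add [of U a "- a" s] by (simp add: P_0 eq_neg_iff_add_eq_0 add.commute)
  have P_sg: "P U (sg n a) s = sg n (P U a s)" for n U a s
    by (simp add: sg_def P_minus)
  have P_ins: "ins n h (\<lambda>v. P U (f v) s) V = P U (ins n h f V) s" for n h f U V s
    by (rule ins_additive) (rule P_add)
  have P_slot: "slot_additive (\<lambda>U. P U e s)" for e s
    unfolding P_def by (rule slot_additive_ins [OF slot y(1)])
  have G_idc: "ins q y (\<lambda>b. G (idc b)) V = G (y V)" if "G 0 = 0" for G :: "'a \<Rightarrow> 'b" and V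
  proof -
    have "ins q y (\<lambda>b. G (idc b)) V = splitsum (\<lambda>u R. if u = [] then
        splitsum (\<lambda>v x. if x = [] then G (y v) else 0) R else 0) V"
      unfolding ins_def by (intro splitsum_cong) (auto simp: idc_append that cong: if_cong intro!: splitsum_cong)
    then show ?thesis
      by (simp only: splitsum_Nil_right splitsum_Nil_left)
  qed
  \<comment> \<open>The third summand is the one in which the value of \<open>y\<close> stands next
    to \<open>e\<close> and is multiplied with it; it is the source of
    \<open>dot y z\<close>.\<close>
  have expand: "ins q y (\<lambda>t. ins 2 mul2 F (t @ e # s)) U =
      sg (q - 1) (ins 2 mul2 (\<lambda>U. P U e s) U)
      + splitsum (\<lambda>U' b. sg (int (length U') + q + 1) (P U' (idc b * e) s)) U
      + splitsum (\<lambda>U' V. sg (q * int (length U')) (F (U' @ (y V * e) # s))) U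
      + splitsum (\<lambda>c d. sg (int (length U) + q + 1) (P U (e * idc c) d)) s
      + sg (int (length U) + q) (ins 2 mul2 (\<lambda>s. P U e s) s)" for e s U
  proof -
    have A: "ins q y (ins 2 mul2 (\<lambda>t. F (t @ e # s))) U = sg (q - 1) (ins 2 mul2 (\<lambda>U. P U e s) U)"
      by (simp add: ins_ins_mul2 [OF slot y(2,3)] sg_fun P_def [abs_def])
    have B: "ins q y (\<lambda>t. splitsum (\<lambda>a b. sg (int (length a)) (F (a @ (idc b * e) # s))) t) U =
      splitsum (\<lambda>U' b. sg (int (length U') + q + 1) (P U' (idc b * e) s)) U
      + splitsum (\<lambda>U' V. sg (q * int (length U')) (F (U' @ (y V * e) # s))) U"
    proof -
      have 1: "ins q y (\<lambda>a. sg (int (length a)) (F (a @ (idc b * e) # s))) U'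
        = sg (int (length U') + q + 1) (P U' (idc b * e) s)" for U' b
        using ins_sg_length [OF slot y(2), where k = 1] by (simp add: P_def)
      have 2: "sg ((q + 1) * int (length U')) (ins q y (\<lambda>b. sg (int (length U')) (F (U' @ (idc b * e) # s))) V)
        = sg (q * int (length U')) (F (U' @ (y V * e) # s))" for U' V
      proof -
        have "ins q y (\<lambda>b. sg (int (length U')) (F (U' @ (idc b * e) # s))) V =
          sg (int (length U')) (F (U' @ (y V * e) # s))"
          by (rule G_idc) (simp add: slot_zero [OF F])
        moreover have "sg ((q + 1) * int (length U') + int (length U')) x = sg (q * int (length U')) x" for x :: 'b
          by (intro sg_cong) auto
        ultimately show ?thesis
          by simp
      qed
      show ?thesis
        unfolding ins_splitsum 1 2 splitsum_add ..
    qed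
    have C: "ins q y (\<lambda>t. splitsum (\<lambda>c d. sg (int (length t)) (F (t @ (e * idc c) # d))) s) U
      = splitsum (\<lambda>c d. sg (int (length U) + q + 1) (P U (e * idc c) d)) s"
      using ins_sg_length [OF slot y(2), where k = 1] by (simp add: P_def ins_splitsum_param)
    have D: "ins q y (\<lambda>t. sg (int (length t) + 1) (ins 2 mul2 (\<lambda>s. F (t @ e # s)) s)) U
      = sg (int (length U) + q) (ins 2 mul2 (\<lambda>s. P U e s) s)"
    proof -
      have "ins q y (\<lambda>t. sg (int (length t) + 1) (ins 2 mul2 (\<lambda>s. F (t @ e # s)) s)) U =
        ins 2 mul2 (\<lambda>s. ins q y (\<lambda>t. sg 1 (sg (int (length t)) (F (t @ e # s)))) U) s"
        by (rule trans [OF _ ins_swap]) (simp add: ins_sg add.commute)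
      also have "\<dots> = sg (1 + (int (length U) + q + 1)) (ins 2 mul2 (\<lambda>s. P U e s) s)"
        using ins_sg_length [OF slot y(2), where k = 1] by (simp add: P_def ins_sg del: sg_sg) (simp add: ins_sg)
      also have "\<dots> = sg (int (length U) + q) (ins 2 mul2 (\<lambda>s. P U e s) s)"
        by (intro sg_cong) auto
      finally show ?thesis .
    qed
    show ?thesis
      unfolding ins_mul2_append [OF F] ins_add A B C D by (simp add: add.assoc)
  qed
  define S where "S f = splitsum (\<lambda>U R. splitsum (\<lambda>v s. f U v s) R) w"
    for f :: "'a list \<Rightarrow> 'a list \<Rightarrow> 'a list \<Rightarrow> 'b"
  have S_add: "S (\<lambda>U v s. f U v s + g U v s) = S f + S g" for f g
    by (simp add: S_def splitsum_add)
  have S_sg: "S (\<lambda>U v s. sg n (f U v s)) = sg n (S f)" for f n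
    by (simp add: S_def splitsum_sg)
  have lhs: "two_ins q r y z (ins 2 mul2 F) w =
    S (\<lambda>U v s. sg ((r + 1) * int (length U) + (q - 1)) (ins 2 mul2 (\<lambda>U. P U (z v) s) U))
    + S (\<lambda>U v s. splitsum (\<lambda>U' b. sg ((r + 1) * int (length U) + (int (length U') + q + 1)) (P U' (idc b * z v) s)) U)
    + S (\<lambda>U v s. splitsum (\<lambda>U' V. sg ((r + 1) * int (length U) + q * int (length U')) (F (U' @ (y V * z v) # s))) U)
    + S (\<lambda>U v s. splitsum (\<lambda>c d. sg ((r + 1) * int (length U) + (int (length U) + q + 1)) (P U (z v * idc c) d)) s)
    + S (\<lambda>U v s. sg ((r + 1) * int (length U) + (int (length U) + q)) (ins 2 mul2 (\<lambda>s. P U (z v) s) s))"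
    unfolding two_ins_def expand S_def [symmetric] sg_add splitsum_sg [symmetric] S_add sg_sg ..
  have rhs: "ins 2 mul2 (two_ins q r y z F) w =
    S (\<lambda>U v s. sg ((r + 1) * (int (length U) + 3)) (ins 2 mul2 (\<lambda>U. P U (z v) s) U))
    + S (\<lambda>U v s. sg (3 * int (length U) + (r + 1) * int (length U)) (P U (ins 2 mul2 z v) s))
    + S (\<lambda>U v s. sg (3 * int (length U) + (3 * int (length v) + (r + 1) * int (length U))) (ins 2 mul2 (\<lambda>s. P U (z v) s) s))"
  proof -
    have "two_ins q r y z F = splitsum (\<lambda>U R. splitsum (\<lambda>v s. sg ((r + 1) * int (length U)) (P U (z v) s)) R)"
      by (auto simp: fun_eq_iff two_ins_def P_def)
    moreover have "ins 2 mul2 (\<lambda>t. splitsum (\<lambda>v s. sg ((r + 1) * int (length t)) (P t (z v) s)) R) U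
      = splitsum (\<lambda>v s. sg ((r + 1) * (int (length U) + 3)) (ins 2 mul2 (\<lambda>U. P U (z v) s) U)) R" for U R
      using ins_sg_length [OF P_slot in_degree_mul2, where k = "r + 1"]
      by (simp add: ins_splitsum_param add.assoc)
    moreover have "ins 2 mul2 (splitsum (\<lambda>v s. sg ((r + 1) * int (length U)) (P U (z v) s))) R =
      splitsum (\<lambda>v s. sg ((r + 1) * int (length U)) (P U (ins 2 mul2 z v) s)
        + sg (3 * int (length v) + (r + 1) * int (length U)) (ins 2 mul2 (\<lambda>s. P U (z v) s) s)) R" for U R
      by (simp add: ins_splitsum ins_sg P_ins)
    ultimately show ?thesis
      by (simp add: ins_splitsum S_def splitsum_add splitsum_sg [symmetric] sg_add add.assoc)
  qed
  have B: "S (\<lambda>U v s. splitsum (\<lambda>U' b. sg ((r + 1) * int (length U) + (int (length U') + q + 1)) (P U' (idc b * z v) s)) U)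
    = S (\<lambda>U v s. sg (r * int (length U) + q + r) (P U (dot idc z v) s))"
  proof -
    have "S (\<lambda>U v s. splitsum (\<lambda>U' b. sg ((r + 1) * int (length U) + (int (length U') + q + 1)) (P U' (idc b * z v) s)) U)
      = S (\<lambda>U v s. splitsum (\<lambda>U' b. sg (r * int (length U') + q + r) (P U' (idc b * z v) s)) U)"
      unfolding S_def
    proof (intro splitsum_cong)
      fix U R v s U' b :: "'a list"
      assume "U = U' @ b"
      then show "sg ((r + 1) * int (length U) + (int (length U') + q + 1)) (P U' (idc b * z v) s)
        = sg (r * int (length U') + q + r) (P U' (idc b * z v) s)"
      proof (cases "length b = 1")
        case True
        then show ?thesis
          using \<open>U = U' @ b\<close> by (intro sg_cong) (auto simp: algebra_simps)
      qed (simp add: idc_def P_0)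
    qed
    also have "\<dots> = splitsum (\<lambda>U R. splitsum (\<lambda>U' b. splitsum (\<lambda>v s. sg (r * int (length U') + q + r) (P U' (idc b * z v) s)) R) U) w"
      unfolding S_def by (rule splitsum_cong, rule splitsum_commute)
    also have "\<dots> = splitsum (\<lambda>U' T. splitsum (\<lambda>V s. splitsum (\<lambda>b v. sg (r * int (length U') + q + r) (P U' (idc b * z v) s)) V) T) w"
      by (simp only: splitsum_assoc)
    also have "\<dots> = S (\<lambda>U v s. sg (r * int (length U) + q + r) (P U (dot idc z v) s))"
      unfolding S_def dot_def splitsum_sg
      by (simp add: splitsum_hom [where h = "\<lambda>e. P U e s" for U s, OF P_0 P_add])
    finally show ?thesis .
  qed
  have C: "S (\<lambda>U v s. splitsum (\<lambda>c d. sg ((r + 1) * int (length U) + (int (length U) + q + 1)) (P U (z v * idc c) d)) s)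
    = S (\<lambda>U v s. sg (r * int (length U) + q + 1) (P U (dot z idc v) s))"
  proof -
    have "S (\<lambda>U v s. splitsum (\<lambda>c d. sg ((r + 1) * int (length U) + (int (length U) + q + 1)) (P U (z v * idc c) d)) s)
      = S (\<lambda>U V s. splitsum (\<lambda>v c. sg ((r + 1) * int (length U) + (int (length U) + q + 1)) (P U (z v * idc c) s)) V)"
      unfolding S_def by (rule splitsum_cong, rule splitsum_assoc [symmetric])
    also have "\<dots> = S (\<lambda>U V s. sg ((r + 1) * int (length U) + (int (length U) + q + 1)) (P U (dot z idc V) s))"
      unfolding S_def dot_def splitsum_sg
      by (simp add: splitsum_hom [where h = "\<lambda>e. P U e s" for U s, OF P_0 P_add])
    also have "\<dots> = S (\<lambda>U v s. sg (r * int (length U) + q + 1) (P U (dot z idc v) s))"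
      unfolding S_def by (intro splitsum_cong sg_cong) auto
    finally show ?thesis .
  qed
  \<comment> \<open>The cocycle equation of \<open>z\<close>: products of its value with the left
    and the right neighbour are traded for products inside its block.\<close>
  have BC: "sg (r * int (length U) + q + r) (P U (dot idc z v) s) + sg (r * int (length U) + q + 1) (P U (dot z idc v) s)
    = sg (r * int (length U) + q + r) (P U (ins 2 mul2 z v) s)" for U v s
  proof -
    have "dot z idc v + sg (r + 1) (dot idc z v) + sg r (ins 2 mul2 z v) = 0"
      using fun_cong [OF z(2), of v] by (simp add: dif_def sg_fun)
    then have "P U (dot z idc v + sg (r + 1) (dot idc z v) + sg r (ins 2 mul2 z v)) s = 0"
      by (simp add: P_0)
    then have "P U (dot z idc v) s + (sg (r + 1) (P U (dot idc z v) s) + sg r (P U (ins 2 mul2 z v) s)) = 0"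
      by (simp add: P_add P_sg add.assoc)
    then have "P U (dot z idc v) s = - (sg (r + 1) (P U (dot idc z v) s) + sg r (P U (ins 2 mul2 z v) s))"
      by (simp only: eq_neg_iff_add_eq_0)
    then show ?thesis
      by (simp add: sg_add sg_minus) (simp add: sg_def)
  qed
  \<comment> \<open>Two adjacent blocks of lengths \<open>q\<close> and \<open>r\<close> merge into
    one block of length \<open>q + r\<close>, on which \<open>dot y z\<close> is evaluated.\<close>
  have Y: "S (\<lambda>U v s. splitsum (\<lambda>U' V. sg ((r + 1) * int (length U) + q * int (length U')) (F (U' @ (y V * z v) # s))) U)
    = sg ((r + 1) * q) (ins (q + r) (dot y z) F w)"
  proof -
    have "S (\<lambda>U v s. splitsum (\<lambda>U' V. sg ((r + 1) * int (length U) + q * int (length U')) (F (U' @ (y V * z v) # s))) U)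
      = S (\<lambda>U v s. splitsum (\<lambda>U' V. sg ((q + r + 1) * int (length U') + (r + 1) * q) (F (U' @ (y V * z v) # s))) U)"
      unfolding S_def
    proof (intro splitsum_cong)
      fix U R v s U' V :: "'a list"
      assume "U = U' @ V"
      then show "sg ((r + 1) * int (length U) + q * int (length U')) (F (U' @ (y V * z v) # s))
        = sg ((q + r + 1) * int (length U') + (r + 1) * q) (F (U' @ (y V * z v) # s))"
      proof (cases "int (length V) = q")
        case True
        then show ?thesis
          using \<open>U = U' @ V\<close> by (intro sg_cong) (auto simp: algebra_simps)
      qed (simp add: in_degreeD [OF y(2)] slot_zero [OF F])
    qed
    also have "\<dots> = splitsum (\<lambda>U R. splitsum (\<lambda>U' V. splitsum (\<lambda>v s. sg ((q + r + 1) * int (length U') + (r + 1) * q) (F (U' @ (y V * z v) # s))) R) U) w"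
      unfolding S_def by (rule splitsum_cong, rule splitsum_commute)
    also have "\<dots> = splitsum (\<lambda>U' T. splitsum (\<lambda>V s. splitsum (\<lambda>b v. sg ((q + r + 1) * int (length U') + (r + 1) * q) (F (U' @ (y b * z v) # s))) V) T) w"
      by (simp only: splitsum_assoc)
    also have "\<dots> = sg ((r + 1) * q) (ins (q + r) (dot y z) F w)"
      by (simp add: ins_def dot_def slot_splitsum [OF F] splitsum_sg [symmetric] add.commute)
    finally show ?thesis .
  qed
  have 1: "S (\<lambda>U v s. sg ((r + 1) * int (length U) + (q - 1)) (ins 2 mul2 (\<lambda>U. P U (z v) s) U))
    = sg (q + r) (S (\<lambda>U v s. sg ((r + 1) * (int (length U) + 3)) (ins 2 mul2 (\<lambda>U. P U (z v) s) U)))"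
    unfolding S_sg [symmetric] unfolding S_def sg_sg by (intro splitsum_cong sg_cong) auto
  have 2: "S (\<lambda>U v s. sg ((r + 1) * int (length U) + (int (length U) + q)) (ins 2 mul2 (\<lambda>s. P U (z v) s) s))
    = sg (q + r) (S (\<lambda>U v s. sg (3 * int (length U) + (3 * int (length v) + (r + 1) * int (length U))) (ins 2 mul2 (\<lambda>s. P U (z v) s) s)))"
    unfolding S_sg [symmetric] unfolding S_def sg_sg
  proof (intro splitsum_cong)
    fix U R v s :: "'a list"
    show "sg ((r + 1) * int (length U) + (int (length U) + q)) (ins 2 mul2 (\<lambda>s. P U (z v) s) s) =
      sg (q + r + (3 * int (length U) + (3 * int (length v) + (r + 1) * int (length U)))) (ins 2 mul2 (\<lambda>s. P U (z v) s) s)"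
    proof (cases "int (length v) = r")
      case True
      then show ?thesis
        by (intro sg_cong) auto
    qed (simp add: in_degreeD [OF z(1)] P_0)
  qed
  have 3: "S (\<lambda>U v s. sg (r * int (length U) + q + r) (P U (dot idc z v) s))
      + S (\<lambda>U v s. sg (r * int (length U) + q + 1) (P U (dot z idc v) s))
    = sg (q + r) (S (\<lambda>U v s. sg (3 * int (length U) + (r + 1) * int (length U)) (P U (ins 2 mul2 z v) s)))"
    unfolding S_add [symmetric] BC
    unfolding S_sg [symmetric] unfolding S_def sg_sg by (intro splitsum_cong sg_cong) auto
  show "two_ins q r y z (ins 2 mul2 F) w = (sg (q + r) (ins 2 mul2 (two_ins q r y z F))
    + sg ((r + 1) * q) (ins (q + r) (dot y z) F)) w"
    unfolding lhs plus_fun_apply sg_fun rhs sg_add B C Y 1 2 using 3 by (simp add: algebra_simps)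
qed

lemma two_ins_add: "two_ins q r y z (F + G) = two_ins q r y z F + two_ins q r y z G"
  by (rule ext) (simp add: two_ins_def ins_add sg_add splitsum_add splitsum_add_fun)

lemma two_ins_sg: "two_ins q r y z (sg n F) = sg n (two_ins q r y z F)"
  by (rule ext) (simp add: two_ins_def ins_sg sg_fun splitsum_sg [symmetric] add.commute)

text \<open>Applying \<open>two_ins\<close> to the three terms of the cocycle equation of
  \<open>x\<close> gives the boundary. The right side is the failure of insertion into
  \<open>x\<close> to be a derivation of the product of \<open>y\<close> and
  \<open>z\<close>.\<close>

lemma dif_two_ins:
  fixes x y z :: "'a::ring list \<Rightarrow> 'a"
  assumes x: "slot_additive x" "in_degree p x" "dif p x = 0"
    and y: "slot_additive y" "in_degree q y" "dif q y = 0"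
    and z: "in_degree r z" "dif r z = 0"
  shows "dif (p + q + r - 2) (two_ins q r y z x) =
    - sg ((r + 1) * (p + q + 1)) (dot (ins q y x) z) - sg (p + 1 + (r + 1) * q) (dot y (ins r z x))
    - sg (p + (r + 1) * q) (ins (q + r) (dot y z) x)"
proof -
  have "two_ins q r y z 0 = (0 :: 'a list \<Rightarrow> 'a)"
    by (auto simp: fun_eq_iff two_ins_def zero_fun_def)
  then have "two_ins q r y z (dif p x) = 0"
    by (simp add: x(3))
  then have "two_ins q r y z (dot x idc) + sg (p + 1) (two_ins q r y z (dot idc x))
    + sg p (two_ins q r y z (ins 2 mul2 x)) = 0"
    by (simp add: dif_def two_ins_add two_ins_sg)
  then show ?thesis
    unfolding two_ins_dot_idc [OF x(1,2) y(2)] two_ins_idc_dot [OF y(2)] two_ins_ins_mul2 [OF x(1) y z]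
    by (cases "even p"; cases "even q"; cases "even r")
      (simp_all add: dif_def sg_add sg_def eq_neg_iff_add_eq_0 algebra_simps)
qed

lemma slot_additive_two_ins:
  assumes F: "slot_additive F" and g: "slot_additive g" and h: "slot_additive h"
  shows "slot_additive (two_ins q r g h F)"
proof -
  define P where "P U e s = ins q g (\<lambda>t. F (t @ e # s)) U" for U e s
  have P1: "P U (a + b) s = P U a s + P U b s" for U a b s
    by (simp add: P_def slot_additiveD [OF F] ins_add)
  have P2: "P U e (s @ (a + b) # s') = P U e (s @ a # s') + P U e (s @ b # s')" for U e s a b s'
    using slot_additiveD [OF F, of "t @ e # s" a b s' for t] by (simp add: P_def ins_add)
  have P3: "P (U @ (a + b) # U') e s = P (U @ a # U') e s + P (U @ b # U') e s" for U U' a b e s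
  proof -
    have "slot_additive (\<lambda>t. F (t @ e # s))"
      using slot_additiveD [OF F] by (simp add: slot_additive_def)
    then show ?thesis
      unfolding P_def by (intro slot_additiveD slot_additive_ins g)
  qed
  show ?thesis
    unfolding slot_additive_def two_ins_def P_def [symmetric]
    by (simp add: splitsum_append splitsum_add splitsum_add_fun sg_add P1 P2 P3 slot_additiveD [OF h])
qed

lemma in_degree_two_ins:
  assumes F: "slot_additive F" "in_degree p F" and g: "in_degree q g" and h: "in_degree r h"
  shows "in_degree (p + q + r - 2) (two_ins q r g h F)"
  unfolding in_degree_def
proof (intro allI impI)
  fix w :: "'a list"
  assume w: "int (length w) \<noteq> p + q + r - 2"
  have "two_ins q r g h F w = splitsum (\<lambda>U R. splitsum (\<lambda>v s. 0) R) w"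
    unfolding two_ins_def
  proof (intro splitsum_cong)
    fix U R v s :: "'a list"
    assume *: "w = U @ R" "R = v @ s"
    have slot: "slot_additive (\<lambda>t. F (t @ e # s))" for e
      using slot_additiveD [OF F(1)] by (simp add: slot_additive_def)
    have "in_degree (p - 1 - int (length s)) (\<lambda>t. F (t @ e # s))" for e
      using in_degreeD [OF F(2)] by (simp add: in_degree_def)
    then have "in_degree (p - 1 - int (length s) + q - 1) (ins q g (\<lambda>t. F (t @ e # s)))" for e
      by (intro in_degree_ins slot g)
    then have "ins q g (\<lambda>t. F (t @ h v # s)) U = 0" if "int (length v) = r"
      using w * that by (intro in_degreeD) auto
    moreover have "ins q g (\<lambda>t. F (t @ h v # s)) U = 0" if "int (length v) \<noteq> r"
      by (simp add: in_degreeD [OF h that] slot_zero [OF F(1)])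
    ultimately show "sg ((r + 1) * int (length U)) (ins q g (\<lambda>t. F (t @ h v # s)) U) = 0"
      by (cases "int (length v) = r") auto
  qed
  then show "two_ins q r g h F w = 0"
    by simp
qed

context k_algebra
begin

lemma homogeneous_two_ins:
  assumes f: "homogeneous f" and g: "homogeneous g" and h: "homogeneous h"
  shows "homogeneous (two_ins q r g h f)"
proof -
  define P where "P U e s = ins q g (\<lambda>t. f (t @ e # s)) U" for U e s
  have f': "f (u @ scale c a # x) = scale c (f (u @ a # x))" for u c a x
    using f by (simp add: homogeneous_def)
  have h': "h (u @ scale c a # x) = scale c (h (u @ a # x))" for u c a x
    using h by (simp add: homogeneous_def)
  have P1: "P U (scale c a) s = scale c (P U a s)" for U c a s
    by (simp add: P_def f' ins_scale)
  have P2: "P U e (s @ scale c a # s') = scale c (P U e (s @ a # s'))" for U e s a c s'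
    using f' [of "t @ e # s" c a s' for t] by (simp add: P_def ins_scale)
  have P3: "P (U @ scale c a # U') e s = scale c (P (U @ a # U') e s)" for U U' a c e s
  proof -
    have "homogeneous (\<lambda>t. f (t @ e # s))"
      using f' by (simp add: homogeneous_def)
    then have "homogeneous (ins q g (\<lambda>t. f (t @ e # s)))"
      by (rule homogeneous_ins [OF _ g])
    then show ?thesis
      unfolding P_def homogeneous_def by blast
  qed
  have sum: "splitsum (\<lambda>u v. scale c (F u v)) = (\<lambda>w. scale c (splitsum F w))" for c F
    by (rule ext) (rule splitsum_scale)
  show ?thesis
    unfolding homogeneous_def two_ins_def P_def [symmetric]
    by (simp add: splitsum_append splitsum_scale sum scale_sg [symmetric] scale_right_distrib splitsum_add P1 P2 P3 h')
qed

lemma normalized_two_ins: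
  assumes s: "slot_additive f" and f: "normalized f" and g: "normalized g" and h: "normalized h"
  shows "normalized (two_ins q r g h f)"
proof -
  define P where "P U e s = ins q g (\<lambda>t. f (t @ e # s)) U" for U e s
  have f': "f (u @ scale c 1 # x) = 0" for u c x
    using f by (simp add: normalized_def)
  have h': "h (u @ scale c 1 # x) = 0" for u c x
    using h by (simp add: normalized_def)
  have P1: "P U 0 s = 0" for U s
    by (simp add: P_def slot_zero [OF s])
  have P2: "P U e (s @ scale c 1 # s') = 0" for U e s c s'
    using f' [of "t @ e # s" c s' for t] by (simp add: P_def)
  have P3: "P (U @ scale c 1 # U') e s = 0" for U U' c e s
  proof -
    have "normalized (\<lambda>t. f (t @ e # s))"
      using f' by (simp add: normalized_def)
    moreover have "slot_additive (\<lambda>t. f (t @ e # s))"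
      using slot_additiveD [OF s] by (simp add: slot_additive_def)
    ultimately have "normalized (ins q g (\<lambda>t. f (t @ e # s)))"
      by (intro normalized_ins g)
    then show ?thesis
      unfolding P_def normalized_def by blast
  qed
  have sum: "splitsum (\<lambda>u v. 0) = (\<lambda>w. 0)"
    by (rule ext) simp
  show ?thesis
    unfolding normalized_def two_ins_def P_def [symmetric]
    by (simp add: splitsum_append sum P1 P2 P3 h')
qed

lemma cochains_two_ins:
  "x \<in> cochains scale p \<Longrightarrow> y \<in> cochains scale q \<Longrightarrow> z \<in> cochains scale r \<Longrightarrow>
    two_ins q r y z x \<in> cochains scale (p + q + r - 2)"
  by (simp add: cochains_iff in_degree_two_ins slot_additive_two_ins homogeneous_two_ins normalized_two_ins)

section \<open>Cocycles, coboundaries and the operations on classes\<close>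

lemma cocycles_iff: "f \<in> cocycles scale n \<longleftrightarrow> f \<in> cochains scale n \<and> dif n f = 0"
  by (auto simp: cocycles_def cochains_iff hochschild_diff_eq_dif fun_eq_iff)

lemma coboundaries_iff: "f \<in> coboundaries scale n \<longleftrightarrow> (\<exists>g \<in> cochains scale (n - 1). f = dif (n - 1) g)"
  by (auto simp: coboundaries_def cochains_iff hochschild_diff_eq_dif)

lemma coboundaries_cocycles: "f \<in> coboundaries scale n \<Longrightarrow> f \<in> cocycles scale n"
  unfolding coboundaries_iff cocycles_iff
  using cochains_dif [where p = "n - 1"] dif_dif [where p = "n - 1"] by (auto simp: cochains_iff)

lemma coboundaries_add:
  "f \<in> coboundaries scale n \<Longrightarrow> g \<in> coboundaries scale n \<Longrightarrow> f + g \<in> coboundaries scale n"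
  unfolding coboundaries_iff by (metis cochains_add dif_add)

lemma coboundaries_diff:
  "f \<in> coboundaries scale n \<Longrightarrow> g \<in> coboundaries scale n \<Longrightarrow> f - g \<in> coboundaries scale n"
  unfolding coboundaries_iff by (metis cochains_diff dif_diff)

lemma coboundaries_sg: "f \<in> coboundaries scale n \<Longrightarrow> sg k f \<in> coboundaries scale n"
  unfolding coboundaries_iff by (metis cochains_sg dif_sg)

lemma coboundaries_zero: "0 \<in> coboundaries scale n"
  unfolding coboundaries_iff using cochains_zero dif_zero by metis

lemma coboundaries_minus: "f \<in> coboundaries scale n \<Longrightarrow> - f \<in> coboundaries scale n"
  using coboundaries_diff [OF coboundaries_zero] by fastforce

lemma dot_scale_fun_left: "dot (scale_fun c f) g = scale_fun c (dot f g)"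
  and dot_scale_fun_right: "dot f (scale_fun c g) = scale_fun c (dot f g)"
  by (auto simp: fun_eq_iff dot_def scale_fun_def scale_mult_left scale_mult_right splitsum_scale)

lemma ins_scale_fun: "ins q g (scale_fun c f) = scale_fun c (ins q g f)"
  by (rule ext) (simp add: scale_fun_def ins_scale)

lemma ins_arg_scale_fun: "homogeneous f \<Longrightarrow> ins q (scale_fun c g) f = scale_fun c (ins q g f)"
  by (rule ext) (simp add: scale_fun_def ins_def homogeneous_def scale_sg [symmetric] splitsum_scale)

lemma scale_fun_add: "scale_fun c (f + g) = scale_fun c f + scale_fun c g"
  by (auto simp: scale_fun_def scale_right_distrib)

lemma scale_fun_diff: "scale_fun c (f - g) = scale_fun c f - scale_fun c g"
  by (auto simp: scale_fun_def scale_right_diff_distrib)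

lemma scale_fun_sg: "scale_fun c (sg n f) = sg n (scale_fun c f)"
  by (auto simp: scale_fun_def scale_sg sg_fun)

lemma scale_fun_powi: "scale_fun ((- 1) powi n) f = sg n f"
  by (auto simp: scale_fun_def powi_scale sg_fun)

lemma dif_scale_fun: "dif p (scale_fun c f) = scale_fun c (dif p f)"
  by (simp add: dif_def dot_scale_fun_left dot_scale_fun_right ins_scale_fun scale_fun_add scale_fun_sg)

lemma coboundaries_scale_fun: "f \<in> coboundaries scale n \<Longrightarrow> scale_fun c f \<in> coboundaries scale n"
  unfolding coboundaries_iff by (metis cochains_scale_fun dif_scale_fun)

lemma cocycles_add: "f \<in> cocycles scale n \<Longrightarrow> g \<in> cocycles scale n \<Longrightarrow> f + g \<in> cocycles scale n"
  by (simp add: cocycles_iff cochains_add dif_add)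

lemma cocycles_diff: "f \<in> cocycles scale n \<Longrightarrow> g \<in> cocycles scale n \<Longrightarrow> f - g \<in> cocycles scale n"
  by (simp add: cocycles_iff cochains_diff dif_diff)

lemma cocycles_sg: "f \<in> cocycles scale n \<Longrightarrow> sg k f \<in> cocycles scale n"
  by (simp add: cocycles_iff cochains_sg dif_sg)

lemma cocycles_scale_fun: "f \<in> cocycles scale n \<Longrightarrow> scale_fun c f \<in> cocycles scale n"
  using dif_scale_fun [of n c f]
  by (simp add: cocycles_iff cochains_scale_fun) (simp add: scale_fun_def zero_fun_def)

lemma cocycles_dot:
  assumes "f \<in> cocycles scale p" "g \<in> cocycles scale q"
  shows "dot f g \<in> cocycles scale (p + q)"
proof -
  have "in_degree p f"
    using assms by (simp add: cocycles_iff cochains_iff)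
  then show ?thesis
    using assms by (simp add: cocycles_iff cochains_dot dif_dot)
qed

lemma br_zero_left: "slot_additive g \<Longrightarrow> br p q 0 g = 0"
  and br_zero_right: "slot_additive f \<Longrightarrow> br p q f 0 = 0"
  by (simp_all add: br_fun)

lemma cocycles_br:
  assumes "f \<in> cocycles scale p" "g \<in> cocycles scale q"
  shows "br p q f g \<in> cocycles scale (p + q - 1)"
  using assms dif_br [of f p g q]
  by (simp add: cocycles_iff cochains_br) (simp add: cochains_iff br_zero_left br_zero_right)

definition cls :: "int \<Rightarrow> ('h list \<Rightarrow> 'h) \<Rightarrow> ('h list \<Rightarrow> 'h) set" where
  "cls n f = HH_class scale n f"

lemma cls_iff: "g \<in> cls n f \<longleftrightarrow> g - f \<in> coboundaries scale n"
proof -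
  have "g = f + b \<longleftrightarrow> b = g - f" for b
    by (auto simp: fun_eq_iff algebra_simps)
  then show ?thesis
    by (auto simp: cls_def HH_class_def elt_set_plus_def)
qed

lemma cls_self: "f \<in> cls n f"
  by (simp add: cls_iff coboundaries_zero)

lemma cls_eqI:
  assumes "f - g \<in> coboundaries scale n"
  shows "cls n f = cls n g"
proof -
  have "h - g \<in> coboundaries scale n \<longleftrightarrow> h - f \<in> coboundaries scale n" for h
    using coboundaries_add [OF _ assms, of "h - f"] coboundaries_diff [OF _ assms, of "h - g"]
    by (auto simp: algebra_simps)
  then show ?thesis
    by (auto simp: cls_iff)
qed

lemma cls_cocycle: "f \<in> cocycles scale n \<Longrightarrow> g \<in> cls n f \<Longrightarrow> g \<in> cocycles scale n"
  using cocycles_add [of "g - f" n f] coboundaries_cocycles by (simp add: cls_iff)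

lemma cls_eq_coboundaries: "cls n 0 = coboundaries scale n"
  using cls_iff [of _ n 0] by auto

text \<open>Operations on classes are defined as unions over representatives. Once all results are
  cohomologous, every member of the union is the same class, and the union is that class.\<close>

lemma UN_cls_unary:
  assumes "\<And>f'. f' \<in> cls p f \<Longrightarrow> F f' - F f \<in> coboundaries scale n"
  shows "(\<Union>f'\<in>cls p f. HH_class scale n (F f')) = cls n (F f)"
proof -
  have "HH_class scale n (F f') = cls n (F f)" if "f' \<in> cls p f" for f'
    using cls_eqI [OF assms [OF that]] by (simp add: cls_def)
  then show ?thesis
    using cls_self by blast
qed

lemma UN_cls_binary:
  assumes "\<And>f' g'. f' \<in> cls p f \<Longrightarrow> g' \<in> cls q g \<Longrightarrow> F f' g' - F f g \<in> coboundaries scale n"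
  shows "(\<Union>f'\<in>cls p f. \<Union>g'\<in>cls q g. HH_class scale n (F f' g')) = cls n (F f g)"
proof -
  have "HH_class scale n (F f' g') = cls n (F f g)" if "f' \<in> cls p f" "g' \<in> cls q g" for f' g'
    using cls_eqI [OF assms [OF that]] by (simp add: cls_def)
  then show ?thesis
    using cls_self by blast
qed

lemma HH_carrier: "carrier (HH scale n) = cls n ` cocycles scale n"
  by (simp add: HH_def cls_def [abs_def])

lemma HH_zero: "\<zero>\<^bsub>HH scale n\<^esub> = cls n 0"
  by (simp add: HH_def cls_eq_coboundaries)

lemma HH_add: "cls n f \<oplus>\<^bsub>HH scale n\<^esub> cls n g = cls n (f + g)"
proof -
  have "cls n f \<oplus>\<^bsub>HH scale n\<^esub> cls n g = (\<Union>f'\<in>cls n f. \<Union>g'\<in>cls n g. HH_class scale n (f' + g'))"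
    by (simp add: HH_def)
  also have "\<dots> = cls n (f + g)"
  proof (rule UN_cls_binary)
    fix f' g' assume "f' \<in> cls n f" "g' \<in> cls n g"
    then have "(f' - f) + (g' - g) \<in> coboundaries scale n"
      by (intro coboundaries_add) (simp_all add: cls_iff)
    then show "f' + g' - (f + g) \<in> coboundaries scale n"
      by (simp add: algebra_simps)
  qed
  finally show ?thesis .
qed

lemma HH_smult: "c \<odot>\<^bsub>HH scale n\<^esub> cls n f = cls n (scale_fun c f)"
proof -
  have "c \<odot>\<^bsub>HH scale n\<^esub> cls n f = (\<Union>f'\<in>cls n f. HH_class scale n (scale_fun c f'))"
    by (simp add: HH_def scale_fun_def)
  also have "\<dots> = cls n (scale_fun c f)"
    by (rule UN_cls_unary) (simp add: cls_iff scale_fun_diff [symmetric] coboundaries_scale_fun)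
  finally show ?thesis .
qed

lemma HH_smult_powi: "(- 1) powi k \<odot>\<^bsub>HH scale n\<^esub> cls n f = cls n (sg k f)"
  by (simp add: HH_smult scale_fun_powi)

lemma HH_cup_cls:
  assumes f: "f \<in> cocycles scale p" and g: "g \<in> cocycles scale q"
  shows "HH_cup scale p q (cls p f) (cls q g) = cls (p + q) (sg (p * q) (dot f g))"
proof -
  have e: "cochain_cup scale p q f' g' = sg (p * q) (dot f' g')"
    if "f' \<in> cocycles scale p" "g' \<in> cocycles scale q" for f' g'
    using that by (intro cochain_cup_eq_dot) (auto simp: cocycles_iff cochains_iff)
  have "HH_cup scale p q (cls p f) (cls q g) = cls (p + q) (cochain_cup scale p q f g)"
    unfolding HH_cup_def
  proof (rule UN_cls_binary)
    fix f' g' assume *: "f' \<in> cls p f" "g' \<in> cls q g"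
    have g': "g' \<in> cocycles scale q" and f': "f' \<in> cocycles scale p"
      using cls_cocycle f g * by blast+
    obtain a where a: "a \<in> cochains scale (p - 1)" "f' - f = dif (p - 1) a"
      using * by (auto simp: cls_iff coboundaries_iff)
    obtain b where b: "b \<in> cochains scale (q - 1)" "g' - g = dif (q - 1) b"
      using * by (auto simp: cls_iff coboundaries_iff)
    \<comment> \<open>The representatives are changed one at a time, \<open>f\<close> first; each
      change is a product of a coboundary and a cocycle, hence a coboundary.\<close>
    have 1: "dif (p + q - 1) (dot a g') = sg q (dot (f' - f) g')"
      using dif_dot [of "p - 1" a q g'] a g' by (simp add: cochains_iff cocycles_iff algebra_simps)
    have 2: "dif (p + q - 1) (dot f b) = dot f (g' - g)"
      using dif_dot [of p f "q - 1" b] b f by (simp add: cochains_iff cocycles_iff algebra_simps)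
    have "dot f' g' - dot f g = dot (f' - f) g' + dot f (g' - g)"
      by (simp add: dot_diff_left dot_diff_right)
    also have "\<dots> = sg q (dif (p + q - 1) (dot a g')) + dif (p + q - 1) (dot f b)"
      unfolding 1 2 by (simp add: sg_def)
    also have "\<dots> \<in> coboundaries scale (p + q)"
    proof (intro coboundaries_add coboundaries_sg)
      show "dif (p + q - 1) (dot a g') \<in> coboundaries scale (p + q)"
        using cochains_dot [of a "p - 1" g' q] a g' unfolding coboundaries_iff
        by (intro bexI [of _ "dot a g'"]) (auto simp: cocycles_iff algebra_simps)
      show "dif (p + q - 1) (dot f b) \<in> coboundaries scale (p + q)"
        using cochains_dot [of f p b "q - 1"] b f unfolding coboundaries_iff
        by (intro bexI [of _ "dot f b"]) (auto simp: cocycles_iff algebra_simps)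
    qed
    finally show "cochain_cup scale p q f' g' - cochain_cup scale p q f g \<in> coboundaries scale (p + q)"
      unfolding e [OF f' g'] e [OF f g] sg_diff [symmetric] by (rule coboundaries_sg)
  qed
  then show ?thesis
    by (simp only: e [OF f g])
qed

lemma br_diff_left: "slot_additive g \<Longrightarrow> br p q (f - f') g = br p q f g - br p q f' g"
  and br_diff_right: "slot_additive f \<Longrightarrow> br p q f (g - g') = br p q f g - br p q f g'"
  and br_add_left: "slot_additive g \<Longrightarrow> br p q (f + f') g = br p q f g + br p q f' g"
  and br_add_right: "slot_additive f \<Longrightarrow> br p q f (g + g') = br p q f g + br p q f g'"
  by (simp_all add: br_fun ins_diff ins_plus ins_arg_diff_fun ins_arg_plus sg_diff sg_add)

lemma br_scale_fun_left: "homogeneous g \<Longrightarrow> br p q (scale_fun c f) g = scale_fun c (br p q f g)"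
  and br_scale_fun_right: "homogeneous f \<Longrightarrow> br p q f (scale_fun c g) = scale_fun c (br p q f g)"
  by (simp_all add: br_fun ins_scale_fun ins_arg_scale_fun scale_fun_diff scale_fun_sg)

lemma HH_bracket_cls:
  assumes f: "f \<in> cocycles scale p" and g: "g \<in> cocycles scale q"
  shows "HH_bracket scale p q (cls p f) (cls q g) = cls (p + q - 1) (br p q f g)"
proof -
  have e: "cochain_bracket scale p q f' g' = br p q f' g'"
    if "f' \<in> cocycles scale p" "g' \<in> cocycles scale q" for f' g'
    using that by (intro cochain_bracket_eq_br) (auto simp: cocycles_iff cochains_iff)
  have "HH_bracket scale p q (cls p f) (cls q g) = cls (p + q - 1) (cochain_bracket scale p q f g)"
    unfolding HH_bracket_def
  proof (rule UN_cls_binary)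
    fix f' g' assume *: "f' \<in> cls p f" "g' \<in> cls q g"
    have g': "g' \<in> cocycles scale q" and f': "f' \<in> cocycles scale p"
      using cls_cocycle f g * by blast+
    obtain a where a: "a \<in> cochains scale (p - 1)" "f' - f = dif (p - 1) a"
      using * by (auto simp: cls_iff coboundaries_iff)
    obtain b where b: "b \<in> cochains scale (q - 1)" "g' - g = dif (q - 1) b"
      using * by (auto simp: cls_iff coboundaries_iff)
    have ac: "slot_additive f" "slot_additive g'" "slot_additive a" "slot_additive b"
      "in_degree p f" "in_degree q g'" "in_degree (p - 1) a" "in_degree (q - 1) b"
      using f g' a b by (auto simp: cocycles_iff cochains_iff)
    have 1: "dif (p + q - 2) (br (p - 1) q a g') = br p q (f' - f) g'"
      using dif_br [OF ac(3,7,2,6)] g' ac a by (simp add: cocycles_iff br_zero_right algebra_simps)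
    have 2: "dif (p + q - 2) (br p (q - 1) f b) = sg (p - 1) (br p q f (g' - g))"
      using dif_br [OF ac(1,5,4,8)] f ac b by (simp add: cocycles_iff br_zero_left algebra_simps)
    have "br p q f' g' - br p q f g = br p q (f' - f) g' + br p q f (g' - g)"
      by (simp add: br_diff_left br_diff_right ac)
    also have "\<dots> = dif (p + q - 2) (br (p - 1) q a g') + sg (p - 1) (dif (p + q - 2) (br p (q - 1) f b))"
      unfolding 1 2 by (simp add: sg_def)
    also have "\<dots> \<in> coboundaries scale (p + q - 1)"
    proof (intro coboundaries_add coboundaries_sg)
      show "dif (p + q - 2) (br (p - 1) q a g') \<in> coboundaries scale (p + q - 1)"
        using cochains_br [of a "p - 1" g' q] a g' unfolding coboundaries_iff
        by (intro bexI [of _ "br (p - 1) q a g'"]) (auto simp: cocycles_iff algebra_simps)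
      show "dif (p + q - 2) (br p (q - 1) f b) \<in> coboundaries scale (p + q - 1)"
        using cochains_br [of f p b "q - 1"] b f unfolding coboundaries_iff
        by (intro bexI [of _ "br p (q - 1) f b"]) (auto simp: cocycles_iff algebra_simps)
    qed
    finally show "cochain_bracket scale p q f' g' - cochain_bracket scale p q f g \<in> coboundaries scale (p + q - 1)"
      unfolding e [OF f' g'] e [OF f g] .
  qed
  then show ?thesis
    by (simp only: e [OF f g])
qed

lemma HH_abelian_group: "abelian_group (HH scale n)"
proof (rule abelian_groupI)
  show "\<exists>y\<in>carrier (HH scale n). y \<oplus>\<^bsub>HH scale n\<^esub> x = \<zero>\<^bsub>HH scale n\<^esub>"
    if "x \<in> carrier (HH scale n)" for x
  proof -
    note carr = that
    obtain f where f: "x = cls n f" "f \<in> cocycles scale n"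
      using carr unfolding HH_carrier by blast
    have "0 - f \<in> cocycles scale n"
      using f coboundaries_cocycles [OF coboundaries_zero] by (intro cocycles_diff) auto
    then show ?thesis
      using f(1) by (intro bexI [of _ "cls n (0 - f)"]) (auto simp: HH_carrier HH_add HH_zero)
  qed
qed (auto simp: HH_carrier HH_add HH_zero cocycles_add coboundaries_cocycles [OF coboundaries_zero] algebra_simps)

lemma HH_minus: "f \<in> cocycles scale n \<Longrightarrow> g \<in> cocycles scale n \<Longrightarrow>
  cls n f \<ominus>\<^bsub>HH scale n\<^esub> cls n g = cls n (f - g)"
proof -
  assume f: "f \<in> cocycles scale n" and g: "g \<in> cocycles scale n"
  interpret abelian_group "HH scale n"
    by (rule HH_abelian_group)
  have "0 - g \<in> cocycles scale n"
    using g coboundaries_cocycles [OF coboundaries_zero] by (intro cocycles_diff) auto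
  then have "\<ominus>\<^bsub>HH scale n\<^esub> cls n g = cls n (0 - g)"
    using g by (intro minus_equality) (auto simp: HH_carrier HH_add HH_zero)
  then show ?thesis
    by (simp add: a_minus_def HH_add)
qed

lemma scale_fun_scale_fun: "scale_fun a (scale_fun b f) = scale_fun (a * b) f"
  and scale_fun_one: "scale_fun 1 f = f"
  and scale_fun_add_left: "scale_fun (a + b) f = scale_fun a f + scale_fun b f"
  by (auto simp: scale_fun_def scale_left_distrib)

lemma HH_module: "Module.module (ring_of_type_algebra :: 'k ring) (HH scale n)"
proof (rule moduleI)
  show "cring (ring_of_type_algebra :: 'k ring)"
    by (rule cring_from_type_algebra)
  show "abelian_group (HH scale n)"
    by (rule HH_abelian_group)
qed (auto simp: HH_carrier HH_smult HH_add ring_of_type_algebra_def cocycles_scale_fun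
    scale_fun_scale_fun scale_fun_one scale_fun_add scale_fun_add_left)

lemma HH_linear_mapI:
  assumes "\<And>f. f \<in> cocycles scale n \<Longrightarrow> F (cls n f) = cls m (G f)"
    and "\<And>f. f \<in> cocycles scale n \<Longrightarrow> G f \<in> cocycles scale m"
    and "\<And>f g. f \<in> cocycles scale n \<Longrightarrow> g \<in> cocycles scale n \<Longrightarrow> G (f + g) = G f + G g"
    and "\<And>c f. f \<in> cocycles scale n \<Longrightarrow> G (scale_fun c f) = scale_fun c (G f)"
  shows "linear_map (HH scale n) (HH scale m) F"
  using assms
  by (auto simp: linear_map_def HH_carrier HH_add HH_smult cocycles_add cocycles_scale_fun)

section \<open>Graded commutativity, Poisson identity and the Gerstenhaber structure\<close>

lemma dot_commute_cohomologous:
  assumes "f \<in> cocycles scale p" "g \<in> cocycles scale q"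
  shows "dot f g - sg (p * q) (dot g f) \<in> coboundaries scale (p + q)"
proof -
  have f: "slot_additive f" "in_degree p f" "dif p f = 0" and g: "in_degree q g" "dif q g = 0"
    and fg: "f \<in> cochains scale p" "g \<in> cochains scale q"
    using assms by (auto simp: cocycles_iff cochains_iff)
  have "dif (p + q - 1) (ins q g f) = - sg ((q + 1) * p) (dot f g) - sg (p + 1) (dot g f)"
    using ins_dif [OF f(1,2) g(1)] f g by (simp add: eq_neg_iff_add_eq_0 algebra_simps)
  then have "dot f g - sg (p * q) (dot g f) = - sg ((q + 1) * p) (dif (p + q - 1) (ins q g f))"
    by (cases "even p"; cases "even q") (simp_all add: sg_def)
  also have "\<dots> \<in> coboundaries scale (p + q)"
    using cochains_ins [OF fg]
    by (intro coboundaries_minus coboundaries_sg) (auto simp: coboundaries_iff)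
  finally show ?thesis .
qed

text \<open>The half of the bracket that inserts \<open>x\<close> into the product of
  \<open>y\<close> and \<open>z\<close> is a derivation exactly, by \<open>ins_dot\<close>. The half
  that inserts the product into \<open>x\<close> is one up to the boundary of
  \<open>two_ins q r y z x\<close>. The signs \<open>q * r\<close> and the like come from the cup
  product.\<close>

lemma poisson_cohomologous:
  assumes "x \<in> cocycles scale p" "y \<in> cocycles scale q" "z \<in> cocycles scale r"
  shows "br p (q + r) x (sg (q * r) (dot y z)) - (sg ((p + q - 1) * r) (dot (br p q x y) z)
    + sg ((p - 1) * q + q * (p + r - 1)) (dot y (br p r x z))) \<in> coboundaries scale (p + q + r - 1)"
proof -
  have x: "slot_additive x" "in_degree p x" "dif p x = 0" and y: "slot_additive y" "in_degree q y" "dif q y = 0"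
    and z: "in_degree r z" "dif r z = 0"
    and c: "x \<in> cochains scale p" "y \<in> cochains scale q" "z \<in> cochains scale r"
    using assms by (auto simp: cocycles_iff cochains_iff)
  have 0: "dif (p + q + r - 2) (two_ins q r y z x) \<in> coboundaries scale (p + q + r - 1)"
    using cochains_two_ins [OF c] unfolding coboundaries_iff by (auto simp: algebra_simps)
  have "br p (q + r) x (sg (q * r) (dot y z)) - (sg ((p + q - 1) * r) (dot (br p q x y) z)
    + sg ((p - 1) * q + q * (p + r - 1)) (dot y (br p r x z))) =
    - sg (p + q) (dif (p + q + r - 2) (two_ins q r y z x))"
    unfolding dif_two_ins [OF x y z] br_fun dot_diff_left dot_diff_right ins_sg_fun
      ins_arg_sg_fun [OF x(1)] ins_dot [OF y(2)] dot_sg_left dot_sg_right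
    by (cases "even p"; cases "even q"; cases "even r")
      (simp_all add: sg_def dot_minus_left dot_minus_right algebra_simps)
  then show ?thesis
    using coboundaries_minus [OF coboundaries_sg [OF 0]] by simp
qed

definition unit_cochain :: "'h list \<Rightarrow> 'h" where
  "unit_cochain = (\<lambda>as. if as = [] then 1 else 0)"

lemma dot_unit_left: "dot unit_cochain f = f"
proof
  fix w
  have "dot unit_cochain f w = splitsum (\<lambda>u v. if u = [] then f v else 0) w"
    unfolding dot_def unit_cochain_def by (intro splitsum_cong) auto
  then show "dot unit_cochain f w = f w"
    by (simp only: splitsum_Nil_left)
qed

lemma dot_unit_right: "dot f unit_cochain = f"
proof
  fix w
  have "dot f unit_cochain w = splitsum (\<lambda>u v. if v = [] then f u else 0) w"
    unfolding dot_def unit_cochain_def by (intro splitsum_cong) auto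
  then show "dot f unit_cochain w = f w"
    by (simp only: splitsum_Nil_right)
qed

lemma unit_cocycle: "unit_cochain \<in> cocycles scale 0"
proof -
  have "ins 2 mul2 unit_cochain = (0 :: 'h list \<Rightarrow> 'h)"
    by (auto simp: fun_eq_iff ins_def unit_cochain_def)
  then show ?thesis
    by (simp add: cocycles_iff cochains_iff dif_def dot_unit_left dot_unit_right sg_def)
      (simp add: unit_cochain_def in_degree_def slot_additive_def homogeneous_def normalized_def)
qed

theorem HH_gerstenhaber_algebra:
  "gerstenhaber_algebra (HH scale) (HH_cup scale) (HH_unit scale) (HH_bracket scale)"
proof (rule gerstenhaber_algebra.intro)
  have unit: "HH_unit scale = cls 0 unit_cochain"
    by (simp add: HH_unit_def cls_def unit_cochain_def)
  show "Module.module (ring_of_type_algebra :: 'k ring) (HH scale n)" for n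
    by (rule HH_module)
  show "HH_unit scale \<in> carrier (HH scale 0)"
    by (simp add: unit HH_carrier unit_cocycle)
  show "linear_map (HH scale p) (HH scale (p + q)) (\<lambda>x. HH_cup scale p q x y)"
    if "y \<in> carrier (HH scale q)" for y p q
  proof -
    note carr = that
    obtain g where g: "y = cls q g" "g \<in> cocycles scale q"
      using carr by (auto simp: HH_carrier)
    show ?thesis
      unfolding g(1)
      by (rule HH_linear_mapI, erule HH_cup_cls [OF _ g(2)])
        (simp_all add: cocycles_sg cocycles_dot g dot_add_left sg_add dot_scale_fun_left scale_fun_sg)
  qed
  show "linear_map (HH scale q) (HH scale (p + q)) (HH_cup scale p q x)"
    if "x \<in> carrier (HH scale p)" for x p q
  proof -
    note carr = that
    obtain g where g: "x = cls p g" "g \<in> cocycles scale p"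
      using carr by (auto simp: HH_carrier)
    show ?thesis
      unfolding g(1)
      by (rule HH_linear_mapI, erule HH_cup_cls [OF g(2)])
        (simp_all add: cocycles_sg cocycles_dot g dot_add_right sg_add dot_scale_fun_right scale_fun_sg)
  qed
  show "HH_cup scale 0 p (HH_unit scale) x = x" if "x \<in> carrier (HH scale p)" for x p
    using that HH_cup_cls [OF unit_cocycle] by (auto simp: HH_carrier unit dot_unit_left)
  show "HH_cup scale (p + q) r (HH_cup scale p q x y) z = HH_cup scale p (q + r) x (HH_cup scale q r y z)"
    if "x \<in> carrier (HH scale p)" "y \<in> carrier (HH scale q)" "z \<in> carrier (HH scale r)" for x p y q z r
    using that
    by (auto simp: HH_carrier HH_cup_cls cocycles_sg cocycles_dot dot_sg_left dot_sg_right dot_assoc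
        algebra_simps)
  show "HH_cup scale p q x y = (- 1) powi (p * q) \<odot>\<^bsub>HH scale (p + q)\<^esub> HH_cup scale q p y x"
    if "x \<in> carrier (HH scale p)" "y \<in> carrier (HH scale q)" for x p y q
  proof -
    note carr = that
    obtain f g where fg: "x = cls p f" "f \<in> cocycles scale p" "y = cls q g" "g \<in> cocycles scale q"
      using carr by (auto simp: HH_carrier)
    have "cls (p + q) (sg (p * q) (dot f g)) = cls (p + q) (sg (p * q) (sg (q * p) (dot g f)))"
      using coboundaries_sg [OF dot_commute_cohomologous [OF fg(2,4)], of "p * q"]
      by (intro cls_eqI) (simp add: sg_diff mult.commute)
    then show ?thesis
      by (simp only: fg HH_cup_cls HH_smult_powi add.commute [of q p])
  qed
  show "linear_map (HH scale p) (HH scale (p + q - 1)) (\<lambda>x. HH_bracket scale p q x y)"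
    if "y \<in> carrier (HH scale q)" for y p q
  proof -
    note carr = that
    obtain g where g: "y = cls q g" "g \<in> cocycles scale q"
      using carr by (auto simp: HH_carrier)
    then have g': "slot_additive g" "homogeneous g"
      by (auto simp: cocycles_iff cochains_iff)
    show ?thesis
      unfolding g(1)
      by (rule HH_linear_mapI, erule HH_bracket_cls [OF _ g(2)])
        (simp_all add: cocycles_br g g' br_add_left br_scale_fun_left)
  qed
  show "linear_map (HH scale q) (HH scale (p + q - 1)) (HH_bracket scale p q x)"
    if "x \<in> carrier (HH scale p)" for x p q
  proof -
    note carr = that
    obtain g where g: "x = cls p g" "g \<in> cocycles scale p"
      using carr by (auto simp: HH_carrier)
    then have g': "slot_additive g" "homogeneous g"
      by (auto simp: cocycles_iff cochains_iff)
    show ?thesis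
      unfolding g(1)
      by (rule HH_linear_mapI, erule HH_bracket_cls [OF g(2)])
        (simp_all add: cocycles_br g g' br_add_right br_scale_fun_right)
  qed
  show "HH_bracket scale p q x y =
      (- ((- 1) powi ((p - 1) * (q - 1)))) \<odot>\<^bsub>HH scale (p + q - 1)\<^esub> HH_bracket scale q p y x"
    if "x \<in> carrier (HH scale p)" "y \<in> carrier (HH scale q)" for x p y q
  proof -
    note carr = that
    obtain f g where fg: "x = cls p f" "f \<in> cocycles scale p" "y = cls q g" "g \<in> cocycles scale q"
      using carr by (auto simp: HH_carrier)
    have "br p q f g = scale_fun (- ((- 1) powi ((p - 1) * (q - 1)))) (br q p g f)"
      by (auto simp: fun_eq_iff scale_fun_def powi_scale br_def sg_def mult.commute)
    then show ?thesis
      by (simp only: fg HH_bracket_cls HH_smult add.commute [of q p])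
  qed
  show "HH_bracket scale p (q + r - 1) x (HH_bracket scale q r y z) =
        HH_bracket scale (p + q - 1) r (HH_bracket scale p q x y) z
        \<oplus>\<^bsub>HH scale (p + q + r - 2)\<^esub> (- 1) powi ((p - 1) * (q - 1))
          \<odot>\<^bsub>HH scale (p + q + r - 2)\<^esub> HH_bracket scale q (p + r - 1) y (HH_bracket scale p r x z)"
    if "x \<in> carrier (HH scale p)" "y \<in> carrier (HH scale q)" "z \<in> carrier (HH scale r)" for x p y q z r
  proof -
    note carr = that
    obtain f g h where fg: "x = cls p f" "f \<in> cocycles scale p" "y = cls q g" "g \<in> cocycles scale q"
      "z = cls r h" "h \<in> cocycles scale r"
      using carr by (auto simp: HH_carrier)
    have jac: "br p (q + r - 1) f (br q r g h) =
      br (p + q - 1) r (br p q f g) h + sg ((p - 1) * (q - 1)) (br q (p + r - 1) g (br p r f h))"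
      using fg by (intro jacobi_br) (auto simp: cocycles_iff cochains_iff)
    have e: "p + (q + r - 1) - 1 = p + q + r - 2" "p + q - 1 + r - 1 = p + q + r - 2"
      "q + (p + r - 1) - 1 = p + q + r - 2"
      by auto
    show ?thesis
      using jac by (simp only: fg HH_bracket_cls cocycles_br HH_smult_powi HH_add e)
  qed
  show "HH_bracket scale p (q + r) x (HH_cup scale q r y z) =
        HH_cup scale (p + q - 1) r (HH_bracket scale p q x y) z
        \<oplus>\<^bsub>HH scale (p + q + r - 1)\<^esub> (- 1) powi ((p - 1) * q)
          \<odot>\<^bsub>HH scale (p + q + r - 1)\<^esub> HH_cup scale q (p + r - 1) y (HH_bracket scale p r x z)"
    if "x \<in> carrier (HH scale p)" "y \<in> carrier (HH scale q)" "z \<in> carrier (HH scale r)" for x p y q z r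
  proof -
    note carr = that
    obtain f g h where fg: "x = cls p f" "f \<in> cocycles scale p" "y = cls q g" "g \<in> cocycles scale q"
      "z = cls r h" "h \<in> cocycles scale r"
      using carr by (auto simp: HH_carrier)
    have e: "p + (q + r) - 1 = p + q + r - 1" "p + q - 1 + r = p + q + r - 1"
      "q + (p + r - 1) = p + q + r - 1"
      by auto
    show ?thesis
      using cls_eqI [OF poisson_cohomologous [OF fg(2,4,6)]]
      by (simp only: fg HH_bracket_cls HH_cup_cls cocycles_br cocycles_sg cocycles_dot HH_smult_powi HH_add e sg_sg)
  qed
qed

end

section \<open>Frobenius algebras with a Nakayama automorphism of finite order\<close>

lemma ins_idc_apply:
  assumes "G 0 = 0"
  shows "ins q g (\<lambda>b. G (idc b)) w = G (g w)"
proof -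
  have "ins q g (\<lambda>b. G (idc b)) w = splitsum (\<lambda>u R. if u = [] then
      splitsum (\<lambda>v x. if x = [] then G (g v) else 0) R else 0) w"
    unfolding ins_def by (intro splitsum_cong) (auto simp: idc_append assms cong: if_cong intro!: splitsum_cong)
  then show ?thesis
    by (simp only: splitsum_Nil_right splitsum_Nil_left)
qed

lemma hom_sg:
  assumes "\<And>a b. h (a + b) = h a + h b"
  shows "h (sg n (a :: 'a::ab_group_add)) = sg n (h a :: 'b::ab_group_add)"
proof -
  have "h 0 = 0"
    using assms [of 0 0] by simp
  then have "h (- a) = - h a"
    using assms [of a "- a"] by (simp add: eq_neg_iff_add_eq_0 add.commute)
  then show ?thesis
    by (simp add: sg_def)
qed

lemma hom_ins:
  assumes "\<And>a b. h (a + b) = h a + h b"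
  shows "h (ins q g F w) = ins q g (\<lambda>t. h (F t)) w"
proof -
  have 0: "h 0 = 0"
    using assms [of 0 0] by simp
  show ?thesis
    by (simp add: ins_def splitsum_hom [of h, OF 0 assms] hom_sg [of h, OF assms])
qed

text \<open>The interface between the two halves of the proof. All that the construction of the
  operator needs from the Hopf algebra is a form whose Nakayama automorphism has order dividing some
  \<open>N\<close> that is invertible in the field. \<open>form_nondegenerate\<close> and
  \<open>form_surj\<close> together say that \<open>c \<mapsto> \<phi> (_ * c)\<close> is a
  bijection onto the dual space, so cochains can be defined by prescribing their pairings.\<close>

locale frobenius_form = k_algebra scale
  for scale :: "'k::field \<Rightarrow> 'h::ring_1 \<Rightarrow> 'h" +
  fixes \<phi> :: "'h \<Rightarrow> 'k" and \<nu> :: "'h \<Rightarrow> 'h" and N :: nat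
  assumes form_add: "\<phi> (a + b) = \<phi> a + \<phi> b"
    and form_scale: "\<phi> (scale c a) = c * \<phi> a"
    and form_nondegenerate: "(\<And>a. \<phi> (a * b) = 0) \<Longrightarrow> b = 0"
    and form_surj: "(\<And>a b. \<psi> (a + b) = \<psi> a + \<psi> b) \<Longrightarrow> (\<And>c a. \<psi> (scale c a) = c * \<psi> a) \<Longrightarrow>
      \<exists>c. \<forall>a. \<phi> (a * c) = \<psi> a"
    and nakayama: "\<phi> (a * b) = \<phi> (b * \<nu> a)"
    and nu_add: "\<nu> (a + b) = \<nu> a + \<nu> b"
    and nu_scale: "\<nu> (scale c a) = scale c (\<nu> a)"
    and nu_mult: "\<nu> (a * b) = \<nu> a * \<nu> b"
    and nu_one: "\<nu> 1 = 1"
    and nu_order: "(\<nu> ^^ N) a = a"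
    and order_nonzero: "of_nat N \<noteq> (0::'k)"
begin

text \<open>The inverse of \<open>\<nu>\<close>, which finite order provides as a power.\<close>

definition \<mu> :: "'h \<Rightarrow> 'h" where
  "\<mu> = \<nu> ^^ (N - 1)"

lemma N_pos: "N > 0"
  using order_nonzero by (cases N) auto

lemma nu_mu [simp]: "\<nu> (\<mu> a) = a"
  and mu_nu [simp]: "\<mu> (\<nu> a) = a"
proof -
  obtain n where n: "N = Suc n"
    using N_pos by (cases N) auto
  have m: "\<mu> = \<nu> ^^ n"
    unfolding \<mu>_def using n by simp
  have "(\<nu> ^^ Suc n) a = a"
    using nu_order [of a] n by simp
  then show "\<nu> (\<mu> a) = a" "\<mu> (\<nu> a) = a"
    by (simp_all add: m funpow_swap1)
qed

lemma mu_eq_iff: "\<mu> a = b \<longleftrightarrow> a = \<nu> b"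
  by auto

lemma mu_add: "\<mu> (a + b) = \<mu> a + \<mu> b"
  by (simp add: mu_eq_iff nu_add)

lemma mu_scale: "\<mu> (scale c a) = scale c (\<mu> a)"
  by (simp add: mu_eq_iff nu_scale)

lemma mu_mult: "\<mu> (a * b) = \<mu> a * \<mu> b"
  by (simp add: mu_eq_iff nu_mult)

lemma nu_zero [simp]: "\<nu> 0 = 0"
  using nu_add [of 0 0] by simp

lemma mu_zero [simp]: "\<mu> 0 = 0"
  by (simp add: mu_eq_iff)

lemma form_zero [simp]: "\<phi> 0 = 0"
  using form_add [of 0 0] by (metis add.right_neutral add_left_cancel)

lemma form_minus: "\<phi> (- a) = - \<phi> a"
  using form_add [of a "- a"] by (simp add: eq_neg_iff_add_eq_0 add.commute)

lemma form_diff: "\<phi> (a - b) = \<phi> a - \<phi> b"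
  using form_add [of a "- b"] by (simp add: form_minus)

lemma form_sg: "\<phi> (sg n a) = sg n (\<phi> a)"
  by (simp add: sg_def form_minus)

lemma form_splitsum: "\<phi> (splitsum F w) = splitsum (\<lambda>u v. \<phi> (F u v)) w"
  by (rule splitsum_hom) (auto simp: form_add)

lemma form_ins: "\<phi> (ins q g F w) = ins q g (\<lambda>t. \<phi> (F t)) w"
  by (rule hom_ins) (rule form_add)

lemma form_nu: "\<phi> (\<nu> a) = \<phi> a"
  using nakayama [of a 1] by simp

lemma form_mu: "\<phi> (a * \<mu> b) = \<phi> (\<nu> a * b)"
  by (metis form_nu nu_mu nu_mult)

lemma form_mult_last: "\<phi> (a * c) = \<phi> (\<mu> c * a)"
  using nakayama [of "\<mu> c" a] by simp

lemma form_cancel: "(\<And>a. \<phi> (a * c) = \<phi> (a * d)) \<Longrightarrow> c = d"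
  using form_nondegenerate [of "c - d"] by (simp add: right_diff_distrib form_diff)

lemma form_cancel_fun: "(\<And>a w. \<phi> (a * f w) = \<phi> (a * g w)) \<Longrightarrow> f = g"
  by (rule ext, rule form_cancel)

definition frep :: "('h \<Rightarrow> 'k) \<Rightarrow> 'h" where
  "frep \<psi> = (THE c. \<forall>a. \<phi> (a * c) = \<psi> a)"

lemma form_frep:
  assumes "\<And>a b. \<psi> (a + b) = \<psi> a + \<psi> b" "\<And>c a. \<psi> (scale c a) = c * \<psi> a"
  shows "\<phi> (a * frep \<psi>) = \<psi> a"
proof -
  obtain c where c: "\<forall>a. \<phi> (a * c) = \<psi> a"
    using form_surj [of \<psi>] assms by blast
  have "frep \<psi> = c"
    unfolding frep_def
  proof (rule the_equality [where P = "\<lambda>c. \<forall>a. \<phi> (a * c) = \<psi> a", OF c])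
    fix d assume "\<forall>a. \<phi> (a * d) = \<psi> a"
    with c show "d = c"
      by (intro form_cancel) auto
  qed
  with c show ?thesis
    by simp
qed

text \<open>The scalar-valued counterpart of a normalized cochain, without a fixed degree; pairing a
  cochain with the form gives such a function.\<close>

definition kform :: "('h list \<Rightarrow> 'k) \<Rightarrow> bool" where
  "kform F \<longleftrightarrow> slot_additive F \<and> (\<forall>u c a x. F (u @ scale c a # x) = c * F (u @ a # x)) \<and>
    (\<forall>u x. F (u @ 1 # x) = 0)"

definition kbilinear :: "('h \<Rightarrow> 'h list \<Rightarrow> 'h list \<Rightarrow> 'k) \<Rightarrow> bool" where
  "kbilinear Q \<longleftrightarrow>
    (\<forall>a b u x. Q (a + b) u x = Q a u x + Q b u x) \<and> (\<forall>c a u x. Q (scale c a) u x = c * Q a u x) \<and>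
    (\<forall>a x. kform (\<lambda>u. Q a u x)) \<and> (\<forall>a u. kform (\<lambda>x. Q a u x))"

text \<open>A sum over rotations of the cyclic word \<open>a\<close>, \<open>u\<close>,
  \<open>x\<close>, which bring \<open>x\<close> to the front. The sign is that of moving
  \<open>x\<close> past \<open>a\<close> and \<open>u\<close>, where \<open>q\<close> allows for a
  block of \<open>q\<close> letters in \<open>u\<close> that has been replaced by one letter;
  \<open>q = 1\<close> means that nothing was replaced.\<close>

definition wheel :: "int \<Rightarrow> ('h \<Rightarrow> 'h list \<Rightarrow> 'h list \<Rightarrow> 'k) \<Rightarrow> 'h \<Rightarrow> 'h list \<Rightarrow> 'k" where
  "wheel q Q a w = splitsum (\<lambda>u x. sg ((int (length u) + q) * int (length x)) (Q a u x)) w"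

definition wheel_cochain :: "int \<Rightarrow> ('h \<Rightarrow> 'h list \<Rightarrow> 'h list \<Rightarrow> 'k) \<Rightarrow> 'h list \<Rightarrow> 'h" where
  "wheel_cochain q Q w = frep (\<lambda>a. wheel q Q a w)"

lemma mult_sg: "(c::'k) * sg n a = sg n (c * a)"
  by (simp add: sg_def)

lemma form_wheel:
  assumes "kbilinear Q"
  shows "\<phi> (a * wheel_cochain q Q w) = wheel q Q a w"
  unfolding wheel_cochain_def
proof (rule form_frep)
  show "wheel q Q (a + b) w = wheel q Q a w + wheel q Q b w" for a b
    using assms by (simp add: wheel_def kbilinear_def sg_add splitsum_add)
  show "wheel q Q (scale c a) w = c * wheel q Q a w" for c a
    using assms by (simp add: wheel_def kbilinear_def splitsum_mult_right mult_sg)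
qed

lemma kform_wheel:
  assumes "kbilinear Q"
  shows "kform (wheel q Q a)"
proof -
  have ku: "kform (\<lambda>u. Q a u x)" and kx: "kform (Q a u)" for a u x
    using assms by (simp_all add: kbilinear_def)
  have u: "Q a (s @ (b + c) # t) x = Q a (s @ b # t) x + Q a (s @ c # t) x"
    "Q a (s @ scale d b # t) x = d * Q a (s @ b # t) x"
    "Q a (s @ 1 # t) x = 0" for s b c t x d
    using ku [of a x] unfolding kform_def slot_additive_def by blast+
  have x: "Q a x (s @ (b + c) # t) = Q a x (s @ b # t) + Q a x (s @ c # t)"
    "Q a x (s @ scale d b # t) = d * Q a x (s @ b # t)"
    "Q a x (s @ 1 # t) = 0" for s b c t x d
    using kx [of a x] unfolding kform_def slot_additive_def by blast+
  show ?thesis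
    unfolding kform_def slot_additive_def
    by (auto simp: wheel_def splitsum_append u x sg_add splitsum_add splitsum_mult_right distrib_left mult_sg)
qed

lemma cochains_wheel:
  assumes Q: "kbilinear Q" and n: "\<And>a u x. int (length u) + int (length x) \<noteq> n \<Longrightarrow> Q a u x = 0"
  shows "wheel_cochain q Q \<in> cochains scale n"
proof -
  have k: "kform (wheel q Q a)" for a
    by (rule kform_wheel [OF Q])
  have eqI: "wheel_cochain q Q w = c" if "\<And>a. wheel q Q a w = \<phi> (a * c)" for w c
    by (rule form_cancel) (simp add: form_wheel [OF Q] that)
  have "wheel q Q a w = 0" if "int (length w) \<noteq> n" for a w
  proof -
    have "wheel q Q a w = splitsum (\<lambda>u x. 0) w"
      unfolding wheel_def using that by (intro splitsum_cong) (auto simp: n)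
    then show ?thesis
      by simp
  qed
  then have "in_degree n (wheel_cochain q Q)"
    by (auto simp: in_degree_def intro: eqI)
  moreover have "slot_additive (wheel_cochain q Q)" "homogeneous (wheel_cochain q Q)"
    unfolding slot_additive_def homogeneous_def using k
    by (auto intro!: eqI simp: form_wheel [OF Q] kform_def slot_additive_def distrib_left form_add
        scale_mult_right form_scale)
  moreover have "normalized (wheel_cochain q Q)"
    unfolding normalized_def
  proof (intro allI eqI)
    fix u c x a
    show "wheel q Q a (u @ scale c 1 # x) = \<phi> (a * 0)"
      using k [of a] unfolding kform_def by simp
  qed
  ultimately show ?thesis
    by (simp add: cochains_iff)
qed

text \<open>The summands multiply all neighbouring pairs of the cyclic word: two letters inside
  \<open>x\<close>, two inside \<open>u\<close>, the last letter of \<open>x\<close> with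
  \<open>a\<close> (it passes through the form and acquires \<open>\<mu>\<close>), and
  \<open>a\<close> with the first letter of \<open>u\<close>. The statement is for arbitrary
  \<open>Q\<close> because it serves both \<open>bvd\<close> and the homotopy
  \<open>insd\<close>.\<close>

lemma form_dif_wheel:
  assumes Q: "kbilinear Q" and n: "\<And>a u x. int (length u) + int (length x) \<noteq> n \<Longrightarrow> Q a u x = 0"
  shows "\<phi> (a * dif n (wheel_cochain q Q) w) = sg (n + q)
    (splitsum (\<lambda>u x. sg ((int (length u) + q) * int (length x))
      (ins 2 mul2 (Q a u) x + sg (int (length x) + q) (ins 2 mul2 (\<lambda>u. Q a u x) u)
       + splitsum (\<lambda>s b. sg (int (length s)) (Q (\<mu> (idc b) * a) u s)) x
       + sg (int (length x) + q + 1) (splitsum (\<lambda>s t. Q (a * idc s) t x) u))) w)"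
proof -
  let ?H = "wheel_cochain q Q"
  have Q0: "Q 0 u x = 0" for u x
  proof -
    have "Q (0 + 0) u x = Q 0 u x + Q 0 u x"
      using Q unfolding kbilinear_def by blast
    then show ?thesis
      by (metis add.right_neutral add_left_cancel)
  qed
  have slot_u: "slot_additive (\<lambda>u. Q a u x)" and slot_x: "slot_additive (Q a u)" for a u x
    using Q by (auto simp: kbilinear_def kform_def)
  have A: "\<phi> (a * dot ?H idc w) = sg (n + q) (splitsum (\<lambda>u x. sg ((int (length u) + q) * int (length x))
    (splitsum (\<lambda>s b. sg (int (length s)) (Q (\<mu> (idc b) * a) u s)) x)) w)"
  proof -
    have "\<phi> (a * dot ?H idc w) = splitsum (\<lambda>T b. \<phi> (\<mu> (idc b) * (a * ?H T))) w"
      by (simp add: dot_def splitsum_mult_right form_splitsum mult.assoc [symmetric]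
          form_mult_last [of _ "idc b" for b])
    also have "\<dots> = splitsum (\<lambda>T b. splitsum (\<lambda>u s. sg ((int (length u) + q) * int (length s))
        (Q (\<mu> (idc b) * a) u s)) T) w"
      by (simp add: mult.assoc [symmetric] form_wheel [OF Q] wheel_def)
    also have "\<dots> = splitsum (\<lambda>u x. splitsum (\<lambda>s b. sg ((int (length u) + q) * int (length s))
        (Q (\<mu> (idc b) * a) u s)) x) w"
      by (rule splitsum_assoc)
    also have "\<dots> = splitsum (\<lambda>u x. splitsum (\<lambda>s b. sg (n + q + ((int (length u) + q) * int (length x) + int (length s)))
        (Q (\<mu> (idc b) * a) u s)) x) w"
    proof (intro splitsum_cong)
      fix u x s b :: "'h list"
      assume x: "x = s @ b"
      show "sg ((int (length u) + q) * int (length s)) (Q (\<mu> (idc b) * a) u s) =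
        sg (n + q + ((int (length u) + q) * int (length x) + int (length s))) (Q (\<mu> (idc b) * a) u s)"
      proof (cases "length b = 1 \<and> int (length u) + int (length s) = n")
        case True
        then show ?thesis
          unfolding x by (intro sg_cong) (auto simp: algebra_simps)
      next
        case False
        then show ?thesis
          by (auto simp: idc_def Q0 n)
      qed
    qed
    finally show ?thesis
      by (simp add: splitsum_sg [symmetric])
  qed
  have B: "\<phi> (a * sg (n + 1) (dot idc ?H) w) = sg (n + q) (splitsum (\<lambda>u x. sg ((int (length u) + q) * int (length x))
    (sg (int (length x) + q + 1) (splitsum (\<lambda>s t. Q (a * idc s) t x) u))) w)"
  proof -
    have "\<phi> (a * sg (n + 1) (dot idc ?H) w) = sg (n + 1) (splitsum (\<lambda>s T. splitsum (\<lambda>t x.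
        sg ((int (length t) + q) * int (length x)) (Q (a * idc s) t x)) T) w)"
      by (simp add: sg_fun sg_mult_right form_sg dot_def splitsum_mult_right form_splitsum
          mult.assoc [symmetric] form_wheel [OF Q] wheel_def)
    also have "splitsum (\<lambda>s T. splitsum (\<lambda>t x.
        sg ((int (length t) + q) * int (length x)) (Q (a * idc s) t x)) T) w
      = splitsum (\<lambda>u x. splitsum (\<lambda>s t. sg ((int (length t) + q) * int (length x)) (Q (a * idc s) t x)) u) w"
      by (rule splitsum_assoc [symmetric])
    also have "sg (n + 1) \<dots> = splitsum (\<lambda>u x. splitsum (\<lambda>s t. sg (n + q + ((int (length u) + q) * int (length x)
        + (int (length x) + q + 1))) (Q (a * idc s) t x)) u) w"
      unfolding splitsum_sg [symmetric] sg_sg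
    proof (intro splitsum_cong)
      fix u x s t :: "'h list"
      assume u: "u = s @ t"
      show "sg (n + 1 + (int (length t) + q) * int (length x)) (Q (a * idc s) t x) =
        sg (n + q + ((int (length u) + q) * int (length x) + (int (length x) + q + 1))) (Q (a * idc s) t x)"
      proof (cases "length s = 1")
        case True
        then show ?thesis
          unfolding u by (intro sg_cong) (auto simp: algebra_simps)
      next
        case False
        then show ?thesis
          by (auto simp: idc_def Q0)
      qed
    qed
    finally show ?thesis
      by (simp add: splitsum_sg [symmetric])
  qed
  have C: "\<phi> (a * sg n (ins 2 mul2 ?H) w) = sg (n + q) (splitsum (\<lambda>u x. sg ((int (length u) + q) * int (length x))
    (ins 2 mul2 (Q a u) x + sg (int (length x) + q) (ins 2 mul2 (\<lambda>u. Q a u x) u))) w)"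
  proof -
    have "\<phi> (a * sg n (ins 2 mul2 ?H) w) = sg n (ins 2 mul2 (\<lambda>t. \<phi> (a * ?H t)) w)"
      by (simp add: sg_fun sg_mult_right form_sg hom_ins [where h = "\<lambda>t. \<phi> (a * t)"] distrib_left form_add)
    also have "(\<lambda>t. \<phi> (a * ?H t)) = splitsum (\<lambda>u x. sg ((int (length u) + q) * int (length x)) (Q a u x))"
      by (rule ext) (simp add: form_wheel [OF Q] wheel_def)
    also have "ins 2 mul2 \<dots> w = splitsum (\<lambda>u x.
      sg (int (length x) + (int (length u) + q) * int (length x)) (ins 2 mul2 (\<lambda>u. Q a u x) u)
      + sg (q + (int (length u) + q) * int (length x)) (ins 2 mul2 (Q a u) x)) w"
    proof -
      have "ins 2 mul2 (\<lambda>u. sg ((int (length u) + q) * int (length x)) (Q a u x)) u =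
        sg (int (length x) + (int (length u) + q) * int (length x)) (ins 2 mul2 (\<lambda>u. Q a u x) u)" for u x
      proof -
        have "ins 2 mul2 (\<lambda>u. sg ((int (length u) + q) * int (length x)) (Q a u x)) u =
          ins 2 mul2 (\<lambda>u. sg (q * int (length x)) (sg (int (length x) * int (length u)) (Q a u x))) u"
          by (simp add: algebra_simps)
        also have "\<dots> = sg (q * int (length x)) (sg (int (length x) * (int (length u) + 2 + 1)) (ins 2 mul2 (\<lambda>u. Q a u x) u))"
          by (simp only: ins_sg ins_sg_length [OF slot_u in_degree_mul2])
        also have "\<dots> = sg (int (length x) + (int (length u) + q) * int (length x)) (ins 2 mul2 (\<lambda>u. Q a u x) u)"
          unfolding sg_sg by (intro sg_cong) (auto simp: algebra_simps)
        finally show ?thesis .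
      qed
      moreover have "sg ((2 + 1) * int (length u)) (ins 2 mul2 (\<lambda>x. sg ((int (length u) + q) * int (length x)) (Q a u x)) x)
        = sg (q + (int (length u) + q) * int (length x)) (ins 2 mul2 (Q a u) x)" for u x
        unfolding ins_sg_length [OF slot_x in_degree_mul2] sg_sg by (intro sg_cong) (auto simp: algebra_simps)
      ultimately show ?thesis
        unfolding ins_splitsum by simp
    qed
    also have "sg n \<dots> = sg (n + q) (splitsum (\<lambda>u x. sg ((int (length u) + q) * int (length x))
      (ins 2 mul2 (Q a u) x + sg (int (length x) + q) (ins 2 mul2 (\<lambda>u. Q a u x) u))) w)"
      unfolding splitsum_sg [symmetric] sg_add sg_sg
      by (intro splitsum_cong) (subst add.commute, intro arg_cong2 [of _ _ _ _ "(+)"] sg_cong, auto)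
    finally show ?thesis .
  qed
  show ?thesis
    unfolding dif_def plus_fun_apply distrib_left form_add A B C
    by (simp add: splitsum_add sg_add algebra_simps)
qed

text \<open>A letter \<open>b\<close> between \<open>s\<close> and \<open>x\<close> is met twice, as
  the last letter of the left part and as the first letter of the right part. Moving the cut across
  \<open>b\<close> changes the sign, so the outer terms of the differential cancel in pairs around
  the wheel.\<close>

lemma wheel_ends_cancel:
  fixes M :: "'h \<Rightarrow> 'h list \<Rightarrow> 'h list \<Rightarrow> 'k"
  assumes M: "\<And>a s x. int (length s) + int (length x) \<noteq> p + q - 2 \<Longrightarrow> M a s x = 0"
    and M0: "\<And>s x. M 0 s x = 0"
  shows "splitsum (\<lambda>u x. sg ((int (length u) + q) * int (length x)) (splitsum (\<lambda>s b. M (idc b) s x) u)) w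
    + sg (p + 1) (splitsum (\<lambda>u x. sg ((int (length u) + q) * int (length x))
        (splitsum (\<lambda>b s. M (idc b) u s) x)) w) = (0::'k)"
proof -
  have "splitsum (\<lambda>u x. sg ((int (length u) + q) * int (length x)) (splitsum (\<lambda>s b. M (idc b) s x) u)) w
    = splitsum (\<lambda>u x. splitsum (\<lambda>s b. sg ((int (length s) + 1 + q) * int (length x)) (M (idc b) s x)) u) w"
    unfolding splitsum_sg [symmetric]
  proof (intro splitsum_cong)
    fix u x s b :: "'h list"
    assume "u = s @ b"
    then show "sg ((int (length u) + q) * int (length x)) (M (idc b) s x) =
      sg ((int (length s) + 1 + q) * int (length x)) (M (idc b) s x)"
      by (cases "length b = 1") (auto simp: idc_def M0 add_ac)
  qed
  also have "\<dots> = splitsum (\<lambda>s r. splitsum (\<lambda>b x. sg ((int (length s) + 1 + q) * int (length x)) (M (idc b) s x)) r) w"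
    by (rule splitsum_assoc)
  also have "\<dots> = - sg (p + 1) (splitsum (\<lambda>s r. sg ((int (length s) + q) * int (length r))
        (splitsum (\<lambda>b x. M (idc b) s x) r)) w)"
    unfolding splitsum_sg [symmetric] splitsum_minus [symmetric] sg_sg
  proof (intro splitsum_cong)
    fix s r b x :: "'h list"
    assume r: "r = b @ x"
    show "sg ((int (length s) + 1 + q) * int (length x)) (M (idc b) s x) =
      - sg (p + 1 + (int (length s) + q) * int (length r)) (M (idc b) s x)"
    proof (cases "length b = 1 \<and> int (length s) + int (length x) = p + q - 2")
      case True
      then have "length b = 1" "even (p + q) = even (int (length s) + int (length x))"
        by presburger+
      then show ?thesis
        unfolding r by (intro sg_cong_uminus) (auto simp: algebra_simps)
    qed (auto simp: idc_def M0 M)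
  qed
  finally show ?thesis
    by simp
qed

end

lemma ins_map:
  assumes "\<And>v. g (map h v) = h (g v)"
  shows "ins q g F (map h w) = ins q g (\<lambda>t. F (map h t)) w"
  by (simp add: ins_def splitsum_map assms)

section \<open>Rotated cochains and the dual of Connes' operator\<close>

context frobenius_form
begin

text \<open>Since \<open>\<phi> (f w) = \<phi> (1 * f w)\<close>, this is a rotation of
  \<open>f\<close> with 1 in the distinguished place, as in Connes' operator on the normalized
  complex. Letters carried around past the form acquire \<open>\<nu>\<close>.\<close>

definition rot :: "('h list \<Rightarrow> 'h) \<Rightarrow> 'h \<Rightarrow> 'h list \<Rightarrow> 'h list \<Rightarrow> 'k" where
  "rot f a u x = \<phi> (f (x @ \<nu> a # map \<nu> u))"

definition rot_ins :: "int \<Rightarrow> ('h list \<Rightarrow> 'h) \<Rightarrow> ('h list \<Rightarrow> 'h) \<Rightarrow> 'h \<Rightarrow> 'h list \<Rightarrow> 'h list \<Rightarrow> 'k" where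
  "rot_ins q g f a u x = ins q g (\<lambda>t. rot f a t x) u"

text \<open>
  The adjoint of Connes' operator twisted by \<open>\<nu>\<close>: the arguments preceding the dual variable
  \<open>a\<close> are moved behind it.
\<close>

definition bvd :: "('h list \<Rightarrow> 'h) \<Rightarrow> 'h list \<Rightarrow> 'h" where
  "bvd f = wheel_cochain 1 (rot f)"

text \<open>The homotopy behind the BV identity: \<open>g\<close> is inserted among the letters that
  were moved behind \<open>a\<close>.\<close>

definition insd :: "int \<Rightarrow> ('h list \<Rightarrow> 'h) \<Rightarrow> ('h list \<Rightarrow> 'h) \<Rightarrow> 'h list \<Rightarrow> 'h" where
  "insd q g f = wheel_cochain q (rot_ins q g f)"

definition twist :: "('h list \<Rightarrow> 'h) \<Rightarrow> 'h list \<Rightarrow> 'h" where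
  "twist f w = \<mu> (f (map \<nu> w))"

lemma kform_comp:
  assumes "f \<in> cochains scale p"
  shows "kform (\<lambda>w. \<phi> (f w))"
proof -
  have "f (u @ scale 1 1 # x) = 0" for u x
    using assms unfolding cochains_iff normalized_def by blast
  with assms show ?thesis
    by (auto simp: cochains_iff kform_def slot_additive_def homogeneous_def form_add form_scale)
qed

lemma kform_prefix: "kform F \<Longrightarrow> kform (\<lambda>x. F (x @ e # y))"
  unfolding kform_def slot_additive_def by simp

lemma kform_suffix:
  assumes "kform F"
  shows "kform (\<lambda>u. F (x @ e # map \<nu> u))"
proof -
  have f: "F (y @ (a + b) # t) = F (y @ a # t) + F (y @ b # t)" "F (y @ scale c a # t) = c * F (y @ a # t)"
    "F (y @ 1 # t) = 0" for y a b c t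
    using assms unfolding kform_def slot_additive_def by blast+
  show ?thesis
    unfolding kform_def slot_additive_def
    using f [of "x @ e # map \<nu> u" for u] by (simp add: nu_add nu_scale nu_one)
qed

lemma kform_ins:
  assumes F: "kform F" and g: "slot_additive g" "homogeneous g" "normalized g"
  shows "kform (ins q g F)"
proof -
  have s: "slot_additive F" and h: "F (u @ scale c a # x) = c * F (u @ a # x)" and n: "F (u @ 1 # x) = 0" for u c a x
    using F unfolding kform_def by blast+
  have g1: "g (u @ scale c a # x) = scale c (g (u @ a # x))" for u c a x
    using g unfolding homogeneous_def by blast
  have "g (u @ scale 1 1 # x) = 0" for u x
    using g unfolding normalized_def by blast
  then have g2: "g (u @ 1 # x) = 0" for u x
    by simp
  have h': "F (u @ a # x @ scale c b # y) = c * F (u @ a # x @ b # y)"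
    and n': "F (u @ a # x @ 1 # y) = 0" for u a x b c y
    using h [of "u @ a # x" c b y] n [of "u @ a # x" y] by simp_all
  have "ins q g F (u @ scale c a # x) = c * ins q g F (u @ a # x)" for u c a x
    by (simp add: ins_append h h' g1 ins_mult_right sg_mult_right splitsum_mult_right distrib_left mult_sg)
  moreover have "ins q g F (u @ 1 # x) = 0" for u x
    unfolding ins_append by (simp add: n n' g2 slot_zero [OF s])
  ultimately show ?thesis
    unfolding kform_def using slot_additive_ins [OF s g(1)] by blast
qed

lemma kbilinear_rot:
  assumes "f \<in> cochains scale p"
  shows "kbilinear (rot f)"
proof -
  have k: "kform (\<lambda>w. \<phi> (f w))"
    by (rule kform_comp [OF assms])
  then have "rot f (a + b) u x = rot f a u x + rot f b u x" "rot f (scale c a) u x = c * rot f a u x" for a b c u x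
    by (auto simp: rot_def kform_def slot_additive_def nu_add nu_scale)
  moreover have "kform (\<lambda>u. rot f a u x)" "kform (\<lambda>x. rot f a u x)" for a u x
    unfolding rot_def by (rule kform_suffix [OF k], rule kform_prefix [OF k])
  ultimately show ?thesis
    by (simp add: kbilinear_def)
qed

lemma kbilinear_rot_ins:
  assumes f: "f \<in> cochains scale p" and g: "g \<in> cochains scale q"
  shows "kbilinear (rot_ins q g f)"
proof -
  note k = kbilinear_rot [OF f, unfolded kbilinear_def]
  have "rot_ins q g f (a + b) u x = rot_ins q g f a u x + rot_ins q g f b u x"
    "rot_ins q g f (scale c a) u x = c * rot_ins q g f a u x" for a b c u x
    using k by (auto simp: rot_ins_def ins_add ins_mult_right)
  moreover have "kform (rot_ins q g f a u)" for a u
  proof -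
    have x: "kform (rot f a u)" for u
      using k by blast
    then show ?thesis
      unfolding kform_def slot_additive_def rot_ins_def by (auto simp: ins_add ins_mult_right)
  qed
  moreover have "kform (\<lambda>u. rot_ins q g f a u x)" for a x
    unfolding rot_ins_def using k g
    by (intro kform_ins) (auto simp: cochains_iff)
  ultimately show ?thesis
    by (simp add: kbilinear_def)
qed

lemma rot_degree:
  assumes "f \<in> cochains scale p" "int (length u) + int (length x) \<noteq> p - 1"
  shows "rot f a u x = 0"
proof -
  have "f (x @ \<nu> a # map \<nu> u) = 0"
    using assms by (intro in_degreeD [of p]) (auto simp: cochains_iff)
  then show ?thesis
    by (simp add: rot_def)
qed

lemma rot_ins_degree:
  assumes f: "f \<in> cochains scale p" and g: "g \<in> cochains scale q"
    and "int (length u) + int (length x) \<noteq> p + q - 2"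
  shows "rot_ins q g f a u x = 0"
proof -
  have "in_degree (p - 1 - int (length x)) (\<lambda>t. rot f a t x)"
    using rot_degree [OF f] by (auto simp: in_degree_def)
  moreover have "slot_additive (\<lambda>t. rot f a t x)"
    using kbilinear_rot [OF f] by (simp add: kbilinear_def kform_def)
  ultimately have "in_degree (p - 1 - int (length x) + q - 1) (ins q g (\<lambda>t. rot f a t x))"
    using g by (intro in_degree_ins) (auto simp: cochains_iff)
  then show ?thesis
    unfolding rot_ins_def using assms(3) by (intro in_degreeD) auto
qed

lemma cochains_bvd: "f \<in> cochains scale p \<Longrightarrow> bvd f \<in> cochains scale (p - 1)"
  unfolding bvd_def by (rule cochains_wheel [OF kbilinear_rot]) (auto simp: rot_degree)

lemma cochains_insd:
  "f \<in> cochains scale p \<Longrightarrow> g \<in> cochains scale q \<Longrightarrow> insd q g f \<in> cochains scale (p + q - 2)"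
  unfolding insd_def by (rule cochains_wheel [OF kbilinear_rot_ins]) (auto simp: rot_ins_degree)

lemma form_bvd: "f \<in> cochains scale p \<Longrightarrow> \<phi> (a * bvd f w) = wheel 1 (rot f) a w"
  unfolding bvd_def by (rule form_wheel [OF kbilinear_rot])

text \<open>The part of \<open>dif p f\<close> on a rotated word that multiplies two inner arguments.\<close>

definition rot_mul :: "('h list \<Rightarrow> 'h) \<Rightarrow> 'h \<Rightarrow> 'h list \<Rightarrow> 'h list \<Rightarrow> 'k" where
  "rot_mul f a u x = ins 2 mul2 (rot f a u) x + sg (int (length x) + 1) (ins 2 mul2 (\<lambda>u. rot f a u x) u)
    + splitsum (\<lambda>s b. sg (int (length s)) (rot f (\<mu> (idc b) * a) u s)) x
    + sg (int (length x)) (splitsum (\<lambda>s t. rot f (a * idc s) t x) u)"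

lemma nu_mul2: "mul2 (map \<nu> v) = \<nu> (mul2 v)"
proof -
  have "idc (map \<nu> v) = \<nu> (idc v)" for v
    by (cases v) (auto simp: idc_def)
  then show ?thesis
    by (simp add: dot_def splitsum_map splitsum_hom [of \<nu>] nu_add nu_mult)
qed

lemma nu_idc: "idc (map \<nu> v) = \<nu> (idc v)"
  by (cases v) (auto simp: idc_def)

lemma rot_mul_eq:
  assumes "f \<in> cochains scale p"
  shows "\<phi> (ins 2 mul2 f (x @ \<nu> a # map \<nu> u)) = rot_mul f a u x"
proof -
  have s: "slot_additive (\<lambda>w. \<phi> (f w))"
    using kform_comp [OF assms] by (simp add: kform_def)
  show ?thesis
    unfolding form_ins ins_mul2_append [OF s] rot_mul_def rot_def
    by (simp add: ins_map [where h = \<nu> and g = mul2, OF nu_mul2] splitsum_map nu_idc nu_mult splitsum_sg algebra_simps)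
qed

text \<open>The outer terms of the differential are separated according to their outer letter. The
  summands with \<open>u = []\<close> or \<open>x = []\<close> are those in which \<open>a\<close>
  itself is the outer letter; they escape the pairwise cancellation of
  \<open>wheel_ends_cancel\<close>.\<close>

lemma rot_dif:
  assumes f: "f \<in> cochains scale p"
  shows "rot (dif p f) a u x =
    splitsum (\<lambda>s b. \<phi> (idc b * f (x @ \<nu> a # map \<nu> s))) u + (if u = [] then \<phi> (a * f x) else 0)
    + sg (p + 1) (splitsum (\<lambda>b s. \<phi> (idc b * f (s @ \<nu> a # map \<nu> u))) x + (if x = [] then \<phi> (\<nu> a * f (map \<nu> u)) else 0))
    + sg p (rot_mul f a u x)"
proof -
  have n: "\<phi> (f y * \<nu> b) = \<phi> (b * f y)" for y b
    by (rule nakayama [symmetric])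
  have A: "\<phi> (dot f idc (x @ \<nu> a # map \<nu> u)) =
    splitsum (\<lambda>s b. \<phi> (idc b * f (x @ \<nu> a # map \<nu> s))) u + (if u = [] then \<phi> (a * f x) else 0)"
    unfolding dot_idc_append form_add form_splitsum splitsum_map nu_idc n by (simp add: n)
  have B: "\<phi> (dot idc f (x @ \<nu> a # map \<nu> u)) =
    splitsum (\<lambda>b s. \<phi> (idc b * f (s @ \<nu> a # map \<nu> u))) x + (if x = [] then \<phi> (\<nu> a * f (map \<nu> u)) else 0)"
    unfolding idc_dot_append form_add form_splitsum by simp
  show ?thesis
    unfolding rot_def dif_def plus_fun_apply sg_fun form_add form_sg rot_mul_eq [OF f] A B ..
qed

lemma form_twist: "\<phi> (a * twist f w) = \<phi> (\<nu> a * f (map \<nu> w))"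
  by (simp add: twist_def form_mu)

text \<open>Around the wheel all outer terms cancel except those with outer letter \<open>a\<close>:
  the cut \<open>u = []\<close> leaves \<open>f\<close>, and the cut \<open>x = []\<close> leaves
  \<open>twist f\<close>. So \<open>bvd\<close> is a homotopy between the identity and the action of
  \<open>\<nu>\<close>, and on invariant cochains it commutes with the differentials.\<close>

lemma bvd_dif:
  assumes f: "f \<in> cochains scale p"
  shows "bvd (dif p f) = sg p (f - twist f) + dif (p - 1) (bvd f)"
proof (rule form_cancel_fun)
  fix a w
  have deg: "f w = 0 \<or> p = int (length w)" for w
    using f by (auto simp: cochains_iff in_degree_def)
  let ?s = "\<lambda>(u :: 'h list) (x :: 'h list). (int (length u) + 1) * int (length x)"
  have "\<phi> (a * bvd (dif p f) w) = splitsum (\<lambda>u x. sg (?s u x) (rot (dif p f) a u x)) w"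
    unfolding form_bvd [OF cochains_dif [OF f]] wheel_def ..
  also have "\<dots> = (splitsum (\<lambda>u x. sg (?s u x) (splitsum (\<lambda>s b. \<phi> (idc b * f (x @ \<nu> a # map \<nu> s))) u)) w
      + sg (p + 1) (splitsum (\<lambda>u x. sg (?s u x) (splitsum (\<lambda>b s. \<phi> (idc b * f (s @ \<nu> a # map \<nu> u))) x)) w))
    + splitsum (\<lambda>u x. if u = [] then sg (int (length x)) (\<phi> (a * f x)) else 0) w
    + sg (p + 1) (splitsum (\<lambda>u x. if x = [] then \<phi> (\<nu> a * f (map \<nu> u)) else 0) w)
    + sg p (splitsum (\<lambda>u x. sg (?s u x) (rot_mul f a u x)) w)"
    unfolding rot_dif [OF f] sg_add splitsum_add splitsum_sg [symmetric] sg_sg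
    by (simp add: add_ac if_distrib if_distribR cong: if_cong)
  also have "splitsum (\<lambda>u x. sg (?s u x) (splitsum (\<lambda>s b. \<phi> (idc b * f (x @ \<nu> a # map \<nu> s))) u)) w
      + sg (p + 1) (splitsum (\<lambda>u x. sg (?s u x) (splitsum (\<lambda>b s. \<phi> (idc b * f (s @ \<nu> a # map \<nu> u))) x)) w) = 0"
  proof (rule wheel_ends_cancel [where M = "\<lambda>e s x. \<phi> (e * f (x @ \<nu> a # map \<nu> s))"])
    fix e and s x :: "'h list"
    assume "int (length s) + int (length x) \<noteq> p + 1 - 2"
    then have "f (x @ \<nu> a # map \<nu> s) = 0"
      using deg [of "x @ \<nu> a # map \<nu> s"] by auto
    then show "\<phi> (e * f (x @ \<nu> a # map \<nu> s)) = 0"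
      by simp
  qed simp
  also have "splitsum (\<lambda>u x. if u = [] then sg (int (length x)) (\<phi> (a * f x)) else 0) w = sg p (\<phi> (a * f w))"
    using deg [of w] by (auto simp: splitsum_Nil_left)
  also have "splitsum (\<lambda>u x. if x = [] then \<phi> (\<nu> a * f (map \<nu> u)) else 0) w = \<phi> (a * twist f w)"
    by (simp only: splitsum_Nil_right form_twist)
  also have "sg p (splitsum (\<lambda>u x. sg (?s u x) (rot_mul f a u x)) w) = \<phi> (a * dif (p - 1) (bvd f) w)"
    unfolding bvd_def
    using form_dif_wheel [OF kbilinear_rot [OF f], of "p - 1" a 1 w] rot_degree [OF f]
    by (simp add: rot_mul_def sg_def)
  finally show "\<phi> (a * bvd (dif p f) w) = \<phi> (a * (sg p (f - twist f) + dif (p - 1) (bvd f)) w)"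
    by (simp add: distrib_left form_add sg_fun sg_mult_right form_sg right_diff_distrib form_diff sg_diff)
      (simp add: sg_def)
qed

text \<open>The second application evaluates the first at dual variable 1, and thereby feeds
  \<open>\<nu> 1 = 1\<close> into a slot of the normalized cochain \<open>f\<close>. This is the
  classical reason why Connes' operator squares to zero.\<close>

lemma bvd_bvd:
  assumes f: "f \<in> cochains scale p"
  shows "bvd (bvd f) = 0"
proof (rule form_cancel_fun)
  fix a w
  have "rot (bvd f) a u x = 0" for u x
  proof -
    have "f (y @ scale 1 1 # y') = 0" for y y'
      using f unfolding cochains_iff normalized_def by blast
    then have n: "f (y @ 1 # y') = 0" for y y'
      by simp
    have "rot (bvd f) a u x = wheel 1 (rot f) 1 (x @ \<nu> a # map \<nu> u)"
      using form_bvd [OF f, of 1] by (simp add: rot_def)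
    also have "\<dots> = 0"
      by (simp add: wheel_def rot_def nu_one n)
    finally show ?thesis .
  qed
  then show "\<phi> (a * bvd (bvd f) w) = \<phi> (a * 0 w)"
    by (simp add: form_bvd [OF cochains_bvd [OF f]] wheel_def)
qed

section \<open>The BV identity on invariant cocycles\<close>

definition inv_cochain :: "('h list \<Rightarrow> 'h) \<Rightarrow> bool" where
  "inv_cochain f \<longleftrightarrow> (\<forall>w. f (map \<nu> w) = \<nu> (f w))"

lemma inv_cochainD: "inv_cochain f \<Longrightarrow> f (map \<nu> w) = \<nu> (f w)"
  by (simp add: inv_cochain_def)

text \<open>The terms of \<open>bvd (dot f g)\<close> in which the marked letter \<open>a\<close> is
  an argument of \<open>f\<close>, before adjusting the sign; the other terms have the roles of
  \<open>f\<close> and \<open>g\<close> exchanged.\<close>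

definition rot_prod :: "int \<Rightarrow> ('h list \<Rightarrow> 'h) \<Rightarrow> ('h list \<Rightarrow> 'h) \<Rightarrow> 'h \<Rightarrow> 'h list \<Rightarrow> 'k" where
  "rot_prod q f g a w = splitsum (\<lambda>u r. splitsum (\<lambda>v x.
     sg (int (length u) * int (length x) + (q + 1) * int (length u)) (\<phi> (g v * f (x @ \<nu> a # map \<nu> u)))) r) w"

text \<open>The equation \<open>dif p f = 0\<close> is evaluated on rotated words with
  \<open>g\<close> inserted behind \<open>a\<close>. The cancellation around the wheel now leaves
  three kinds of terms besides the boundary of \<open>insd\<close>: the value of \<open>g\<close> as
  outer letter gives \<open>rot_prod\<close>, the letter \<open>a\<close> as outer letter gives
  \<open>ins q g f\<close>, and the value of \<open>g\<close> next to \<open>a\<close> gives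
  \<open>dot g (bvd f)\<close>.\<close>

lemma form_insd_dif:
  assumes f: "f \<in> cocycles scale p" and g: "g \<in> cocycles scale q" and fi: "inv_cochain f"
  shows "rot_prod q f g a w + sg (p + 1) (\<phi> (a * ins q g f w))
    + (\<phi> (a * dif (p + q - 2) (insd q g f) w) + sg p (\<phi> (a * dot g (bvd f) w))) = 0"
proof -
  have fc: "f \<in> cochains scale p" "dif p f = 0" and gc: "g \<in> cochains scale q" "dif q g = 0"
    using f g by (auto simp: cocycles_iff)
  have fs: "slot_additive f" "in_degree p f" and gs: "slot_additive g" "in_degree q g"
    using fc gc by (auto simp: cochains_iff)
  have slot_rot: "slot_additive (\<lambda>t. rot f a t x)" for a x
    using kbilinear_rot [OF fc(1)] by (simp add: kbilinear_def kform_def)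
  let ?s = "\<lambda>(u :: 'h list) (x :: 'h list). (int (length u) + q) * int (length x)"
  define M where "M e s x = ins q g (\<lambda>t. \<phi> (e * f (x @ \<nu> a # map \<nu> t))) s" for e s x
  have 1: "ins q g (\<lambda>u. splitsum (\<lambda>s b. \<phi> (idc b * f (x @ \<nu> a # map \<nu> s))) u) u =
      splitsum (\<lambda>s b. M (idc b) s x) u
      + splitsum (\<lambda>s b. sg ((q + 1) * int (length s)) (\<phi> (g b * f (x @ \<nu> a # map \<nu> s)))) u" for u x
    unfolding ins_splitsum splitsum_add M_def
    by (subst ins_idc_apply [where G = "\<lambda>e. \<phi> (e * c)" for c]) auto
  \<comment> \<open>A word that contains an inserted letter is not empty, so the term with
    \<open>u = []\<close> disappears.\<close>
  have 2: "ins q g (\<lambda>u. if u = [] then c else 0) u = (0::'k)" for c u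
    by (simp add: ins_def)
  have 3: "ins q g (\<lambda>u. splitsum (\<lambda>b s. \<phi> (idc b * f (s @ \<nu> a # map \<nu> u))) x) u =
      splitsum (\<lambda>b s. M (idc b) u s) x" for u x
    unfolding ins_splitsum_param M_def ..
  \<comment> \<open>Invariance of \<open>f\<close> removes \<open>\<nu>\<close> from all letters at
    once.\<close>
  have 4: "ins q g (\<lambda>u. if x = [] then \<phi> (\<nu> a * f (map \<nu> u)) else 0) u =
      (if x = [] then \<phi> (a * ins q g f u) else 0)" for u x
  proof -
    have "ins q g (\<lambda>u. \<phi> (\<nu> a * f (map \<nu> u))) u = ins q g (\<lambda>u. \<phi> (a * f u)) u"
      by (simp add: inv_cochainD [OF fi] nu_mult [symmetric] form_nu)
    then show ?thesis
      by (simp add: hom_ins [where h = "\<lambda>t. \<phi> (a * t)"] distrib_left form_add)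
  qed
  \<comment> \<open>The last summand is the exceptional one: \<open>a\<close> multiplied with the
    value of \<open>g\<close> standing directly behind it.\<close>
  have 5: "ins q g (\<lambda>u. rot_mul f a u x) u =
     (ins 2 mul2 (rot_ins q g f a u) x + sg (int (length x) + q) (ins 2 mul2 (\<lambda>u. rot_ins q g f a u x) u)
    + splitsum (\<lambda>s b. sg (int (length s)) (rot_ins q g f (\<mu> (idc b) * a) u s)) x
    + sg (int (length x) + q + 1) (splitsum (\<lambda>s t. rot_ins q g f (a * idc s) t x) u))
    + sg (int (length x)) (splitsum (\<lambda>s t. rot f (a * g s) t x) u)" for u x
  proof -
    have A: "ins q g (\<lambda>u. ins 2 mul2 (rot f a u) x) u = ins 2 mul2 (rot_ins q g f a u) x"
      unfolding rot_ins_def by (rule ins_swap)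
    have B: "ins q g (\<lambda>u. sg (int (length x) + 1) (ins 2 mul2 (\<lambda>u. rot f a u x) u)) u =
      sg (int (length x) + q) (ins 2 mul2 (\<lambda>u. rot_ins q g f a u x) u)"
    proof -
      have "ins q g (\<lambda>u. sg (int (length x) + 1) (ins 2 mul2 (\<lambda>u. rot f a u x) u)) u =
        sg (int (length x) + 1) (ins q g (ins 2 mul2 (\<lambda>u. rot f a u x)) u)"
        by (rule ins_sg)
      also have "ins q g (ins 2 mul2 (\<lambda>u. rot f a u x)) = sg (q - 1) (ins 2 mul2 (ins q g (\<lambda>u. rot f a u x)))"
        by (rule ins_ins_mul2 [OF slot_rot gs(2) gc(2)])
      also have "ins q g (\<lambda>u. rot f a u x) = (\<lambda>u. rot_ins q g f a u x)"
        by (rule ext) (simp only: rot_ins_def)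
      finally have "ins q g (\<lambda>u. sg (int (length x) + 1) (ins 2 mul2 (\<lambda>u. rot f a u x) u)) u =
        sg (int (length x) + 1 + (q - 1)) (ins 2 mul2 (\<lambda>u. rot_ins q g f a u x) u)"
        unfolding sg_fun sg_sg .
      also have "int (length x) + 1 + (q - 1) = int (length x) + q"
        by simp
      finally show ?thesis .
    qed
    have C: "ins q g (\<lambda>u. splitsum (\<lambda>s b. sg (int (length s)) (rot f (\<mu> (idc b) * a) u s)) x) u =
      splitsum (\<lambda>s b. sg (int (length s)) (rot_ins q g f (\<mu> (idc b) * a) u s)) x"
      by (simp add: ins_splitsum_param ins_sg rot_ins_def)
    have D: "ins q g (\<lambda>u. splitsum (\<lambda>s t. rot f (a * idc s) t x) u) u =
      splitsum (\<lambda>s t. rot f (a * g s) t x) u + sg (q + 1) (splitsum (\<lambda>s t. rot_ins q g f (a * idc s) t x) u)"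
    proof -
      have z: "rot f 0 t x = 0" for t x
        using slot_zero [OF fs(1)] by (simp add: rot_def)
      have "ins q g (\<lambda>t'. rot f (a * idc t') t x) s = rot f (a * g s) t x" for s t
        by (rule ins_idc_apply [where G = "\<lambda>e. rot f (a * e) t x"]) (simp add: z)
      moreover have "splitsum (\<lambda>s t. sg ((q + 1) * int (length s)) (ins q g (\<lambda>t. rot f (a * idc s) t x) t)) u =
        sg (q + 1) (splitsum (\<lambda>s t. rot_ins q g f (a * idc s) t x) u)"
        unfolding rot_ins_def
        by (subst splitsum_left_degree [where p = 1]) (auto simp: idc_def z)
      ultimately show ?thesis
        by (simp add: ins_splitsum splitsum_add)
    qed
    show ?thesis
      unfolding rot_mul_def ins_add A B C unfolding ins_sg D by (simp add: sg_add add_ac)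
  qed
  have "0 = splitsum (\<lambda>u x. sg (?s u x) (ins q g (\<lambda>u. rot (dif p f) a u x) u)) w"
    by (simp add: fc(2) rot_def)
  also have "\<dots> = (splitsum (\<lambda>u x. sg (?s u x) (splitsum (\<lambda>s b. M (idc b) s x) u)) w
      + sg (p + 1) (splitsum (\<lambda>u x. sg (?s u x) (splitsum (\<lambda>b s. M (idc b) u s) x)) w))
    + splitsum (\<lambda>u x. splitsum (\<lambda>s b. sg (?s u x + (q + 1) * int (length s)) (\<phi> (g b * f (x @ \<nu> a # map \<nu> s)))) u) w
    + sg (p + 1) (splitsum (\<lambda>u x. if x = [] then \<phi> (a * ins q g f u) else 0) w)
    + (sg p (splitsum (\<lambda>u x. sg (?s u x) (ins 2 mul2 (rot_ins q g f a u) x + sg (int (length x) + q) (ins 2 mul2 (\<lambda>u. rot_ins q g f a u x) u)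
        + splitsum (\<lambda>s b. sg (int (length s)) (rot_ins q g f (\<mu> (idc b) * a) u s)) x
        + sg (int (length x) + q + 1) (splitsum (\<lambda>s t. rot_ins q g f (a * idc s) t x) u))) w)
      + sg p (splitsum (\<lambda>u x. splitsum (\<lambda>s t. sg (?s u x + int (length x)) (rot f (a * g s) t x)) u) w))"
  proof -
    have i: "(if x = [] then c else 0) = (if x = [] then sg (?s u x) c else 0)" for u x :: "'h list" and c :: 'k
      by simp
    have "splitsum (\<lambda>u x. if x = [] then \<phi> (a * ins q g f u) else 0) w =
      splitsum (\<lambda>u x. sg (?s u x) (if x = [] then \<phi> (a * ins q g f u) else 0)) w"
      by (intro splitsum_cong) auto
    then show ?thesis
      unfolding rot_dif [OF fc(1)] ins_add ins_sg 1 2 3 4 5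
      by (simp add: sg_add splitsum_add splitsum_sg [symmetric] add_ac)
  qed
  also have "splitsum (\<lambda>u x. sg (?s u x) (splitsum (\<lambda>s b. M (idc b) s x) u)) w
      + sg (p + 1) (splitsum (\<lambda>u x. sg (?s u x) (splitsum (\<lambda>b s. M (idc b) u s) x)) w) = 0"
  proof (rule wheel_ends_cancel)
    fix e and s x :: "'h list"
    show "M 0 s x = 0"
      by (simp add: M_def)
    assume "int (length s) + int (length x) \<noteq> p + q - 2"
    moreover have "in_degree (p - 1 - int (length x)) (\<lambda>t. \<phi> (e * f (x @ \<nu> a # map \<nu> t)))"
      using fs(2) by (auto simp: in_degree_def)
    moreover have "slot_additive (\<lambda>t. \<phi> (e * f (x @ \<nu> a # map \<nu> t)))"
    proof -
      have "f (x @ \<nu> a # map \<nu> s @ (b + c) # t) = f (x @ \<nu> a # map \<nu> s @ b # t) + f (x @ \<nu> a # map \<nu> s @ c # t)" for s b c t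
        using slot_additiveD [OF fs(1), of "x @ \<nu> a # map \<nu> s" b c t] by simp
      then show ?thesis
        by (simp add: slot_additive_def nu_add distrib_left form_add)
    qed
    ultimately show "M e s x = 0"
      unfolding M_def using in_degree_ins [OF _ _ gs(2), of _ "p - 1 - int (length x)"]
      by (intro in_degreeD) auto
  qed
  also have "splitsum (\<lambda>u x. splitsum (\<lambda>s b. sg (?s u x + (q + 1) * int (length s)) (\<phi> (g b * f (x @ \<nu> a # map \<nu> s)))) u) w
    = rot_prod q f g a w"
  proof -
    have "splitsum (\<lambda>u x. splitsum (\<lambda>s b. sg (?s u x + (q + 1) * int (length s)) (\<phi> (g b * f (x @ \<nu> a # map \<nu> s)))) u) w
      = splitsum (\<lambda>u x. splitsum (\<lambda>s b. sg (int (length s) * int (length x) + (q + 1) * int (length s)) (\<phi> (g b * f (x @ \<nu> a # map \<nu> s)))) u) w"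
    proof (intro splitsum_cong)
      fix u x s b :: "'h list" assume u: "u = s @ b"
      show "sg (?s u x + (q + 1) * int (length s)) (\<phi> (g b * f (x @ \<nu> a # map \<nu> s))) =
        sg (int (length s) * int (length x) + (q + 1) * int (length s)) (\<phi> (g b * f (x @ \<nu> a # map \<nu> s)))"
      proof (cases "int (length b) = q")
        case True
        then show ?thesis
          unfolding u by (intro sg_cong) (auto simp: algebra_simps)
      qed (simp add: in_degreeD [OF gs(2)])
    qed
    then show ?thesis
      unfolding splitsum_assoc rot_prod_def .
  qed
  also have "splitsum (\<lambda>u x. if x = [] then \<phi> (a * ins q g f u) else 0) w = \<phi> (a * ins q g f w)"
    by (rule splitsum_Nil_right)
  also have "sg p (splitsum (\<lambda>u x. sg (?s u x) (ins 2 mul2 (rot_ins q g f a u) x + sg (int (length x) + q) (ins 2 mul2 (\<lambda>u. rot_ins q g f a u x) u)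
        + splitsum (\<lambda>s b. sg (int (length s)) (rot_ins q g f (\<mu> (idc b) * a) u s)) x
        + sg (int (length x) + q + 1) (splitsum (\<lambda>s t. rot_ins q g f (a * idc s) t x) u))) w)
    = \<phi> (a * dif (p + q - 2) (insd q g f) w)"
  proof -
    have s: "sg (p + q - 2 + q) c = sg p c" for c :: 'k
      by (intro sg_cong) auto
    show ?thesis
      unfolding insd_def
      by (subst form_dif_wheel [OF kbilinear_rot_ins [OF fc(1) gc(1)], of "p + q - 2" a q w])
        (erule rot_ins_degree [OF fc(1) gc(1)], simp only: s)
  qed
  also have "splitsum (\<lambda>u x. splitsum (\<lambda>s t. sg (?s u x + int (length x)) (rot f (a * g s) t x)) u) w =
    \<phi> (a * dot g (bvd f) w)"
  proof -
    have "splitsum (\<lambda>u x. splitsum (\<lambda>s t. sg (?s u x + int (length x)) (rot f (a * g s) t x)) u) w =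
      splitsum (\<lambda>u x. splitsum (\<lambda>s t. sg ((int (length t) + 1) * int (length x)) (rot f (a * g s) t x)) u) w"
    proof (intro splitsum_cong)
      fix u x s t :: "'h list" assume u: "u = s @ t"
      show "sg (?s u x + int (length x)) (rot f (a * g s) t x) = sg ((int (length t) + 1) * int (length x)) (rot f (a * g s) t x)"
      proof (cases "int (length s) = q")
        case True
        then show ?thesis
          unfolding u by (intro sg_cong) (auto simp: algebra_simps)
      qed (simp add: in_degreeD [OF gs(2)] rot_def slot_zero [OF fs(1)])
    qed
    also have "\<dots> = splitsum (\<lambda>s r. wheel 1 (rot f) (a * g s) r) w"
      unfolding splitsum_assoc wheel_def ..
    finally show ?thesis
      by (simp add: form_bvd [OF fc(1), symmetric] dot_def splitsum_mult_right form_splitsum mult.assoc)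
  qed
  finally show ?thesis
    by (simp add: add_ac)
qed

text \<open>The marked letter is an argument of \<open>g\<close> or of \<open>f\<close>. In the
  second case \<open>g\<close> receives letters that were carried around; invariance of
  \<open>g\<close> pulls \<open>\<nu>\<close> out of it, and the Nakayama property then moves its
  value to the front.\<close>

lemma form_bvd_dot:
  assumes f: "f \<in> cochains scale p" and g: "g \<in> cochains scale q" and gi: "inv_cochain g"
  shows "\<phi> (a * bvd (dot f g) w) = sg (p + q + 1) (rot_prod p g f a w) + sg ((q + 1) * (p + 1)) (rot_prod q f g a w)"
proof -
  have fs: "in_degree p f" and gs: "in_degree q g"
    using f g by (auto simp: cochains_iff)
  have split: "rot (dot f g) a u x = splitsum (\<lambda>s t. \<phi> (f s * g (t @ \<nu> a # map \<nu> u))) x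
    + splitsum (\<lambda>s t. \<phi> (g t * f (x @ \<nu> a # map \<nu> s))) u" for u x
  proof -
    have "\<phi> (y * g (map \<nu> t)) = \<phi> (g t * y)" for y t
      by (simp add: inv_cochainD [OF gi] nakayama [of "g t"])
    then show ?thesis
      by (simp add: rot_def dot_def splitsum_append form_add form_splitsum splitsum_map)
  qed
  have 1: "splitsum (\<lambda>u x. splitsum (\<lambda>s t. sg ((int (length u) + 1) * int (length x)) (\<phi> (f s * g (t @ \<nu> a # map \<nu> u)))) x) w =
    sg (p + q + 1) (rot_prod p g f a w)"
    unfolding rot_prod_def splitsum_sg [symmetric] sg_sg
  proof (intro splitsum_cong)
    fix u x s t :: "'h list" assume x: "x = s @ t"
    show "sg ((int (length u) + 1) * int (length x)) (\<phi> (f s * g (t @ \<nu> a # map \<nu> u))) =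
      sg (p + q + 1 + (int (length u) * int (length t) + (p + 1) * int (length u))) (\<phi> (f s * g (t @ \<nu> a # map \<nu> u)))"
    proof (cases "int (length s) = p \<and> int (length (t @ \<nu> a # map \<nu> u)) = q")
      case True
      then have "p = int (length s)" "q = int (length t) + 1 + int (length u)"
        by auto
      then show ?thesis
        unfolding x by (intro sg_cong) (auto simp: algebra_simps)
    next
      case False
      then have "f s * g (t @ \<nu> a # map \<nu> u) = 0"
        using in_degreeD [OF fs] in_degreeD [OF gs] by fastforce
      then show ?thesis
        by simp
    qed
  qed
  have 2: "splitsum (\<lambda>u x. splitsum (\<lambda>s t. sg ((int (length u) + 1) * int (length x)) (\<phi> (g t * f (x @ \<nu> a # map \<nu> s)))) u) w =
    sg ((q + 1) * (p + 1)) (rot_prod q f g a w)"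
  proof -
    have "splitsum (\<lambda>u x. splitsum (\<lambda>s t. sg ((int (length u) + 1) * int (length x)) (\<phi> (g t * f (x @ \<nu> a # map \<nu> s)))) u) w =
      splitsum (\<lambda>u x. splitsum (\<lambda>s t. sg ((q + 1) * (p + 1) + (int (length s) * int (length x) + (q + 1) * int (length s)))
        (\<phi> (g t * f (x @ \<nu> a # map \<nu> s)))) u) w"
    proof (intro splitsum_cong)
      fix u x s t :: "'h list" assume u: "u = s @ t"
      show "sg ((int (length u) + 1) * int (length x)) (\<phi> (g t * f (x @ \<nu> a # map \<nu> s))) =
        sg ((q + 1) * (p + 1) + (int (length s) * int (length x) + (q + 1) * int (length s))) (\<phi> (g t * f (x @ \<nu> a # map \<nu> s)))"
      proof (cases "int (length t) = q \<and> int (length (x @ \<nu> a # map \<nu> s)) = p")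
        case True
        then have "q = int (length t)" "p = int (length x) + 1 + int (length s)"
          by auto
        then show ?thesis
          unfolding u by (intro sg_cong) (auto simp: algebra_simps)
      next
        case False
        then have "g t * f (x @ \<nu> a # map \<nu> s) = 0"
          using in_degreeD [OF fs] in_degreeD [OF gs] by fastforce
        then show ?thesis
          by simp
      qed
    qed
    then show ?thesis
      unfolding splitsum_assoc rot_prod_def splitsum_sg [symmetric] sg_sg .
  qed
  show ?thesis
    unfolding form_bvd [OF cochains_dot [OF f g]] wheel_def split sg_add splitsum_add
    by (simp only: splitsum_sg [symmetric] 1 2)
qed

section \<open>Averaging over the powers of the Nakayama automorphism\<close>

lemma mu_sg: "\<mu> (sg n a) = sg n (\<mu> a)"
  by (rule hom_sg) (rule mu_add)

lemma mu_splitsum: "\<mu> (splitsum F w) = splitsum (\<lambda>u v. \<mu> (F u v)) w"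
  by (rule splitsum_hom) (auto simp: mu_add)

lemma twist_dot: "twist (dot f g) = dot (twist f) (twist g)"
  by (rule ext) (simp add: twist_def dot_def splitsum_map mu_splitsum mu_mult)

lemma twist_idc: "twist idc = idc"
  by (rule ext) (simp add: twist_def nu_idc)

lemma twist_ins: "twist (ins q g f) = ins q (twist g) (twist f)"
  by (rule ext) (simp add: twist_def ins_def splitsum_map mu_splitsum mu_sg)

lemma twist_add: "twist (f + g) = twist f + twist g"
  by (rule ext) (simp add: twist_def mu_add)

lemma twist_sg: "twist (sg n f) = sg n (twist f)"
  by (rule ext) (simp add: twist_def sg_fun mu_sg)

lemma twist_scale_fun: "twist (scale_fun c f) = scale_fun c (twist f)"
  by (rule ext) (simp add: twist_def scale_fun_def mu_scale)

lemma twist_dif: "twist (dif p f) = dif p (twist f)"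
  by (simp add: dif_def twist_add twist_sg twist_dot twist_idc twist_ins)

lemma cochains_twist:
  assumes "f \<in> cochains scale p"
  shows "twist f \<in> cochains scale p"
proof -
  have "f (u @ scale c 1 # x) = 0" for u c x
    using assms unfolding cochains_iff normalized_def by blast
  then have "normalized (twist f)"
    by (simp add: normalized_def twist_def nu_scale nu_one)
  then show ?thesis
    using assms
    by (auto simp: cochains_iff in_degree_def slot_additive_def homogeneous_def twist_def nu_add nu_scale
        mu_add mu_scale)
qed

lemma twist_eq_iff: "twist f = f \<longleftrightarrow> inv_cochain f"
  by (auto simp: fun_eq_iff twist_def inv_cochain_def mu_eq_iff)

lemma twist_bvd:
  assumes f: "f \<in> cochains scale p"
  shows "twist (bvd f) = bvd (twist f)"
proof (rule form_cancel_fun)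
  fix a w
  have "rot (twist f) a u x = rot f (\<nu> a) (map \<nu> u) (map \<nu> x)" for u x
    using form_nu [of "\<mu> c" for c] by (simp add: rot_def twist_def)
  then show "\<phi> (a * twist (bvd f) w) = \<phi> (a * bvd (twist f) w)"
    by (simp add: form_twist form_bvd [OF f] form_bvd [OF cochains_twist [OF f]] wheel_def splitsum_map)
qed

lemma twist_cohomologous:
  assumes f: "f \<in> cocycles scale p"
  shows "f - twist f \<in> coboundaries scale p"
proof -
  have fc: "f \<in> cochains scale p" "dif p f = 0"
    using f by (auto simp: cocycles_iff)
  have "bvd (0 :: 'h list \<Rightarrow> 'h) = 0"
    by (rule form_cancel_fun) (simp add: form_bvd [OF cochains_zero] wheel_def rot_def)
  then have "sg p (f - twist f) + dif (p - 1) (bvd f) = 0"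
    using bvd_dif [OF fc(1)] fc(2) by simp
  then have "sg p (f - twist f) = - dif (p - 1) (bvd f)"
    by (simp add: eq_neg_iff_add_eq_0)
  moreover have "dif (p - 1) (bvd f) \<in> coboundaries scale p"
    using cochains_bvd [OF fc(1)] by (auto simp: coboundaries_iff)
  ultimately have "sg p (sg p (f - twist f)) \<in> coboundaries scale p"
    by (metis coboundaries_minus coboundaries_sg)
  then show ?thesis
    by (cases "even p") (simp_all add: sg_def)
qed

definition avg :: "('h list \<Rightarrow> 'h) \<Rightarrow> 'h list \<Rightarrow> 'h" where
  "avg f = scale_fun (inverse (of_nat N)) (\<Sum>i<N. (twist ^^ i) f)"

lemma funpow_twist: "(twist ^^ i) f w = (\<mu> ^^ i) (f (map (\<nu> ^^ i) w))"
  by (induction i arbitrary: f) (simp_all add: funpow_swap1 twist_def comp_def)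

lemma funpow_twist_N: "(twist ^^ N) f = f"
proof
  fix w
  have "(\<nu> ^^ i) ((\<mu> ^^ i) a) = a" for i a
    by (induction i arbitrary: a) (simp_all add: funpow_swap1)
  then have "(\<mu> ^^ N) a = a" for a
    by (metis nu_order)
  moreover have "\<nu> ^^ N = id"
    by (rule ext) (simp add: nu_order)
  ultimately show "(twist ^^ N) f w = f w"
    by (simp add: funpow_twist)
qed

lemma twist_sum: "twist (\<Sum>i\<in>A. f i) = (\<Sum>i\<in>A. twist (f i))"
proof -
  have "twist 0 = 0"
    by (rule ext) (simp add: twist_def)
  then show ?thesis
    by (induction A rule: infinite_finite_induct) (simp_all add: twist_add)
qed

text \<open>\<open>twist\<close> permutes its \<open>N\<close> powers cyclically, because the
  \<open>N\<close>-th one is the identity.\<close>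

lemma inv_avg: "inv_cochain (avg f)"
proof -
  have "twist (\<Sum>i<N. (twist ^^ i) f) = (\<Sum>i<N. (twist ^^ Suc i) f)"
    by (simp only: twist_sum funpow.simps comp_apply)
  moreover have "(twist ^^ 0) f + (\<Sum>i<N. (twist ^^ Suc i) f) = (\<Sum>i<Suc N. (twist ^^ i) f)"
    by (rule sum.lessThan_Suc_shift [symmetric])
  moreover have "(\<Sum>i<Suc N. (twist ^^ i) f) = (\<Sum>i<N. (twist ^^ i) f) + (twist ^^ 0) f"
    unfolding sum.lessThan_Suc funpow_twist_N by simp
  ultimately have "twist (\<Sum>i<N. (twist ^^ i) f) = (\<Sum>i<N. (twist ^^ i) f)"
    by (metis add.commute add_left_cancel)
  then show ?thesis
    by (simp add: twist_eq_iff [symmetric] avg_def twist_scale_fun)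
qed

lemma cochains_sum: "(\<And>i. i \<in> A \<Longrightarrow> f i \<in> cochains scale n) \<Longrightarrow> (\<Sum>i\<in>A. f i) \<in> cochains scale n"
  by (induction A rule: infinite_finite_induct) (simp_all add: cochains_zero cochains_add)

lemma cochains_avg: "f \<in> cochains scale n \<Longrightarrow> avg f \<in> cochains scale n"
proof -
  assume "f \<in> cochains scale n"
  then have "(twist ^^ i) f \<in> cochains scale n" for i
    by (induction i) (simp_all add: cochains_twist)
  then show ?thesis
    by (simp add: avg_def cochains_scale_fun cochains_sum)
qed

lemma funpow_twist_add: "(twist ^^ i) (f + g) = (twist ^^ i) f + (twist ^^ i) g"
  by (induction i) (simp_all only: funpow.simps comp_apply id_apply twist_add)

lemma funpow_twist_scale_fun: "(twist ^^ i) (scale_fun c f) = scale_fun c ((twist ^^ i) f)"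
  by (induction i) (simp_all add: twist_scale_fun)

lemma funpow_twist_dif: "(twist ^^ i) (dif p f) = dif p ((twist ^^ i) f)"
  by (induction i) (simp_all add: twist_dif)

lemma scale_fun_sum: "scale_fun c (\<Sum>i\<in>A. f i) = (\<Sum>i\<in>A. scale_fun c (f i))"
proof -
  have "scale_fun c 0 = 0"
    by (rule ext) (simp add: scale_fun_def)
  then show ?thesis
    by (induction A rule: infinite_finite_induct) (simp_all add: scale_fun_add)
qed

lemma avg_add: "avg (f + g) = avg f + avg g"
  by (simp add: avg_def funpow_twist_add sum.distrib scale_fun_add)

lemma avg_scale_fun: "avg (scale_fun c f) = scale_fun c (avg f)"
  by (simp add: avg_def funpow_twist_scale_fun scale_fun_sum [symmetric] scale_fun_scale_fun mult.commute)

lemma dif_sum: "dif p (\<Sum>i\<in>A. f i) = (\<Sum>i\<in>A. dif p (f i))"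
  by (induction A rule: infinite_finite_induct)
    (simp_all only: sum.infinite sum.empty sum.insert dif_zero dif_add not_False_eq_True)

lemma avg_dif: "avg (dif p f) = dif p (avg f)"
  by (simp add: avg_def funpow_twist_dif dif_sum dif_scale_fun)

lemma sum_const_scale_fun: "(\<Sum>i<n. f) = scale_fun (of_nat n) f" for n :: nat
proof (induction n)
  case (Suc n)
  show ?case
    unfolding sum.lessThan_Suc Suc.IH
    by (auto simp: scale_fun_def fun_eq_iff scale_left_distrib add.commute)
qed (auto simp: scale_fun_def fun_eq_iff)

lemma avg_inv: "inv_cochain f \<Longrightarrow> avg f = f"
proof -
  assume "inv_cochain f"
  then have "twist f = f"
    by (simp add: twist_eq_iff)
  then have "(twist ^^ i) f = f" for i
    by (induction i) simp_all
  then have "avg f = scale_fun (inverse (of_nat N)) (\<Sum>i<N. f)"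
    by (simp add: avg_def)
  then show ?thesis
    by (simp only: sum_const_scale_fun scale_fun_scale_fun order_nonzero scale_fun_one left_inverse not_False_eq_True)
qed

text \<open>\<open>twist_cohomologous\<close> is telescoped along the powers of
  \<open>twist\<close>, and the mean of the resulting coboundaries is taken.\<close>

lemma avg_cohomologous:
  assumes f: "f \<in> cocycles scale p"
  shows "f - avg f \<in> coboundaries scale p"
proof -
  have "(twist ^^ i) f \<in> cocycles scale p \<and> f - (twist ^^ i) f \<in> coboundaries scale p" for i
  proof (induction i)
    case (Suc i)
    let ?g = "(twist ^^ i) f"
    have g: "?g \<in> cocycles scale p" "f - ?g \<in> coboundaries scale p"
      using Suc by blast+
    have "(f - ?g) + (?g - twist ?g) \<in> coboundaries scale p"
      by (intro coboundaries_add twist_cohomologous g)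
    moreover have "?g - (?g - twist ?g) \<in> cocycles scale p"
      by (intro cocycles_diff coboundaries_cocycles twist_cohomologous g)
    moreover have "(twist ^^ Suc i) f = twist ?g" "(f - ?g) + (?g - twist ?g) = f - twist ?g"
      "?g - (?g - twist ?g) = twist ?g"
      by (simp_all only: funpow.simps comp_apply) (auto simp: fun_eq_iff)
    ultimately show ?case
      by (simp only: simp_thms)
  next
    case 0
    show ?case
      using f coboundaries_zero [of p] by (metis funpow_0 diff_self)
  qed
  then have "(\<Sum>i<n. f - (twist ^^ i) f) \<in> coboundaries scale p" for n
    by (induction n) (simp_all add: coboundaries_zero coboundaries_add)
  then have "scale_fun (inverse (of_nat N)) (\<Sum>i<N. f - (twist ^^ i) f) \<in> coboundaries scale p"
    by (rule coboundaries_scale_fun)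
  also have "scale_fun (inverse (of_nat N)) (\<Sum>i<N. f - (twist ^^ i) f) =
    scale_fun (inverse (of_nat N)) (\<Sum>i<N. f) - avg f"
    by (simp only: avg_def sum_subtractf scale_fun_diff)
  finally show ?thesis
    by (simp only: sum_const_scale_fun scale_fun_scale_fun order_nonzero scale_fun_one left_inverse not_False_eq_True)
qed

section \<open>The operator on cohomology\<close>

lemma bvd_add:
  assumes "f \<in> cochains scale p" "g \<in> cochains scale p"
  shows "bvd (f + g) = bvd f + bvd g"
  by (rule form_cancel_fun)
    (simp add: form_bvd [OF cochains_add [OF assms]] distrib_left form_add form_bvd [OF assms(1)] form_bvd [OF assms(2)]
      wheel_def rot_def sg_add splitsum_add)

lemma bvd_scale_fun:
  assumes "f \<in> cochains scale p"
  shows "bvd (scale_fun c f) = scale_fun c (bvd f)"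
proof (rule form_cancel_fun)
  fix a w
  have s: "\<phi> (a * scale_fun c g w) = c * \<phi> (a * g w)" for g
    by (simp add: scale_fun_def scale_mult_right form_scale)
  have r: "rot (scale_fun c f) a u x = c * rot f a u x" for u x
    by (simp add: rot_def scale_fun_def form_scale)
  show "\<phi> (a * bvd (scale_fun c f) w) = \<phi> (a * scale_fun c (bvd f) w)"
    unfolding s form_bvd [OF cochains_scale_fun [OF assms]] form_bvd [OF assms] wheel_def r
    by (simp add: splitsum_mult_right mult_sg)
qed

lemma bvd_sg:
  assumes "f \<in> cochains scale p"
  shows "bvd (sg n f) = sg n (bvd f)"
  using bvd_scale_fun [OF assms, of "(- 1) powi n"] by (simp add: scale_fun_powi)

lemma bvd_avg_dif:
  assumes "f \<in> cochains scale p"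
  shows "bvd (avg (dif p f)) = dif (p - 1) (bvd (avg f))"
  using bvd_dif [OF cochains_avg [OF assms]] inv_avg [of f] by (simp add: avg_dif twist_eq_iff [symmetric])

lemma cocycles_bvd_avg:
  assumes "f \<in> cocycles scale p"
  shows "bvd (avg f) \<in> cocycles scale (p - 1)"
proof -
  have f: "f \<in> cochains scale p" "dif p f = 0"
    using assms by (auto simp: cocycles_iff)
  have "bvd (avg (0 :: 'h list \<Rightarrow> 'h)) = 0"
    using bvd_avg_dif [OF cochains_zero, of "p"] inv_cochain_def
    by (simp add: avg_inv inv_cochain_def) (rule form_cancel_fun, simp add: form_bvd [OF cochains_zero] wheel_def rot_def)
  then have "dif (p - 1) (bvd (avg f)) = 0"
    using bvd_avg_dif [OF f(1)] f(2) by simp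
  then show ?thesis
    using cochains_bvd [OF cochains_avg [OF f(1)]] by (simp add: cocycles_iff)
qed

text \<open>Averaging is built in because \<open>bvd\<close> is a chain map only on invariant
  cochains. The sign \<open>p\<close> is one for which the BV identity comes out with the given cup
  product and bracket.\<close>

definition bv_op :: "int \<Rightarrow> ('h list \<Rightarrow> 'h) set \<Rightarrow> ('h list \<Rightarrow> 'h) set" where
  "bv_op p U = (\<Union>f\<in>U. HH_class scale (p - 1) (sg p (bvd (avg f))))"

lemma bv_op_cls:
  assumes f: "f \<in> cocycles scale p"
  shows "bv_op p (cls p f) = cls (p - 1) (sg p (bvd (avg f)))"
  unfolding bv_op_def
proof (rule UN_cls_unary)
  fix f' assume "f' \<in> cls p f"
  then obtain g where g: "g \<in> cochains scale (p - 1)" "f' - f = dif (p - 1) g"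
    by (auto simp: cls_iff coboundaries_iff)
  have fc: "f \<in> cochains scale p"
    using f by (simp add: cocycles_iff)
  have dg: "dif (p - 1) g \<in> cochains scale p"
    using cochains_dif [OF g(1)] by simp
  have "f' = f + dif (p - 1) g"
    using g(2) by (simp add: algebra_simps)
  then have "bvd (avg f') - bvd (avg f) = dif (p - 1 - 1) (bvd (avg g))"
    using bvd_avg_dif [OF g(1)] by (simp add: avg_add bvd_add [OF cochains_avg [OF fc] cochains_avg [OF dg]])
  also have "\<dots> \<in> coboundaries scale (p - 1)"
    using cochains_bvd [OF cochains_avg [OF g(1)]] unfolding coboundaries_iff by blast
  finally show "sg p (bvd (avg f')) - sg p (bvd (avg f)) \<in> coboundaries scale (p - 1)"
    unfolding sg_diff [symmetric] by (rule coboundaries_sg)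
qed

lemma cochains_negative: "f \<in> cochains scale n \<Longrightarrow> n < 0 \<Longrightarrow> f = 0"
  by (auto simp: cochains_def fun_eq_iff)

text \<open>\<open>form_bvd_dot\<close> splits \<open>bvd (dot f g)\<close> into two
  \<open>rot_prod\<close> terms. Applying \<open>form_insd_dif\<close> to the pair in both orders
  replaces each of them by an insertion, a product with \<open>bvd\<close> and a boundary; the two
  insertions combine to the bracket.\<close>

lemma bv_identity_cohomologous:
  assumes f: "f \<in> cocycles scale p" and g: "g \<in> cocycles scale q"
    and fi: "inv_cochain f" and gi: "inv_cochain g"
  shows "br p q f g - sg (p + 1) (sg (p + q + p * q) (bvd (dot f g)) - sg ((p - 1) * q + p) (dot (bvd f) g)
    - sg (p + p * (q - 1) + q) (dot f (bvd g))) \<in> coboundaries scale (p + q - 1)"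
proof -
  have fc: "f \<in> cochains scale p" "dif p f = 0" and gc: "g \<in> cochains scale q" "dif q g = 0"
    using f g by (auto simp: cocycles_iff)
  have Z1: "bvd (dot f g) = - sg (p + q + 1) (dif (p + q - 2) (insd p f g) + sg (q + 1) (ins p f g) + sg q (dot f (bvd g)))
    - sg ((q + 1) * (p + 1)) (dif (p + q - 2) (insd q g f) + sg (p + 1) (ins q g f) + sg p (dot g (bvd f)))"
  proof (rule form_cancel_fun)
    fix a w
    have 1: "rot_prod q f g a w = - (\<phi> (a * dif (p + q - 2) (insd q g f) w) + sg (p + 1) (\<phi> (a * ins q g f w))
      + sg p (\<phi> (a * dot g (bvd f) w)))"
      using form_insd_dif [OF f g fi, of a w] by (simp only: eq_neg_iff_add_eq_0 add_ac)
    have 2: "rot_prod p g f a w = - (\<phi> (a * dif (p + q - 2) (insd p f g) w) + sg (q + 1) (\<phi> (a * ins p f g w))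
      + sg q (\<phi> (a * dot f (bvd g) w)))"
      using form_insd_dif [OF g f gi, of a w] by (simp only: eq_neg_iff_add_eq_0 add_ac)
    show "\<phi> (a * bvd (dot f g) w) = \<phi> (a * (- sg (p + q + 1) (dif (p + q - 2) (insd p f g)
      + sg (q + 1) (ins p f g) + sg q (dot f (bvd g)))
      - sg ((q + 1) * (p + 1)) (dif (p + q - 2) (insd q g f) + sg (p + 1) (ins q g f) + sg p (dot g (bvd f)))) w)"
      unfolding form_bvd_dot [OF fc(1) gc(1) gi] 1 2
      by (simp add: sg_fun sg_mult_right distrib_left right_diff_distrib form_add form_diff form_minus form_sg
          sg_add sg_minus sg_diff)
  qed
  have bf: "bvd f \<in> cocycles scale (p - 1)"
    using cocycles_bvd_avg [OF f] avg_inv [OF fi] by simp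
  \<comment> \<open>\<open>form_insd_dif\<close> yields \<open>bvd f\<close> as the right factor,
    whereas the BV identity has it on the left; commutativity up to a coboundary repairs
    this.\<close>
  have 3: "dot (bvd f) g - sg ((p - 1) * q) (dot g (bvd f)) \<in> coboundaries scale (p + q - 1)"
    using dot_commute_cohomologous [OF bf g] by (simp add: algebra_simps)
  have 4: "dif (p + q - 2) (insd q g f) \<in> coboundaries scale (p + q - 1)"
    using cochains_insd [OF fc(1) gc(1)] by (auto simp: coboundaries_iff)
  have 5: "dif (p + q - 2) (insd p f g) \<in> coboundaries scale (p + q - 1)"
    using cochains_insd [OF gc(1) fc(1)] by (auto simp: coboundaries_iff add.commute)
  have "br p q f g - sg (p + 1) (sg (p + q + p * q) (bvd (dot f g)) - sg ((p - 1) * q + p) (dot (bvd f) g)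
    - sg (p + p * (q - 1) + q) (dot f (bvd g))) =
    sg (p + 1 + (p - 1) * q + p) (dot (bvd f) g - sg ((p - 1) * q) (dot g (bvd f)))
    + sg (p * q + p) (dif (p + q - 2) (insd p f g)) - sg (p + 1) (dif (p + q - 2) (insd q g f))"
    unfolding Z1 br_fun by (cases "even p"; cases "even q") (simp_all add: sg_def algebra_simps)
  also have "\<dots> \<in> coboundaries scale (p + q - 1)"
    by (rule coboundaries_diff [OF coboundaries_add [OF coboundaries_sg [OF 3] coboundaries_sg [OF 5]] coboundaries_sg [OF 4]])
  finally show ?thesis .
qed

theorem HH_bv_algebra: "bv_algebra (HH scale) (HH_cup scale) (HH_unit scale) (HH_bracket scale)"
proof (rule bv_algebra.intro [OF HH_gerstenhaber_algebra], rule bv_algebra_axioms.intro,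
    intro exI [of _ bv_op] conjI allI ballI)
  show "linear_map (HH scale p) (HH scale (p - 1)) (bv_op p)" for p
  proof (rule HH_linear_mapI, erule bv_op_cls)
    show "sg p (bvd (avg f)) \<in> cocycles scale (p - 1)" if "f \<in> cocycles scale p" for f
      using that by (intro cocycles_sg cocycles_bvd_avg)
    have bvd: "bvd (avg f + avg g) = bvd (avg f) + bvd (avg g)"
      "bvd (scale_fun c (avg f)) = scale_fun c (bvd (avg f))"
      if "f \<in> cocycles scale p" "g \<in> cocycles scale p" for f g c
      using that unfolding cocycles_iff by (blast intro: bvd_add bvd_scale_fun cochains_avg)+
    show "sg p (bvd (avg (f + g))) = sg p (bvd (avg f)) + sg p (bvd (avg g))"
      if "f \<in> cocycles scale p" "g \<in> cocycles scale p" for f g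
      unfolding avg_add bvd(1) [OF that] sg_add ..
    show "sg p (bvd (avg (scale_fun c f))) = scale_fun c (sg p (bvd (avg f)))"
      if "f \<in> cocycles scale p" for f c
      unfolding avg_scale_fun bvd(2) [OF that that] scale_fun_sg ..
  qed
  show "bv_op (p - 1) (bv_op p x) = \<zero>\<^bsub>HH scale (p - 2)\<^esub>" if x: "x \<in> carrier (HH scale p)" for p x
  proof -
    obtain f where f: "x = cls p f" "f \<in> cocycles scale p"
      using x by (auto simp: HH_carrier)
    then have fc: "avg f \<in> cochains scale p"
      by (simp add: cocycles_iff cochains_avg)
    \<comment> \<open>\<open>bvd\<close> preserves invariance, so the second averaging changes
      nothing and \<open>bvd_bvd\<close> applies.\<close>
    have "inv_cochain (bvd (avg f))"
      using twist_bvd [OF fc] inv_avg [of f] by (simp add: twist_eq_iff [symmetric])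
    then have "avg (bvd (avg f)) = bvd (avg f)"
      by (rule avg_inv)
    then have "avg (sg p (bvd (avg f))) = sg p (bvd (avg f))"
      using avg_scale_fun [of "(- 1) powi p" "bvd (avg f)"] by (simp add: scale_fun_powi)
    then have "bvd (avg (sg p (bvd (avg f)))) = 0"
      using bvd_bvd [OF fc] bvd_sg [OF cochains_bvd [OF fc]] by simp
    then show ?thesis
      using bv_op_cls [OF cocycles_sg [OF cocycles_bvd_avg [OF f(2)], of p]]
      by (simp add: f bv_op_cls HH_zero)
  qed
  show "bv_op 0 (HH_unit scale) = \<zero>\<^bsub>HH scale (- 1)\<^esub>"
  proof -
    have u: "HH_unit scale = cls 0 unit_cochain"
      by (simp add: HH_unit_def cls_def unit_cochain_def)
    have "bvd (avg unit_cochain) \<in> cochains scale (- 1)"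
      using cocycles_bvd_avg [OF unit_cocycle] by (simp add: cocycles_iff)
    then have "bvd (avg unit_cochain) = 0"
      by (rule cochains_negative) simp
    then show ?thesis
      unfolding u bv_op_cls [OF unit_cocycle] by (simp add: HH_zero)
  qed
  show "HH_bracket scale p q x y =
        (- 1) powi (p + 1) \<odot>\<^bsub>HH scale (p + q - 1)\<^esub>
          (bv_op (p + q) (HH_cup scale p q x y)
           \<ominus>\<^bsub>HH scale (p + q - 1)\<^esub> HH_cup scale (p - 1) q (bv_op p x) y
           \<ominus>\<^bsub>HH scale (p + q - 1)\<^esub>
             (- 1) powi p \<odot>\<^bsub>HH scale (p + q - 1)\<^esub> HH_cup scale p (q - 1) x (bv_op q y))"
    if x: "x \<in> carrier (HH scale p)" and y: "y \<in> carrier (HH scale q)" for p q x y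
  proof -
    \<comment> \<open>Each class contains an invariant cocycle, so the BV identity can be checked on
      invariant representatives.\<close>
    have rep: "\<exists>f. x = cls n f \<and> f \<in> cocycles scale n \<and> inv_cochain f" if x: "x \<in> carrier (HH scale n)" for x n
    proof -
      obtain f where f: "x = cls n f" "f \<in> cocycles scale n"
        using x by (auto simp: HH_carrier)
      have "x = cls n (avg f)"
        using cls_eqI [OF avg_cohomologous [OF f(2)]] f(1) by simp
      moreover have "avg f \<in> cocycles scale n"
        using cocycles_diff [OF f(2) coboundaries_cocycles [OF avg_cohomologous [OF f(2)]]] by simp
      ultimately show ?thesis
        using inv_avg by blast
    qed
    obtain f where f: "x = cls p f" "f \<in> cocycles scale p" "inv_cochain f"
      using rep [OF x] by blast
    obtain g where g: "y = cls q g" "g \<in> cocycles scale q" "inv_cochain g"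
      using rep [OF y] by blast
    have af: "avg f = f" "avg g = g"
      by (rule avg_inv, fact)+
    have bf: "bvd f \<in> cocycles scale (p - 1)" and bg: "bvd g \<in> cocycles scale (q - 1)"
      using cocycles_bvd_avg [OF f(2)] cocycles_bvd_avg [OF g(2)] af by simp_all
    have fg: "sg (p * q) (dot f g) \<in> cocycles scale (p + q)"
      by (intro cocycles_sg cocycles_dot f g)
    have "twist (dot f g) = dot f g"
      using f(3) g(3) by (simp add: twist_dot twist_eq_iff [symmetric])
    then have "avg (sg (p * q) (dot f g)) = sg (p * q) (dot f g)"
      by (intro avg_inv) (simp add: twist_eq_iff [symmetric] twist_sg)
    then have 1: "bv_op (p + q) (HH_cup scale p q x y) = cls (p + q - 1) (sg (p + q + p * q) (bvd (dot f g)))"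
      using cocycles_dot [OF f(2) g(2)] bvd_sg [of "dot f g" "p + q" "p * q"]
      unfolding f(1) g(1) HH_cup_cls [OF f(2) g(2)] bv_op_cls [OF fg] by (simp add: cocycles_iff)
    have "HH_cup scale (p - 1) q (bv_op p x) y = cls (p - 1 + q) (sg ((p - 1) * q) (dot (sg p (bvd f)) g))"
      using HH_cup_cls [OF cocycles_sg [OF bf, of p] g(2)] by (simp add: f(1,2) g(1) af bv_op_cls)
    then have 2: "HH_cup scale (p - 1) q (bv_op p x) y = cls (p + q - 1) (sg ((p - 1) * q + p) (dot (bvd f) g))"
      by (simp add: dot_sg_left algebra_simps)
    have "HH_cup scale p (q - 1) x (bv_op q y) = cls (p + (q - 1)) (sg (p * (q - 1)) (dot f (sg q (bvd g))))"
      using HH_cup_cls [OF f(2) cocycles_sg [OF bg, of q]] by (simp add: f(1) g(1,2) af bv_op_cls)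
    then have 3: "(- 1) powi p \<odot>\<^bsub>HH scale (p + q - 1)\<^esub> HH_cup scale p (q - 1) x (bv_op q y) =
      cls (p + q - 1) (sg (p + p * (q - 1) + q) (dot f (bvd g)))"
      by (simp add: dot_sg_right HH_smult_powi algebra_simps)
    have c: "sg (p + q + p * q) (bvd (dot f g)) \<in> cocycles scale (p + q - 1)"
      "sg ((p - 1) * q + p) (dot (bvd f) g) \<in> cocycles scale (p + q - 1)"
      "sg (p + p * (q - 1) + q) (dot f (bvd g)) \<in> cocycles scale (p + q - 1)"
    proof -
      have "bvd (avg (dot f g)) \<in> cocycles scale (p + q - 1)"
        by (intro cocycles_bvd_avg cocycles_dot f g)
      also have "avg (dot f g) = dot f g"
        using \<open>twist (dot f g) = dot f g\<close> by (intro avg_inv) (simp add: twist_eq_iff [symmetric])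
      finally show "sg (p + q + p * q) (bvd (dot f g)) \<in> cocycles scale (p + q - 1)"
        by (rule cocycles_sg)
      show "sg ((p - 1) * q + p) (dot (bvd f) g) \<in> cocycles scale (p + q - 1)"
        using cocycles_sg [OF cocycles_dot [OF bf g(2)]] by (simp add: algebra_simps)
      show "sg (p + p * (q - 1) + q) (dot f (bvd g)) \<in> cocycles scale (p + q - 1)"
        using cocycles_sg [OF cocycles_dot [OF f(2) bg]] by (simp add: algebra_simps)
    qed
    have "HH_bracket scale p q x y = cls (p + q - 1) (br p q f g)"
      by (simp add: f(1,2) g(1,2) HH_bracket_cls)
    also have "\<dots> = cls (p + q - 1) (sg (p + 1) (sg (p + q + p * q) (bvd (dot f g)) - sg ((p - 1) * q + p) (dot (bvd f) g)
      - sg (p + p * (q - 1) + q) (dot f (bvd g))))"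
      by (rule cls_eqI) (rule bv_identity_cohomologous [OF f(2) g(2) f(3) g(3)])
    finally show ?thesis
      unfolding 1 2 3 by (simp add: HH_minus [OF c(1,2)] HH_minus [OF cocycles_diff [OF c(1,2)] c(3)] HH_smult_powi)
  qed
qed

end

section \<open>Sweedler sums in finite-dimensional Hopf algebras\<close>

text \<open>\<open>sv\<close> is multiplication in the field or \<open>scale\<close>, so that
  functionals and endomorphisms share one notion.\<close>

definition linear_into :: "('k::field \<Rightarrow> 'h::ab_group_add \<Rightarrow> 'h) \<Rightarrow> ('k \<Rightarrow> 'v \<Rightarrow> 'v) \<Rightarrow> ('h \<Rightarrow> 'v::ab_group_add) \<Rightarrow> bool" where
  "linear_into s sv f \<longleftrightarrow> (\<forall>a b. f (a + b) = f a + f b) \<and> (\<forall>c a. f (s c a) = sv c (f a))"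

definition bilinear_into :: "('k::field \<Rightarrow> 'h::ab_group_add \<Rightarrow> 'h) \<Rightarrow> ('k \<Rightarrow> 'v \<Rightarrow> 'v) \<Rightarrow> ('h \<Rightarrow> 'h \<Rightarrow> 'v::ab_group_add) \<Rightarrow> bool" where
  "bilinear_into s sv f \<longleftrightarrow> (\<forall>x. linear_into s sv (f x)) \<and> (\<forall>y. linear_into s sv (\<lambda>x. f x y))"

definition trilinear_into :: "('k::field \<Rightarrow> 'h::ab_group_add \<Rightarrow> 'h) \<Rightarrow> ('k \<Rightarrow> 'v \<Rightarrow> 'v) \<Rightarrow> ('h \<Rightarrow> 'h \<Rightarrow> 'h \<Rightarrow> 'v::ab_group_add) \<Rightarrow> bool" where
  "trilinear_into s sv f \<longleftrightarrow> (\<forall>x y. linear_into s sv (f x y)) \<and> (\<forall>x z. linear_into s sv (\<lambda>y. f x y z))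
    \<and> (\<forall>y z. linear_into s sv (\<lambda>x. f x y z))"

lemmas multilinear_defs = linear_into_def bilinear_into_def trilinear_into_def

lemma lookup_map_times: "Poly_Mapping.lookup (Poly_Mapping.map ((*) (c::'k::field)) p) k = c * Poly_Mapping.lookup p k"
  by (simp add: Poly_Mapping.map.rep_eq when_def)

lemma poly_mapping_module: "Modules.module (\<lambda>c. Poly_Mapping.map ((*) (c::'k::field)))"
proof
  fix a b :: 'k and x y :: "'a \<Rightarrow>\<^sub>0 'k"
  show "Poly_Mapping.map ((*) a) (x + y) = Poly_Mapping.map ((*) a) x + Poly_Mapping.map ((*) a) y"
    by (rule poly_mapping_eqI) (simp add: lookup_map_times lookup_add algebra_simps)
  show "Poly_Mapping.map ((*) (a + b)) x = Poly_Mapping.map ((*) a) x + Poly_Mapping.map ((*) b) x"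
    by (rule poly_mapping_eqI) (simp add: lookup_map_times lookup_add algebra_simps)
  show "Poly_Mapping.map ((*) a) (Poly_Mapping.map ((*) b) x) = Poly_Mapping.map ((*) (a * b)) x"
    by (rule poly_mapping_eqI) (simp add: lookup_map_times algebra_simps)
  show "Poly_Mapping.map ((*) 1) x = x"
    by (rule poly_mapping_eqI) (simp add: lookup_map_times)
qed

text \<open>The linear extension \<open>L\<close> of \<open>F\<close> to the free vector space kills
  the relators and is therefore constant on cosets. Equal tensors are thus indistinguishable by
  multilinear forms, and this is what the Hopf axioms are used through.\<close>

lemma tensor_eq_imp_sum_eq:
  fixes F :: "'h::ab_group_add list \<Rightarrow> 'k::field"
  assumes add: "slot_additive F" and hom: "\<And>u c a x. F (u @ scale c a # x) = c * F (u @ a # x)"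
    and eq: "tensor scale xss = tensor scale yss"
  shows "(\<Sum>xs\<leftarrow>xss. F xs) = (\<Sum>ys\<leftarrow>yss. F ys)"
proof -
  define L :: "('h list \<Rightarrow>\<^sub>0 'k) \<Rightarrow> 'k" where "L p = (\<Sum>xs\<in>Poly_Mapping.keys p. Poly_Mapping.lookup p xs * F xs)" for p
  have L_superset: "L p = (\<Sum>xs\<in>A. Poly_Mapping.lookup p xs * F xs)" if "finite A" "Poly_Mapping.keys p \<subseteq> A" for p A
    unfolding L_def using that by (intro sum.mono_neutral_left) (auto simp: not_in_keys_iff_lookup_eq_zero)
  have L_add: "L (p + q) = L p + L q" for p q
    using L_superset [of "Poly_Mapping.keys p \<union> Poly_Mapping.keys q" p] L_superset [of "Poly_Mapping.keys p \<union> Poly_Mapping.keys q" q]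
      L_superset [of "Poly_Mapping.keys p \<union> Poly_Mapping.keys q" "p + q"] Poly_Mapping.keys_add [of p q]
    by (simp add: lookup_add distrib_right sum.distrib)
  have L_0: "L 0 = 0"
    by (simp add: L_def)
  have L_uminus: "L (- p) = - L p" for p
    using L_add [of p "- p"] by (simp add: L_0 eq_neg_iff_add_eq_0 add.commute)
  have L_diff: "L (p - q) = L p - L q" for p q
    using L_add [of p "- q"] by (simp add: L_uminus)
  have L_single: "L (Poly_Mapping.single xs c) = c * F xs" for xs c
    by (subst L_superset [of "{xs}"]) auto
  have L_scale: "L (Poly_Mapping.map ((*) c) p) = c * L p" for c p
  proof -
    have "Poly_Mapping.keys (Poly_Mapping.map ((*) c) p) \<subseteq> Poly_Mapping.keys p"
      by (auto simp: in_keys_iff lookup_map_times)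
    then have "L (Poly_Mapping.map ((*) c) p) = (\<Sum>xs\<in>Poly_Mapping.keys p. Poly_Mapping.lookup (Poly_Mapping.map ((*) c) p) xs * F xs)"
      by (intro L_superset) auto
    also have "\<dots> = c * L p"
      unfolding L_def sum_distrib_left
      by (intro sum.cong) (auto simp: lookup_map_times)
    finally show ?thesis .
  qed
  interpret P: Modules.module "\<lambda>c. Poly_Mapping.map ((*) (c::'k)) :: ('h list \<Rightarrow>\<^sub>0 'k) \<Rightarrow> _"
    by (rule poly_mapping_module)
  have null: "L p = 0" if "p \<in> tensor_null scale" for p
  proof -
    have "P.subspace {p. L p = 0}"
      by (auto simp: P.subspace_def L_0 L_add L_scale)
    moreover have "tensor_relators scale \<subseteq> {p. L p = 0}"
      using slot_additiveD [OF add] hom by (auto simp: tensor_relators_def L_diff L_single)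
    ultimately have "P.span (tensor_relators scale) \<subseteq> {p. L p = 0}"
      by (rule P.span_minimal [rotated])
    then show ?thesis
      using that by (auto simp: tensor_null_def)
  qed
  have L_list: "L (\<Sum>xs\<leftarrow>xss. Poly_Mapping.single xs 1) = (\<Sum>xs\<leftarrow>xss. F xs)" for xss
    by (induction xss) (simp_all add: L_0 L_add L_single)
  have "0 \<in> tensor_null scale"
    by (simp add: tensor_null_def P.span_zero)
  then have "(\<Sum>xs\<leftarrow>xss. Poly_Mapping.single xs 1) \<in> tensor scale yss"
    unfolding eq [symmetric] by (auto simp: tensor_def elt_set_plus_def intro: bexI [of _ 0])
  then obtain p where "(\<Sum>xs\<leftarrow>xss. Poly_Mapping.single xs 1) = (\<Sum>ys\<leftarrow>yss. Poly_Mapping.single ys 1) + p"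
    "p \<in> tensor_null scale"
    by (auto simp: tensor_def elt_set_plus_def)
  then show ?thesis
    using L_list [of xss] L_list [of yss] by (simp add: L_add null)
qed

text \<open>The value 0 off lists of length 2 makes a bilinear form slot-additive on all lists, as
  \<open>tensor_eq_imp_sum_eq\<close> requires.\<close>

definition list2 :: "('h \<Rightarrow> 'h \<Rightarrow> 'k) \<Rightarrow> 'h list \<Rightarrow> 'k::zero" where
  "list2 f l = (case l of [x, y] \<Rightarrow> f x y | _ \<Rightarrow> 0)"

definition list3 :: "('h \<Rightarrow> 'h \<Rightarrow> 'h \<Rightarrow> 'k) \<Rightarrow> 'h list \<Rightarrow> 'k::zero" where
  "list3 f l = (case l of [x, y, z] \<Rightarrow> f x y z | _ \<Rightarrow> 0)"

lemma tensor2_eq_imp_sum_eq: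
  assumes f: "bilinear_into scale (*) f" and eq: "tensor2 scale ps = tensor2 scale qs"
  shows "(\<Sum>(x, y)\<leftarrow>ps. f x y) = (\<Sum>(x, y)\<leftarrow>qs. f x y)"
proof -
  have *: "(\<Sum>xs\<leftarrow>map (\<lambda>(x, y). [x, y]) ps. list2 f xs) = (\<Sum>(x, y)\<leftarrow>ps. f x y)" for ps
    by (induction ps) (auto simp: list2_def)
  have "slot_additive (list2 f)"
    unfolding slot_additive_def
  proof (intro allI)
    fix u a b x
    show "list2 f (u @ (a + b) # x) = list2 f (u @ a # x) + list2 f (u @ b # x)"
      using f by (auto simp: list2_def multilinear_defs append_eq_Cons_conv split: list.splits)
  qed
  moreover have "list2 f (u @ scale c a # x) = c * list2 f (u @ a # x)" for u c a x
    using f by (auto simp: list2_def multilinear_defs append_eq_Cons_conv split: list.splits)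
  ultimately have "(\<Sum>xs\<leftarrow>map (\<lambda>(x, y). [x, y]) ps. list2 f xs) = (\<Sum>xs\<leftarrow>map (\<lambda>(x, y). [x, y]) qs. list2 f xs)"
    using eq by (rule tensor_eq_imp_sum_eq)
  then show ?thesis
    by (simp only: *)
qed

text \<open>\<open>D\<close> chooses one expression of each comultiplication as a list of pairs, and
  the axioms on it that concern tensors are tested by multilinear forms with values in the field.
  Because functionals separate points (\<open>lin_ext\<close>), nothing needed later is lost.
  Phrased in terms of \<open>D\<close>, the locale can be instantiated a second time with the
  factors swapped (\<open>cop_hopf\<close>).\<close>

locale fd_hopf = k_algebra scale
  for scale :: "'k::field \<Rightarrow> 'h::ring_1 \<Rightarrow> 'h" +
  fixes D :: "'h \<Rightarrow> ('h \<times> 'h) list" and \<epsilon> :: "'h \<Rightarrow> 'k" and S :: "'h \<Rightarrow> 'h" and B :: "'h set"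
  assumes D_add: "bilinear_into scale (*) f \<Longrightarrow>
      (\<Sum>(x, y)\<leftarrow>D (a + b). f x y) = (\<Sum>(x, y)\<leftarrow>D a. f x y) + (\<Sum>(x, y)\<leftarrow>D b. f x y)"
    and D_scale: "bilinear_into scale (*) f \<Longrightarrow>
      (\<Sum>(x, y)\<leftarrow>D (scale c a). f x y) = c * (\<Sum>(x, y)\<leftarrow>D a. f x y)"
    and D_one: "bilinear_into scale (*) f \<Longrightarrow> (\<Sum>(x, y)\<leftarrow>D 1. f x y) = f 1 1"
    and D_mult: "bilinear_into scale (*) f \<Longrightarrow>
      (\<Sum>(x, y)\<leftarrow>D (a * b). f x y) = (\<Sum>(x, y)\<leftarrow>D a. \<Sum>(x', y')\<leftarrow>D b. f (x * x') (y * y'))"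
    and D_coassoc: "trilinear_into scale (*) g \<Longrightarrow>
      (\<Sum>(x, y)\<leftarrow>D a. \<Sum>(x1, x2)\<leftarrow>D x. g x1 x2 y) = (\<Sum>(x, y)\<leftarrow>D a. \<Sum>(y1, y2)\<leftarrow>D y. g x y1 y2)"
    and eps_linear: "linear_into scale (*) \<epsilon>"
    and eps_one: "\<epsilon> 1 = 1"
    and eps_mult: "\<epsilon> (a * b) = \<epsilon> a * \<epsilon> b"
    and counit_l: "(\<Sum>(x, y)\<leftarrow>D a. scale (\<epsilon> x) y) = a"
    and counit_r: "(\<Sum>(x, y)\<leftarrow>D a. scale (\<epsilon> y) x) = a"
    and S_linear: "linear_into scale scale S"
    and antipode_l: "(\<Sum>(x, y)\<leftarrow>D a. S x * y) = scale (\<epsilon> a) 1"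
    and antipode_r: "(\<Sum>(x, y)\<leftarrow>D a. x * S y) = scale (\<epsilon> a) 1"
    and finite_basis: "finite_dimensional_vector_space scale B"

lemma (in hopf_algebra) fd_hopf_exists:
  assumes B: "finite_dimensional_vector_space scale B"
  shows "\<exists>D. fd_hopf scale D counit antipode B"
proof -
  have "\<forall>a. \<exists>ps. comult a = tensor2 scale ps"
    using comult_tensor by blast
  then obtain D where D: "\<And>a. comult a = tensor2 scale (D a)"
    by metis
  have "fd_hopf scale D counit antipode B"
  proof
    fix f :: "'h \<Rightarrow> 'h \<Rightarrow> 'k" and a b c
    assume f: "bilinear_into scale (*) f"
    show "(\<Sum>(x, y)\<leftarrow>D (a + b). f x y) = (\<Sum>(x, y)\<leftarrow>D a. f x y) + (\<Sum>(x, y)\<leftarrow>D b. f x y)"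
      using tensor2_eq_imp_sum_eq [OF f trans [OF D [symmetric] comult_add [OF D D]]] by simp
    show "(\<Sum>(x, y)\<leftarrow>D (scale c a). f x y) = c * (\<Sum>(x, y)\<leftarrow>D a. f x y)"
    proof -
      have "(\<Sum>(x, y)\<leftarrow>map (\<lambda>(x, y). (scale c x, y)) ps. f x y) = c * (\<Sum>(x, y)\<leftarrow>ps. f x y)" for ps
        using f by (induction ps) (auto simp: multilinear_defs distrib_left)
      then show ?thesis
        using tensor2_eq_imp_sum_eq [OF f trans [OF D [symmetric] comult_scale [OF D]]] by simp
    qed
    show "(\<Sum>(x, y)\<leftarrow>D 1. f x y) = f 1 1"
      using tensor2_eq_imp_sum_eq [OF f trans [OF D [symmetric] comult_one]] by simp
    show "(\<Sum>(x, y)\<leftarrow>D (a * b). f x y) = (\<Sum>(x, y)\<leftarrow>D a. \<Sum>(x', y')\<leftarrow>D b. f (x * x') (y * y'))"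
    proof -
      have 1: "sum_list (map ((\<lambda>(x, y). f x y) \<circ> (\<lambda>(x', y'). (u * x', v * y'))) qs) = (\<Sum>(x', y')\<leftarrow>qs. f (u * x') (v * y'))" for u v qs
        by (induction qs) auto
      have "(\<Sum>(x, y)\<leftarrow>[(x * x', y * y'). (x, y) \<leftarrow> ps, (x', y') \<leftarrow> qs]. f x y) =
        (\<Sum>(x, y)\<leftarrow>ps. \<Sum>(x', y')\<leftarrow>qs. f (x * x') (y * y'))" for ps qs
        by (induction ps) (auto simp: 1)
      then show ?thesis
        using tensor2_eq_imp_sum_eq [OF f trans [OF D [symmetric] comult_mult [OF D D]]] by simp
    qed
  next
    fix g :: "'h \<Rightarrow> 'h \<Rightarrow> 'h \<Rightarrow> 'k" and a
    assume g: "trilinear_into scale (*) g"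
    have add: "slot_additive (list3 g)"
      unfolding slot_additive_def
    proof (intro allI)
      fix u a b x
      show "list3 g (u @ (a + b) # x) = list3 g (u @ a # x) + list3 g (u @ b # x)"
        using g by (auto simp: list3_def multilinear_defs append_eq_Cons_conv split: list.splits)
    qed
    have hom: "list3 g (u @ scale c a # x) = c * list3 g (u @ a # x)" for u c a x
      using g by (auto simp: list3_def multilinear_defs append_eq_Cons_conv split: list.splits)
    have 1: "sum_list (map (list3 g \<circ> (\<lambda>(x1, x2). [x1, x2, y])) qs) = (\<Sum>(x1, x2)\<leftarrow>qs. g x1 x2 y)" for y qs
      by (induction qs) (auto simp: list3_def)
    have 2: "sum_list (map (list3 g \<circ> (\<lambda>(y1, y2). [x, y1, y2])) qs) = (\<Sum>(y1, y2)\<leftarrow>qs. g x y1 y2)" for x qs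
      by (induction qs) (auto simp: list3_def)
    have "(\<Sum>xs\<leftarrow>[[x1, x2, y]. (x, y) \<leftarrow> ps, (x1, x2) \<leftarrow> D x]. list3 g xs) = (\<Sum>(x, y)\<leftarrow>ps. \<Sum>(x1, x2)\<leftarrow>D x. g x1 x2 y)" for ps
      by (induction ps) (auto simp: 1)
    moreover have "(\<Sum>xs\<leftarrow>[[x, y1, y2]. (x, y) \<leftarrow> ps, (y1, y2) \<leftarrow> D y]. list3 g xs) = (\<Sum>(x, y)\<leftarrow>ps. \<Sum>(y1, y2)\<leftarrow>D y. g x y1 y2)" for ps
      by (induction ps) (auto simp: 2)
    ultimately show "(\<Sum>(x, y)\<leftarrow>D a. \<Sum>(x1, x2)\<leftarrow>D x. g x1 x2 y) = (\<Sum>(x, y)\<leftarrow>D a. \<Sum>(y1, y2)\<leftarrow>D y. g x y1 y2)"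
      using tensor_eq_imp_sum_eq [OF add hom coassoc [OF D D]] by simp
  next
    show "linear_into scale (*) counit" "linear_into scale scale antipode"
      using counit_linear antipode_linear by (auto simp: linear_into_def Vector_Spaces.linear_iff)
  qed (use counit_one counit_mult counit_left [OF D] counit_right [OF D] antipode_left [OF D] antipode_right [OF D]
      finite_dimensional_vector_space.finite_Basis [OF B] finite_dimensional_vector_space.independent_Basis [OF B]
      finite_dimensional_vector_space.span_Basis [OF B] in auto)
  then show ?thesis
    by (rule exI [of _ D])
qed

section \<open>Sweedler calculus tested by linear functionals\<close>

context fd_hopf
begin

sublocale fd: finite_dimensional_vector_space scale B
  by (rule finite_basis)

abbreviation lin :: "('h \<Rightarrow> 'k) \<Rightarrow> bool" where
  "lin \<equiv> linear_into scale (*)"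

abbreviation bilin :: "('h \<Rightarrow> 'h \<Rightarrow> 'k) \<Rightarrow> bool" where
  "bilin \<equiv> bilinear_into scale (*)"

abbreviation trilin :: "('h \<Rightarrow> 'h \<Rightarrow> 'h \<Rightarrow> 'k) \<Rightarrow> bool" where
  "trilin \<equiv> trilinear_into scale (*)"

definition sw :: "('h \<Rightarrow> 'h \<Rightarrow> 'v::comm_monoid_add) \<Rightarrow> 'h \<Rightarrow> 'v" where
  "sw f a = (\<Sum>(x, y)\<leftarrow>D a. f x y)"

lemma linD: "lin \<psi> \<Longrightarrow> \<psi> (a + b) = \<psi> a + \<psi> b" "lin \<psi> \<Longrightarrow> \<psi> (scale c a) = c * \<psi> a"
  by (simp_all add: linear_into_def)

lemma lin_zero: "lin \<psi> \<Longrightarrow> \<psi> 0 = 0"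
  using linD(2) [of \<psi> 0 0] by simp

lemma lin_diff: "lin \<psi> \<Longrightarrow> \<psi> (a - b) = \<psi> a - \<psi> b"
  using linD(1) [of \<psi> "a - b" b] by simp

lemma lin_sum: "lin \<psi> \<Longrightarrow> \<psi> (\<Sum>i\<in>A. f i) = (\<Sum>i\<in>A. \<psi> (f i))"
  by (induction A rule: infinite_finite_induct) (simp_all add: lin_zero linD)

lemma lin_sw: "lin \<psi> \<Longrightarrow> \<psi> (sw f a) = sw (\<lambda>x y. \<psi> (f x y)) a"
proof -
  assume \<psi>: "lin \<psi>"
  have "\<psi> (\<Sum>(x, y)\<leftarrow>ps. f x y) = (\<Sum>(x, y)\<leftarrow>ps. \<psi> (f x y))" for ps
    by (induction ps) (auto simp: lin_zero [OF \<psi>] linD [OF \<psi>])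
  then show ?thesis
    by (simp add: sw_def)
qed

lemma sw_plus: "sw (\<lambda>x y. f x y + g x y) a = sw f a + sw g a"
  unfolding sw_def by (simp add: split_def sum_list_addf)

lemma sw_mult_left: "sw (\<lambda>x y. (c::'k) * f x y) a = c * sw f a"
  unfolding sw_def by (simp add: split_def sum_list_const_mult)

lemma sw_mult_right: "sw (\<lambda>x y. f x y * (c::'k)) a = sw f a * c"
  unfolding sw_def by (simp add: split_def sum_list_mult_const)

lemma sw_0: "sw (\<lambda>x y. 0) a = 0"
  unfolding sw_def by (simp add: split_def)

lemma sw_commute: "sw (\<lambda>x y. sw (\<lambda>u v. f x y u v) b) a = sw (\<lambda>u v. sw (\<lambda>x y. f x y u v) a) b"
proof -
  have "(\<Sum>p\<leftarrow>ps. \<Sum>q\<leftarrow>qs. h p q) = (\<Sum>q\<leftarrow>qs. \<Sum>p\<leftarrow>ps. h p q)" for h :: "'h \<times> 'h \<Rightarrow> 'h \<times> 'h \<Rightarrow> 'a" and ps qs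
    by (induction ps) (simp_all add: sum_list_addf)
  then show ?thesis
    by (simp add: sw_def split_def)
qed

lemma sw_sum: "sw (\<lambda>x y. \<Sum>i\<in>A. f i x y) a = (\<Sum>i\<in>A. sw (f i) a)"
  by (induction A rule: infinite_finite_induct) (simp_all add: sw_0 sw_plus)

lemma sw_add: "bilin f \<Longrightarrow> sw f (a + b) = sw f a + sw f b"
  unfolding sw_def by (rule D_add)

lemma sw_scale: "bilin f \<Longrightarrow> sw f (scale c a) = c * sw f a"
  unfolding sw_def by (rule D_scale)

lemma sw_one: "bilin f \<Longrightarrow> sw f 1 = f 1 1"
  unfolding sw_def by (rule D_one)

lemma sw_mult: "bilin f \<Longrightarrow> sw f (a * b) = sw (\<lambda>x y. sw (\<lambda>x' y'. f (x * x') (y * y')) b) a"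
  unfolding sw_def by (rule D_mult)

lemma sw_coassoc: "trilin g \<Longrightarrow>
  sw (\<lambda>x y. sw (\<lambda>x1 x2. g x1 x2 y) x) a = sw (\<lambda>x y. sw (\<lambda>y1 y2. g x y1 y2) y) a"
  unfolding sw_def by (rule D_coassoc)

lemma eps_add: "\<epsilon> (a + b) = \<epsilon> a + \<epsilon> b" and eps_scale: "\<epsilon> (scale c a) = c * \<epsilon> a"
  using eps_linear by (simp_all add: linear_into_def)

lemma S_add: "S (a + b) = S a + S b" and S_scale: "S (scale c a) = scale c (S a)"
  using S_linear by (simp_all add: linear_into_def)

lemma lin_sw_fun: "bilin f \<Longrightarrow> lin (sw f)"
  by (simp add: linear_into_def sw_add sw_scale)

text \<open>Nearly every Sweedler rule has a multilinearity premise; these rewrites discharge it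
  once the linearity of the functionals involved is in the simpset.\<close>

lemmas multilinear_simps = multilinear_defs distrib_left distrib_right scale_mult_left scale_mult_right
  eps_add eps_scale S_add S_scale scale_right_distrib mult.assoc mult.left_commute sw_plus sw_mult_left sw_add sw_scale

lemma sw_eps_left: "lin L \<Longrightarrow> sw (\<lambda>x y. \<epsilon> x * L y) a = L a"
proof -
  assume L: "lin L"
  have "L (sw (\<lambda>x y. scale (\<epsilon> x) y) a) = L a"
    by (simp add: sw_def counit_l)
  then show ?thesis
    by (simp add: lin_sw [OF L] linD [OF L])
qed

lemma sw_eps_right: "lin L \<Longrightarrow> sw (\<lambda>x y. \<epsilon> y * L x) a = L a"
proof -
  assume L: "lin L"
  have "L (sw (\<lambda>x y. scale (\<epsilon> y) x) a) = L a"
    by (simp add: sw_def counit_r)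
  then show ?thesis
    by (simp add: lin_sw [OF L] linD [OF L])
qed

lemma sw_S_left: "lin L \<Longrightarrow> sw (\<lambda>x y. L (S x * y)) a = \<epsilon> a * L 1"
proof -
  assume L: "lin L"
  have "L (sw (\<lambda>x y. S x * y) a) = \<epsilon> a * L 1"
    by (simp add: sw_def antipode_l linD [OF L])
  then show ?thesis
    by (simp add: lin_sw [OF L])
qed

lemma sw_S_right: "lin L \<Longrightarrow> sw (\<lambda>x y. L (x * S y)) a = \<epsilon> a * L 1"
proof -
  assume L: "lin L"
  have "L (sw (\<lambda>x y. x * S y) a) = \<epsilon> a * L 1"
    by (simp add: sw_def antipode_r linD [OF L])
  then show ?thesis
    by (simp add: lin_sw [OF L])
qed

definition crd :: "'h \<Rightarrow> 'h \<Rightarrow> 'k" where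
  "crd b x = representation B x b"

lemma crd_lin: "lin (crd b)"
  by (auto simp: linear_into_def crd_def representation_add [OF fd.independent_Basis]
      representation_scale [OF fd.independent_Basis] fd.span_Basis)

lemma crd_sum: "(\<Sum>b\<in>B. scale (crd b x) b) = x"
  unfolding crd_def
  by (rule sum_representation_eq) (auto simp: fd.independent_Basis fd.span_Basis fd.finite_Basis)

lemma lin_expand: "lin L \<Longrightarrow> (\<Sum>b\<in>B. crd b x * L b) = L x"
  using lin_sum [of L "\<lambda>b. scale (crd b x) b" B] by (simp add: crd_sum linD)

text \<open>Coordinates with respect to a basis are linear functionals. Identities in H are proved
  by applying an arbitrary functional to both sides.\<close>

lemma lin_ext: "(\<And>\<psi>. lin \<psi> \<Longrightarrow> \<psi> x = \<psi> y) \<Longrightarrow> x = y"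
proof -
  assume eq: "\<And>\<psi>. lin \<psi> \<Longrightarrow> \<psi> x = \<psi> y"
  have "(\<Sum>b\<in>B. scale (crd b x) b) = (\<Sum>b\<in>B. scale (crd b y) b)"
    using eq [OF crd_lin] by simp
  then show ?thesis
    by (simp only: crd_sum)
qed

text \<open>Both sides are convolution inverse to the multiplication. Concretely,
  \<open>S (a1 * b1) * (a2 * b2) * (S b3 * S a3)\<close>, which is \<open>Om\<close> under a
  functional, is evaluated by cancelling its right half or its left half.\<close>

lemma S_mult: "S (a * b) = S b * S a"
proof (rule lin_ext)
  fix \<psi> assume \<psi>: "lin \<psi>"
  note [simp] = linD [OF \<psi>]
  define Om where "Om a1 b1 p r q s = \<psi> (S (a1 * b1) * (p * r) * (S s * S q))" for a1 b1 p r q s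
  have 1: "sw (\<lambda>p q. sw (\<lambda>r s. Om a1 b1 p r q s) b2) a2 = \<epsilon> a2 * (\<epsilon> b2 * \<psi> (S (a1 * b1)))" for a1 b1 a2 b2
  proof -
    have "sw (\<lambda>r s. \<psi> (S (a1 * b1) * p * (r * S s) * S q)) b2 = \<epsilon> b2 * \<psi> (S (a1 * b1) * p * 1 * S q)" for p q
      by (rule sw_S_right) (simp add: multilinear_simps)
    then have "sw (\<lambda>p q. sw (\<lambda>r s. Om a1 b1 p r q s) b2) a2 = \<epsilon> b2 * sw (\<lambda>p q. \<psi> (S (a1 * b1) * (p * S q))) a2"
      by (simp add: Om_def mult.assoc sw_mult_left)
    also have "sw (\<lambda>p q. \<psi> (S (a1 * b1) * (p * S q))) a2 = \<epsilon> a2 * \<psi> (S (a1 * b1) * 1)"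
      by (rule sw_S_right) (simp add: multilinear_simps)
    finally show ?thesis
      by simp
  qed
  have 2: "sw (\<lambda>a1 p. sw (\<lambda>b1 r. Om a1 b1 p r q s) v) u = \<epsilon> u * (\<epsilon> v * \<psi> (S s * S q))" for u v q s
  proof -
    have "sw (\<lambda>a1 p. sw (\<lambda>b1 r. Om a1 b1 p r q s) v) u = sw (\<lambda>x y. \<psi> (S x * y * (S s * S q))) (u * v)"
      unfolding Om_def by (rule sw_mult [symmetric]) (simp add: multilinear_simps)
    also have "\<dots> = \<epsilon> (u * v) * \<psi> (1 * (S s * S q))"
      by (rule sw_S_left) (simp add: multilinear_simps)
    finally show ?thesis
      by (simp add: eps_mult)
  qed
  have "\<psi> (S (a * b)) = sw (\<lambda>a1 a2. \<epsilon> a2 * sw (\<lambda>b1 b2. \<epsilon> b2 * \<psi> (S (a1 * b1))) b) a"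
    by (subst sw_eps_right, simp add: multilinear_simps)+ (rule refl)
  also have "\<dots> = sw (\<lambda>a1 a2. sw (\<lambda>b1 b2. sw (\<lambda>p q. sw (\<lambda>r s. Om a1 b1 p r q s) b2) a2) b) a"
    by (simp add: 1 sw_mult_left)
  also have "\<dots> = sw (\<lambda>a1 a2. sw (\<lambda>p q. sw (\<lambda>b1 b2. sw (\<lambda>r s. Om a1 b1 p r q s) b2) b) a2) a"
    by (subst sw_commute) (rule refl)
  also have "\<dots> = sw (\<lambda>a1 a2. sw (\<lambda>p q. sw (\<lambda>v s. sw (\<lambda>b1 r. Om a1 b1 p r q s) v) b) a2) a"
    by (subst sw_coassoc) (simp_all add: Om_def multilinear_simps)
  also have "\<dots> = sw (\<lambda>u q. sw (\<lambda>a1 p. sw (\<lambda>v s. sw (\<lambda>b1 r. Om a1 b1 p r q s) v) b) u) a"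
    by (rule sw_coassoc [symmetric]) (simp add: Om_def multilinear_simps)
  also have "\<dots> = sw (\<lambda>u q. sw (\<lambda>v s. sw (\<lambda>a1 p. sw (\<lambda>b1 r. Om a1 b1 p r q s) v) u) b) a"
    by (subst sw_commute) (rule refl)
  also have "\<dots> = sw (\<lambda>u q. \<epsilon> u * sw (\<lambda>v s. \<epsilon> v * \<psi> (S s * S q)) b) a"
    by (simp add: 2 sw_mult_left)
  also have "\<dots> = \<psi> (S b * S a)"
    by (subst sw_eps_left, simp add: multilinear_simps)+ (rule refl)
  finally show "\<psi> (S (a * b)) = \<psi> (S b * S a)" .
qed

text \<open>The argument of \<open>S_mult\<close> for the comultiplication: \<open>T\<close> is the
  product of the comultiplications of \<open>S x\<close> and \<open>y\<close> with
  \<open>S z2 \<otimes> S z1\<close>, and its last two or its first two factors cancel.\<close>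

lemma sw_S:
  assumes F: "bilin F"
  shows "sw F (S a) = sw (\<lambda>x y. F (S y) (S x)) a"
proof -
  have [simp]: "F (x + x') y = F x y + F x' y" "F x (y + y') = F x y + F x y'"
    "F (scale c x) y = c * F x y" "F x (scale c y) = c * F x y" for x x' y y' c
    using F by (auto simp: multilinear_defs)
  define T where "T x y z = sw (\<lambda>x1 x2. sw (\<lambda>y1 y2. sw (\<lambda>z1 z2. F (x1 * (y1 * S z2)) (x2 * (y2 * S z1))) z) y) (S x)" for x y z
  have T: "trilin T"
    by (simp add: T_def multilinear_simps)
  have R: "sw (\<lambda>y z. sw (\<lambda>y1 y2. sw (\<lambda>z1 z2. F (p * (y1 * S z2)) (q * (y2 * S z1))) z) y) r = \<epsilon> r * F p q" for p q r
  proof -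
    have "sw (\<lambda>y z. sw (\<lambda>y1 y2. sw (\<lambda>z1 z2. F (p * (y1 * S z2)) (q * (y2 * S z1))) z) y) r =
      sw (\<lambda>y1 t. sw (\<lambda>y2 z. sw (\<lambda>z1 z2. F (p * (y1 * S z2)) (q * (y2 * S z1))) z) t) r"
      by (rule sw_coassoc) (simp add: multilinear_simps)
    also have "\<dots> = sw (\<lambda>y1 t. sw (\<lambda>w z2. sw (\<lambda>y2 z1. F (p * (y1 * S z2)) (q * (y2 * S z1))) w) t) r"
      by (subst sw_coassoc [symmetric]) (simp_all add: multilinear_simps)
    also have "\<dots> = sw (\<lambda>y1 t. sw (\<lambda>w z2. \<epsilon> w * F (p * (y1 * S z2)) (q * 1)) t) r"
      by (subst sw_S_right [where L = "\<lambda>e. F u (q * e)" for u]) (simp_all add: multilinear_simps)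
    also have "\<dots> = sw (\<lambda>y1 t. F (p * (y1 * S t)) (q * 1)) r"
      by (subst sw_eps_left) (simp_all add: multilinear_simps)
    also have "\<dots> = \<epsilon> r * F (p * 1) (q * 1)"
      by (rule sw_S_right) (simp add: multilinear_simps)
    finally show ?thesis
      by simp
  qed
  have right: "sw (\<lambda>y z. T x y z) r = \<epsilon> r * sw F (S x)" for x r
    unfolding T_def by (subst sw_commute) (simp add: R sw_mult_left)
  have left: "sw (\<lambda>x y. T x y z) r = \<epsilon> r * sw (\<lambda>x y. F (S y) (S x)) z" for z r
  proof -
    have "sw (\<lambda>x y. T x y z) r = sw (\<lambda>x y. sw (\<lambda>z1 z2. sw (\<lambda>x1 x2. sw (\<lambda>y1 y2. F (x1 * (y1 * S z2)) (x2 * (y2 * S z1))) y) (S x)) z) r"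
    proof -
      have "T x y z = sw (\<lambda>z1 z2. sw (\<lambda>x1 x2. sw (\<lambda>y1 y2. F (x1 * (y1 * S z2)) (x2 * (y2 * S z1))) y) (S x)) z" for x y
        unfolding T_def by (subst sw_commute [where a = y]) (rule sw_commute)
      then show ?thesis
        by simp
    qed
    also have "\<dots> = sw (\<lambda>z1 z2. sw (\<lambda>x y. sw (\<lambda>p q. F (p * S z2) (q * S z1)) (S x * y)) r) z"
      by (subst sw_commute) (simp add: sw_mult multilinear_simps)
    also have "\<dots> = sw (\<lambda>z1 z2. \<epsilon> r * sw (\<lambda>p q. F (p * S z2) (q * S z1)) 1) z"
      by (subst sw_S_left) (simp_all add: multilinear_simps)
    also have "\<dots> = \<epsilon> r * sw (\<lambda>x y. F (S y) (S x)) z"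
      by (simp add: sw_one multilinear_simps)
    finally show ?thesis .
  qed
  have "sw F (S a) = sw (\<lambda>x r. \<epsilon> r * sw F (S x)) a"
    by (rule sw_eps_right [symmetric]) (simp add: multilinear_simps)
  also have "\<dots> = sw (\<lambda>r z. sw (\<lambda>x y. T x y z) r) a"
    unfolding right [symmetric] by (rule sw_coassoc [OF T, symmetric])
  also have "\<dots> = sw (\<lambda>x y. F (S y) (S x)) a"
    unfolding left by (rule sw_eps_left) (simp add: multilinear_simps)
  finally show ?thesis .
qed

lemma S_one: "S 1 = 1"
proof (rule lin_ext)
  fix \<psi> assume \<psi>: "lin \<psi>"
  note [simp] = linD [OF \<psi>]
  have "sw (\<lambda>x y. \<psi> (S x * y)) 1 = \<psi> (S 1 * 1)"
    by (rule sw_one) (simp add: multilinear_simps)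
  then show "\<psi> (S 1) = \<psi> 1"
    using sw_S_left [OF \<psi>, of 1] by (simp add: eps_one)
qed

text \<open>Both sides are the coaction of \<open>m\<close> translated by \<open>S h\<close>, as in the Hopf module theorem.\<close>

lemma sw_translate:
  assumes \<psi>: "lin \<psi>" and m: "lin m"
  shows "sw (\<lambda>h1 h2. sw (\<lambda>u1 u2. \<psi> (u1 * h2) * m u2) (x * S h1)) h = sw (\<lambda>x1 x2. \<psi> x1 * m (x2 * S h)) x"
proof -
  note [simp] = linD [OF \<psi>] linD [OF m]
  have "sw (\<lambda>u1 u2. \<psi> (u1 * h2) * m u2) (x * S h1) =
    sw (\<lambda>x1 x2. sw (\<lambda>p q. \<psi> (x1 * (S q * h2)) * m (x2 * S p)) h1) x" for h1 h2
    by (subst sw_mult, simp add: multilinear_simps, subst sw_S) (simp_all add: multilinear_simps)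
  then have "sw (\<lambda>h1 h2. sw (\<lambda>u1 u2. \<psi> (u1 * h2) * m u2) (x * S h1)) h =
    sw (\<lambda>x1 x2. sw (\<lambda>h1 h2. sw (\<lambda>p q. \<psi> (x1 * (S q * h2)) * m (x2 * S p)) h1) h) x"
    by (simp only:) (rule sw_commute)
  also have "\<dots> = sw (\<lambda>x1 x2. sw (\<lambda>p t. sw (\<lambda>q h2. m (x2 * S p) * \<psi> (x1 * (S q * h2))) t) h) x"
    by (subst sw_coassoc) (simp_all add: multilinear_simps mult.commute [of "m a" for a])
  also have "\<dots> = sw (\<lambda>x1 x2. sw (\<lambda>p t. \<epsilon> t * (m (x2 * S p) * \<psi> x1)) h) x"
    by (simp add: sw_mult_left sw_S_left [where L = "\<lambda>e. \<psi> (u * e)" for u] multilinear_simps)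
  also have "\<dots> = sw (\<lambda>x1 x2. \<psi> x1 * m (x2 * S h)) x"
    by (subst sw_eps_right) (simp_all add: multilinear_simps mult.commute)
  finally show ?thesis .
qed

end

section \<open>Integrals and the Nakayama automorphism\<close>

context fd_hopf
begin

lemma sw_mult_left_fun: "sw (\<lambda>x y. (c::'k) * f x y) = (\<lambda>a. c * sw f a)"
  by (rule ext) (rule sw_mult_left)

text \<open>A left integral of the dual algebra, \<open>x1 * lam x2 = lam x * 1\<close> in Sweedler
  notation, tested by functionals.\<close>

definition lint :: "('h \<Rightarrow> 'k) \<Rightarrow> bool" where
  "lint lam \<longleftrightarrow> lin lam \<and> (\<forall>\<psi> x. lin \<psi> \<longrightarrow> sw (\<lambda>x1 x2. \<psi> x1 * lam x2) x = \<psi> 1 * lam x)"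

lemma lint_lin: "lint lam \<Longrightarrow> lin lam"
  by (simp add: lint_def)

lemma lintD: "lint lam \<Longrightarrow> lin \<psi> \<Longrightarrow> sw (\<lambda>x1 x2. \<psi> x1 * lam x2) x = \<psi> 1 * lam x"
  by (simp add: lint_def)

text \<open>Left integrals arise as traces of the operators \<open>y \<mapsto> (x S\<^sup>2(y))\<^sub>1 f((x S\<^sup>2(y))\<^sub>2)\<close>.\<close>

definition contract :: "('h \<Rightarrow> 'k) \<Rightarrow> 'h \<Rightarrow> 'h" where
  "contract f u = sw (\<lambda>p q. scale (f q) p) u"

definition trace_functional :: "('h \<Rightarrow> 'k) \<Rightarrow> 'h \<Rightarrow> 'k" where
  "trace_functional f x = (\<Sum>b\<in>B. crd b (contract f (x * S (S b))))"

lemma lin_contract: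
  assumes f: "lin f" and G: "lin G"
  shows "G (contract f u) = sw (\<lambda>p q. f q * G p) u"
  unfolding contract_def lin_sw [OF G] by (simp add: linD [OF G])

lemma contract_linear:
  assumes f: "lin f"
  shows "linear_into scale scale (contract f)"
proof -
  note [simp] = linD [OF f]
  have "contract f (a + b) = contract f a + contract f b" for a b
  proof (rule lin_ext)
    fix \<psi> assume \<psi>: "lin \<psi>"
    note [simp] = linD [OF \<psi>]
    show "\<psi> (contract f (a + b)) = \<psi> (contract f a + contract f b)"
      by (simp add: lin_contract [OF f \<psi>] multilinear_simps)
  qed
  moreover have "contract f (scale c a) = scale c (contract f a)" for a c
  proof (rule lin_ext)
    fix \<psi> assume \<psi>: "lin \<psi>"
    note [simp] = linD [OF \<psi>]
    show "\<psi> (contract f (scale c a)) = \<psi> (scale c (contract f a))"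
      by (simp add: lin_contract [OF f \<psi>] multilinear_simps)
  qed
  ultimately show ?thesis
    by (simp add: linear_into_def)
qed

lemma sw_contract:
  assumes f: "lin f" and G: "bilin G"
  shows "sw G (contract f u) = sw (\<lambda>p q. sw (\<lambda>v w. G p v * f w) q) u"
proof -
  have [simp]: "G (x + x') y = G x y + G x' y" "G x (y + y') = G x y + G x y'"
    "G (scale c x) y = c * G x y" "G x (scale c y) = c * G x y" for x x' y y' c
    using G by (auto simp: multilinear_defs)
  note [simp] = linD [OF f]
  have "sw G (contract f u) = sw (\<lambda>t w. sw (\<lambda>p v. G p v * f w) t) u"
    by (simp add: lin_contract [OF f lin_sw_fun [OF G]] sw_mult_left mult.commute)
  also have "\<dots> = sw (\<lambda>p q. sw (\<lambda>v w. G p v * f w) q) u"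
    by (rule sw_coassoc) (simp add: multilinear_simps)
  finally show ?thesis .
qed

text \<open>\<open>sw_translate\<close> pulls \<open>\<psi>\<close> into the trace at the cost of a
  factor \<open>S b1\<close>. Cyclicity of the trace brings this factor next to the letter it
  cancels with, and \<open>\<psi> 1\<close> is left.\<close>

lemma lint_trace_functional:
  assumes f: "lin f"
  shows "lint (trace_functional f)"
  unfolding lint_def
proof (intro conjI allI impI)
  note [simp] = linD [OF f] linD [OF crd_lin]
  have C_add [simp]: "contract f (a + b) = contract f a + contract f b"
    and C_scale [simp]: "contract f (scale c a) = scale c (contract f a)" for a b c
    using contract_linear [OF f] by (simp_all add: linear_into_def)
  show "lin (trace_functional f)"
    by (simp add: trace_functional_def multilinear_simps sum.distrib sum_distrib_left)
  fix \<psi> x assume \<psi>: "lin \<psi>"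
  note [simp] = linD [OF \<psi>]
  define m where "m b u = sw (\<lambda>p q. crd b p * f q) u" for b u
  have m_lin: "lin (m b)" for b
    unfolding m_def by (rule lin_sw_fun) (simp add: multilinear_simps)
  note [simp] = linD [OF m_lin]
  have m_crd: "crd b (contract f u) = m b u" for b u
    by (simp add: lin_contract [OF f crd_lin] m_def mult.commute)
  let ?V = "\<lambda>y. contract f (x * S (S y))"
  have expand_b: "sw (\<lambda>x1 x2. \<psi> x1 * crd b (contract f (x2 * S (S b)))) x =
    sw (\<lambda>b1 b2. \<Sum>a\<in>B. crd a (?V b2) * sw (\<lambda>u1 v. \<psi> (u1 * S b1) * crd b v) a) b" for b
  proof -
    have "sw (\<lambda>x1 x2. \<psi> x1 * crd b (contract f (x2 * S (S b)))) x =
      sw (\<lambda>h1 h2. sw (\<lambda>u1 u2. \<psi> (u1 * h2) * m b u2) (x * S h1)) (S b)"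
      unfolding m_crd by (rule sw_translate [OF \<psi> m_lin, symmetric])
    also have "\<dots> = sw (\<lambda>b1 b2. sw (\<lambda>u1 u2. \<psi> (u1 * S b1) * m b u2) (x * S (S b2))) b"
      by (rule sw_S) (simp add: multilinear_simps)
    also have "\<dots> = sw (\<lambda>b1 b2. sw (\<lambda>u1 v. \<psi> (u1 * S b1) * crd b v) (?V b2)) b"
      by (subst sw_contract [OF f], simp add: multilinear_simps)
        (simp add: m_def mult.assoc sw_mult_left_fun)
    also have "\<dots> = sw (\<lambda>b1 b2. \<Sum>a\<in>B. crd a (?V b2) * sw (\<lambda>u1 v. \<psi> (u1 * S b1) * crd b v) a) b"
      by (subst lin_expand) (simp_all add: multilinear_simps)
    finally show ?thesis .
  qed
  have "sw (\<lambda>x1 x2. \<psi> x1 * trace_functional f x2) x =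
    (\<Sum>b\<in>B. sw (\<lambda>x1 x2. \<psi> x1 * crd b (contract f (x2 * S (S b)))) x)"
    by (simp add: trace_functional_def sum_distrib_left sw_sum)
  also have "\<dots> = (\<Sum>b\<in>B. \<Sum>a\<in>B. sw (\<lambda>b1 b2. crd a (?V b2) * sw (\<lambda>u1 v. \<psi> (u1 * S b1) * crd b v) a) b)"
    unfolding expand_b sw_sum ..
  \<comment> \<open>Swapping the two basis sums is the cyclicity of the trace.\<close>
  also have "\<dots> = (\<Sum>a\<in>B. \<Sum>b\<in>B. sw (\<lambda>b1 b2. crd a (?V b2) * sw (\<lambda>u1 v. \<psi> (u1 * S b1) * crd b v) a) b)"
    by (rule sum.swap)
  also have "\<dots> = (\<Sum>a\<in>B. \<psi> 1 * crd a (?V a))"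
  proof (rule sum.cong [OF refl])
    fix a
    have "(\<Sum>b\<in>B. sw (\<lambda>b1 b2. crd a (?V b2) * sw (\<lambda>u1 v. \<psi> (u1 * S b1) * crd b v) a) b) =
      (\<Sum>b\<in>B. sw (\<lambda>u1 v. crd b v * sw (\<lambda>b1 b2. crd a (?V b2) * \<psi> (u1 * S b1)) b) a)"
      by (intro sum.cong refl) (simp add: sw_mult_left [symmetric] sw_commute [of _ a] mult_ac)
    also have "\<dots> = sw (\<lambda>u1 v. sw (\<lambda>b1 b2. crd a (?V b2) * \<psi> (u1 * S b1)) v) a"
      unfolding sw_sum [symmetric] by (subst lin_expand) (simp_all add: multilinear_simps)
    also have "\<dots> = sw (\<lambda>r q. sw (\<lambda>u1 b1. crd a (?V q) * \<psi> (u1 * S b1)) r) a"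
      by (rule sw_coassoc [symmetric]) (simp add: multilinear_simps)
    also have "\<dots> = sw (\<lambda>r q. \<epsilon> r * (\<psi> 1 * crd a (?V q))) a"
      by (subst sw_S_right [where L = "\<lambda>e. c * \<psi> e" for c]) (simp_all add: multilinear_simps mult.commute)
    also have "\<dots> = \<psi> 1 * crd a (?V a)"
      by (rule sw_eps_left) (simp add: multilinear_simps)
    finally show "(\<Sum>b\<in>B. sw (\<lambda>b1 b2. crd a (?V b2) * sw (\<lambda>u1 v. \<psi> (u1 * S b1) * crd b v) a) b) =
      \<psi> 1 * crd a (?V a)" .
  qed
  finally show "sw (\<lambda>x1 x2. \<psi> x1 * trace_functional f x2) x = \<psi> 1 * trace_functional f x"
    by (simp add: trace_functional_def sum_distrib_left)
qed

text \<open>This makes every functional a sum of translates of left integrals, so the left integrals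
  cannot all vanish. The coordinate sums recombine to \<open>S p * v\<close> over the
  comultiplication of a basis element, where the antipode axiom applies.\<close>

lemma trace_functional_decomposition:
  assumes f: "lin f"
  shows "(\<Sum>b\<in>B. trace_functional (sw (\<lambda>p q. crd b p * f q)) (x * S b)) = f x"
proof -
  note [simp] = linD [OF f] linD [OF crd_lin]
  have m_lin: "lin (sw (\<lambda>p q. crd b p * f q))" for b
    by (rule lin_sw_fun) (simp add: multilinear_simps)
  have C_add [simp]: "contract f (a + b) = contract f a + contract f b"
    and C_scale [simp]: "contract f (scale c a) = scale c (contract f a)" for a b c
    using contract_linear [OF f] by (simp_all add: linear_into_def)
  let ?Z = "\<lambda>y. contract f (x * S y)"
  have "trace_functional (sw (\<lambda>p q. crd b p * f q)) (x * S b) =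
    (\<Sum>a\<in>B. \<Sum>c\<in>B. crd c (?Z (S a * b)) * sw (\<lambda>p v. crd a p * crd b v) c)" for b
    unfolding trace_functional_def
  proof (rule sum.cong [OF refl])
    fix a
    have "crd a (contract (sw (\<lambda>p q. crd b p * f q)) (x * S b * S (S a))) =
      sw (\<lambda>p q. sw (\<lambda>v w. crd a p * crd b v * f w) q) (x * S (S a * b))"
      unfolding lin_contract [OF m_lin crd_lin]
      by (simp add: S_mult mult.assoc sw_mult_left) (simp add: mult.commute)
    also have "\<dots> = sw (\<lambda>p v. crd a p * crd b v) (?Z (S a * b))"
      by (rule sw_contract [OF f, symmetric]) (simp add: multilinear_simps)
    also have "\<dots> = (\<Sum>c\<in>B. crd c (?Z (S a * b)) * sw (\<lambda>p v. crd a p * crd b v) c)"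
      by (rule lin_expand [symmetric], rule lin_sw_fun) (simp add: multilinear_simps)
    finally show "crd a (contract (sw (\<lambda>p q. crd b p * f q)) (x * S b * S (S a))) =
      (\<Sum>c\<in>B. crd c (?Z (S a * b)) * sw (\<lambda>p v. crd a p * crd b v) c)" .
  qed
  then have "(\<Sum>b\<in>B. trace_functional (sw (\<lambda>p q. crd b p * f q)) (x * S b)) =
    (\<Sum>b\<in>B. \<Sum>a\<in>B. \<Sum>c\<in>B. crd c (?Z (S a * b)) * sw (\<lambda>p v. crd a p * crd b v) c)"
    by simp
  also have "\<dots> = (\<Sum>b\<in>B. \<Sum>c\<in>B. \<Sum>a\<in>B. crd c (?Z (S a * b)) * sw (\<lambda>p v. crd a p * crd b v) c)"
    by (intro sum.cong refl sum.swap)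
  also have "\<dots> = (\<Sum>c\<in>B. \<Sum>b\<in>B. \<Sum>a\<in>B. crd c (?Z (S a * b)) * sw (\<lambda>p v. crd a p * crd b v) c)"
    by (rule sum.swap)
  also have "\<dots> = (\<Sum>c\<in>B. \<epsilon> c * crd c (?Z 1))"
  proof (rule sum.cong [OF refl])
    fix c
    have "(\<Sum>b\<in>B. \<Sum>a\<in>B. crd c (?Z (S a * b)) * sw (\<lambda>p v. crd a p * crd b v) c) =
      sw (\<lambda>p v. \<Sum>b\<in>B. crd b v * (\<Sum>a\<in>B. crd a p * crd c (?Z (S a * b)))) c"
      by (simp add: sw_sum sum_distrib_left sw_mult_left [symmetric] mult_ac)
    also have "\<dots> = sw (\<lambda>p v. crd c (?Z (S p * v))) c"
    proof -
      have "(\<Sum>a\<in>B. crd a p * crd c (?Z (S a * b))) = crd c (?Z (S p * b))" for p b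
        by (rule lin_expand) (simp add: multilinear_simps)
      moreover have "(\<Sum>b\<in>B. crd b v * crd c (?Z (S p * b))) = crd c (?Z (S p * v))" for p v
        by (rule lin_expand) (simp add: multilinear_simps)
      ultimately show ?thesis
        by simp
    qed
    also have "\<dots> = \<epsilon> c * crd c (?Z 1)"
      by (rule sw_S_left) (simp add: multilinear_simps)
    finally show "(\<Sum>b\<in>B. \<Sum>a\<in>B. crd c (?Z (S a * b)) * sw (\<lambda>p v. crd a p * crd b v) c) = \<epsilon> c * crd c (?Z 1)" .
  qed
  also have "\<dots> = \<epsilon> (?Z 1)"
    using lin_expand [OF eps_linear, of "?Z 1"] by (simp add: mult.commute)
  also have "\<dots> = f x"
    by (simp add: lin_contract [OF f eps_linear] S_one) (simp add: mult.commute sw_eps_left [OF f])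
  finally show ?thesis .
qed

lemma lint_exists: "\<exists>lam x. lint lam \<and> lam x \<noteq> 0"
proof (rule ccontr)
  assume none: "\<nexists>lam x. lint lam \<and> lam x \<noteq> 0"
  have "lint (trace_functional (sw (\<lambda>p q. crd b p * \<epsilon> q)))" for b
    by (intro lint_trace_functional lin_sw_fun) (simp add: multilinear_simps linD [OF crd_lin])
  then have "trace_functional (sw (\<lambda>p q. crd b p * \<epsilon> q)) x = 0" for b x
    using none by blast
  then have "\<epsilon> 1 = 0"
    using trace_functional_decomposition [OF eps_linear, of 1] by simp
  then show False
    by (simp add: eps_one)
qed

text \<open>\<open>sw_translate\<close> with \<open>m = lam\<close>, where the integral property
  evaluates the inner sum.\<close>

lemma lint_translate:
  assumes lam: "lint lam" and \<psi>: "lin \<psi>"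
  shows "sw (\<lambda>h1 h2. \<psi> h2 * lam (x * S h1)) h = sw (\<lambda>x1 x2. \<psi> x1 * lam (x2 * S h)) x"
proof -
  note [simp] = linD [OF \<psi>]
  have "sw (\<lambda>u1 u2. \<psi> (u1 * h2) * lam u2) y = \<psi> (1 * h2) * lam y" for h2 y
    by (rule lintD [OF lam]) (simp add: multilinear_simps)
  then show ?thesis
    using sw_translate [OF \<psi> lint_lin [OF lam], of x h] by simp
qed

text \<open>The hypothesis on \<open>h\<close> passes to \<open>contract \<psi> h\<close> for every
  functional \<open>\<psi>\<close>, so it is enough to derive \<open>\<epsilon> h = 0\<close>. For
  that, \<open>x0 * S (S h2)\<close> is put in place of \<open>x\<close>: then
  \<open>S (S h2) * S h1 = S (h1 * S h2)\<close> collapses, and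
  \<open>\<epsilon> h * lam x0 = 0\<close> remains.\<close>

lemma lint_nondegenerate:
  assumes lam: "lint lam" and nz: "lam x0 \<noteq> 0" and h: "\<And>x. lam (x * S h) = 0"
  shows "h = 0"
proof -
  note [simp] = linD [OF lint_lin [OF lam]]
  have eps: "\<epsilon> h = 0" if h: "\<And>x. lam (x * S h) = 0" for h
  proof -
    have 0: "sw (\<lambda>h1 h2. crd b h2 * lam (y * S h1)) h = 0" for b y
      using lint_translate [OF lam crd_lin, of b y h] h by (simp add: sw_0)
    \<comment> \<open>Expanding \<open>h2\<close> in the basis allows the left factor of
      \<open>S h1\<close> to depend on \<open>h2\<close>.\<close>
    have "0 = (\<Sum>b\<in>B. sw (\<lambda>h1 h2. crd b h2 * lam (x0 * S (S b) * S h1)) h)"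
      by (simp add: 0)
    also have "\<dots> = sw (\<lambda>h1 h2. \<Sum>b\<in>B. crd b h2 * lam (x0 * S (S b) * S h1)) h"
      by (rule sw_sum [symmetric])
    also have "\<dots> = sw (\<lambda>h1 h2. lam (x0 * S (S h2) * S h1)) h"
      by (subst lin_expand) (simp_all add: multilinear_simps)
    also have "\<dots> = sw (\<lambda>h1 h2. lam (x0 * S (h1 * S h2))) h"
      by (simp add: S_mult mult.assoc)
    also have "\<dots> = \<epsilon> h * lam (x0 * S 1)"
      by (rule sw_S_right) (simp add: multilinear_simps)
    finally show ?thesis
      using nz by (simp add: S_one)
  qed
  show "h = 0"
  proof (rule lin_ext)
    fix \<psi> assume \<psi>: "lin \<psi>"
    have "lam (x * S (contract \<psi> h)) = 0" for x
    proof -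
      have "lam (x * S (contract \<psi> h)) = sw (\<lambda>p q. \<psi> q * lam (x * S p)) h"
        by (rule lin_contract [OF \<psi>, where G = "\<lambda>t. lam (x * S t)"]) (simp add: multilinear_simps)
      then show ?thesis
        using lint_translate [OF lam \<psi>, of x h] h by (simp add: sw_0)
    qed
    then have "\<epsilon> (contract \<psi> h) = 0"
      by (rule eps)
    then show "\<psi> h = \<psi> 0"
      by (simp add: lin_contract [OF \<psi> eps_linear] lin_zero [OF \<psi>])
        (simp add: mult.commute sw_eps_left [OF \<psi>])
  qed
qed

lemma linear_iff_linear_into: "Vector_Spaces.linear scale scale f \<longleftrightarrow> linear_into scale scale f"
  by (auto simp: linear_into_def Vector_Spaces.linear_iff vector_space_axioms)

text \<open>In finite dimension the injectivity provided by \<open>lint_nondegenerate\<close> is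
  surjectivity.\<close>

lemma lint_represents:
  assumes lam: "lint lam" and nz: "lam x0 \<noteq> 0" and \<psi>: "lin \<psi>"
  shows "\<exists>h. \<forall>x. lam (x * S h) = \<psi> x"
proof -
  note [simp] = linD [OF lint_lin [OF lam]]
  \<comment> \<open>The functional \<open>lam (_ * S h)\<close> is recorded as the element of H that
    has its values on the basis as coordinates; this makes \<open>?T\<close> an
    endomorphism.\<close>
  let ?T = "\<lambda>h. \<Sum>b\<in>B. scale (lam (b * S h)) b"
  have crd_B: "crd b' b = (if b' = b then 1 else 0)" if "b \<in> B" for b b'
    using that by (simp add: crd_def representation_basis [OF fd.independent_Basis])
  have crd_T: "crd b' (\<Sum>b\<in>B. scale (c b) b) = c b'" if "b' \<in> B" for b' c
    using that by (simp add: lin_sum [OF crd_lin] linD [OF crd_lin] crd_B fd.finite_Basis if_distrib [of "(*) x" for x] cong: if_cong)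
  have ext: "\<chi> x = \<chi>' x" if "lin \<chi>" "lin \<chi>'" "\<And>b. b \<in> B \<Longrightarrow> \<chi> b = \<chi>' b" for \<chi> \<chi>' x
    using lin_expand [OF that(1), of x] lin_expand [OF that(2), of x] that(3) by (metis (no_types, lifting) sum.cong)
  have lin1: "lin (\<lambda>x. lam (x * S h))" for h
    by (simp add: multilinear_simps)
  have T: "Vector_Spaces.linear scale scale ?T"
    unfolding linear_iff_linear_into
    by (simp add: multilinear_simps scale_left_distrib sum.distrib scale_sum_right)
  have "inj ?T"
  proof (rule injI)
    fix h h' assume "?T h = ?T h'"
    then have "lam (b * S h) = lam (b * S h')" if "b \<in> B" for b
      using crd_T [OF that] by metis
    then have "lam (x * S h) = lam (x * S h')" for x
      by (rule ext [OF lin1 lin1])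
    then have "lam (x * S (h - h')) = 0" for x
      using lin_diff [of "\<lambda>t. lam (x * S t)" h h'] by (simp add: multilinear_simps)
    then have "h - h' = 0"
      by (rule lint_nondegenerate [OF lam nz])
    then show "h = h'"
      by simp
  qed
  then have "surj ?T"
    by (rule fd.linear_inj_imp_surj [OF T])
  then have "\<exists>h. (\<Sum>b\<in>B. scale (\<psi> b) b) = ?T h"
    by (rule surjD)
  then obtain h where h: "(\<Sum>b\<in>B. scale (\<psi> b) b) = ?T h"
    by (rule exE)
  have "lam (b * S h) = \<psi> b" if "b \<in> B" for b
    using crd_T [OF that, of \<psi>] crd_T [OF that, of "\<lambda>b. lam (b * S h)"] unfolding h by simp
  then have "lam (x * S h) = \<psi> x" for x
    by (rule ext [OF lin1 \<psi>])
  then show ?thesis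
    by blast
qed

text \<open>If \<open>S h = 0\<close>, then \<open>lam (_ * S h)\<close> vanishes and nondegeneracy
  gives \<open>h = 0\<close>. Bijectivity is what provides the antipode of the co-opposite Hopf
  algebra.\<close>

lemma bij_S: "bij S"
proof -
  obtain lam x0 where lam: "lint lam" "lam x0 \<noteq> 0"
    using lint_exists by blast
  have lin: "Vector_Spaces.linear scale scale S"
    unfolding linear_iff_linear_into by (rule S_linear)
  have "inj S"
  proof (rule injI)
    fix h h' assume "S h = S h'"
    then have "S (h - h') = 0"
      using S_add [of "h - h'" h'] by simp
    then have "h - h' = 0"
      by (intro lint_nondegenerate [OF lam]) (simp add: lin_zero [OF lint_lin [OF lam(1)]])
    then show "h = h'"
      by simp
  qed
  then show ?thesis
    using fd.linear_inj_imp_surj [OF lin] by (simp add: bij_def)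
qed

text \<open>As \<open>S\<close> is onto, the factor \<open>S h\<close> in
  \<open>lint_nondegenerate\<close> can be any element.\<close>

lemma lint_cancel:
  assumes lam: "lint lam" "lam x0 \<noteq> 0" and "\<And>x. lam (x * c) = lam (x * d)"
  shows "c = d"
proof -
  obtain h where h: "c - d = S h"
    using bij_S by (metis bij_pointE)
  have "lam (x * S h) = 0" for x
    unfolding h [symmetric] right_diff_distrib lin_diff [OF lint_lin [OF lam(1)]] using assms(3) by simp
  then have "h = 0"
    by (rule lint_nondegenerate [OF lam])
  then have "S h = 0"
    using S_scale [of 0 0] by simp
  then show ?thesis
    using h by simp
qed

lemma lint_surj:
  assumes "lint lam" "lam x0 \<noteq> 0" "lin \<psi>"
  shows "\<exists>c. \<forall>x. lam (x * c) = \<psi> x"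
  using lint_represents [OF assms] by blast

text \<open>Represent \<open>mu\<close> as \<open>lam (_ * S h)\<close>. Comparing the integral
  properties of both through \<open>lint_translate\<close> gives
  \<open>contract \<psi> h = \<psi> 1 * h\<close> for all \<open>\<psi>\<close>, and applying
  \<open>\<epsilon>\<close> shows that \<open>h\<close> is a scalar.\<close>

lemma lint_unique:
  assumes lam: "lint lam" "lam x0 \<noteq> 0" and mu: "lint mu"
  shows "\<exists>c. \<forall>x. mu x = c * lam x"
proof -
  note [simp] = linD [OF lint_lin [OF lam(1)]]
  obtain h where h: "\<And>x. lam (x * S h) = mu x"
    using lint_represents [OF lam lint_lin [OF mu]] by blast
  have "h = scale (\<epsilon> h) 1"
  proof (rule lin_ext)
    fix \<psi> assume \<psi>: "lin \<psi>"
    have "lam (x * S (contract \<psi> h - scale (\<psi> 1) h)) = 0" for x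
    proof -
      have L: "lin (\<lambda>t. lam (x * S t))"
        by (simp add: multilinear_simps)
      have "lam (x * S (contract \<psi> h)) = sw (\<lambda>p q. \<psi> q * lam (x * S p)) h"
        by (rule lin_contract [OF \<psi> L])
      also have "\<dots> = \<psi> 1 * mu x"
        unfolding lint_translate [OF lam(1) \<psi>] h by (rule lintD [OF mu \<psi>])
      finally show ?thesis
        using lin_diff [OF L] linD(2) [OF L] h by simp
    qed
    then have "contract \<psi> h - scale (\<psi> 1) h = 0"
      by (rule lint_nondegenerate [OF lam])
    then have "\<epsilon> (contract \<psi> h) = \<epsilon> (scale (\<psi> 1) h)"
      by simp
    then show "\<psi> h = \<psi> (scale (\<epsilon> h) 1)"
      by (simp add: lin_contract [OF \<psi> eps_linear] eps_scale linD [OF \<psi>])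
        (simp add: mult.commute sw_eps_left [OF \<psi>])
  qed
  then have "mu x = lam (x * S (scale (\<epsilon> h) 1))" for x
    using h by simp
  then show ?thesis
    by (intro exI [of _ "\<epsilon> h"]) (simp add: S_scale S_one scale_mult_right)
qed

text \<open>In Sweedler notation \<open>b1 * lam (x * b2) = S x1 * lam (x2 * b)\<close>. On the
  right, the integral property at \<open>x2 * b\<close> produces a further factor
  \<open>x2 * b1\<close> behind \<open>S x1\<close>, and \<open>S x1 * x2\<close> cancels.\<close>

lemma lint_antipode:
  assumes lam: "lint lam" and \<psi>: "lin \<psi>"
  shows "sw (\<lambda>b1 b2. \<psi> b1 * lam (x * b2)) b = sw (\<lambda>x1 x2. \<psi> (S x1) * lam (x2 * b)) x"
proof -
  note [simp] = linD [OF lint_lin [OF lam]] linD [OF \<psi>]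
  have "sw (\<lambda>x1 x2. \<psi> (S x1) * lam (x2 * b)) x =
    sw (\<lambda>x1 t. sw (\<lambda>y1 y2. \<psi> (S x1 * y1) * lam y2) (t * b)) x"
    by (subst lintD [OF lam]) (simp_all add: multilinear_simps)
  also have "\<dots> = sw (\<lambda>x1 t. sw (\<lambda>x2 x3. sw (\<lambda>b1 b2. \<psi> (S x1 * (x2 * b1)) * lam (x3 * b2)) b) t) x"
    by (subst sw_mult) (simp_all add: multilinear_simps)
  also have "\<dots> = sw (\<lambda>t x3. sw (\<lambda>x1 x2. sw (\<lambda>b1 b2. \<psi> (S x1 * (x2 * b1)) * lam (x3 * b2)) b) t) x"
    by (rule sw_coassoc [symmetric]) (simp add: multilinear_simps)
  also have "\<dots> = sw (\<lambda>t x3. sw (\<lambda>b1 b2. sw (\<lambda>x1 x2. \<psi> (S x1 * x2 * b1) * lam (x3 * b2)) t) b) x"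
    by (subst sw_commute) (simp add: mult.assoc)
  also have "\<dots> = sw (\<lambda>t x3. \<epsilon> t * sw (\<lambda>b1 b2. \<psi> b1 * lam (x3 * b2)) b) x"
  proof -
    have "sw (\<lambda>x1 x2. \<psi> (S x1 * x2 * b1) * c) t = \<epsilon> t * (\<psi> (1 * b1) * c)" for b1 c t
      by (rule sw_S_left) (simp add: multilinear_simps)
    then show ?thesis
      by (simp add: sw_mult_left)
  qed
  also have "\<dots> = sw (\<lambda>b1 b2. \<psi> b1 * lam (x * b2)) b"
    by (rule sw_eps_left) (simp add: multilinear_simps)
  finally show ?thesis ..
qed

text \<open>\<open>t\<close> is a left integral of the algebra and \<open>al\<close> its modular function.\<close>

lemma nakayama_formula:
  assumes lam: "lint lam"
    and t: "\<And>x. lam (x * t) = \<epsilon> x" and al: "\<And>b. lam (t * b) = al b"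
    and nu: "\<And>a b. lam (a * b) = lam (b * nu a)" and \<psi>: "lin \<psi>"
  shows "sw (\<lambda>u v. \<psi> u * al v) (nu x) = \<psi> (S (S x))"
proof -
  note [simp] = linD [OF lint_lin [OF lam]] linD [OF \<psi>]
  have \<psi>S: "lin (\<lambda>y. \<psi> (S y))"
    by (simp add: multilinear_simps)
  have "\<psi> (S (S x)) = sw (\<lambda>x1 x2. \<psi> (S (S x1)) * lam (x2 * t)) x"
    unfolding t using sw_eps_right [of "\<lambda>y. \<psi> (S (S y))" x] by (simp add: multilinear_simps mult.commute)
  also have "\<dots> = sw (\<lambda>t1 t2. \<psi> (S t1) * lam (x * t2)) t"
    by (rule lint_antipode [OF lam \<psi>S, symmetric])
  also have "\<dots> = sw (\<lambda>t1 t2. \<psi> (S t1) * lam (t2 * nu x)) t"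
    by (simp only: nu [of x])
  also have "\<dots> = sw (\<lambda>u v. \<psi> u * lam (t * v)) (nu x)"
    by (rule lint_antipode [OF lam \<psi>, symmetric])
  finally show ?thesis
    by (simp add: al)
qed

end

text \<open>Dedekind's argument. The semigroup is a set \<open>C\<close> with an operation
  \<open>m\<close>, so that the lemma covers both the algebra and its linear functionals under
  convolution.\<close>

lemma characters_independent:
  fixes \<chi> :: "'i \<Rightarrow> 'a \<Rightarrow> 'k::field"
  assumes closed: "\<And>a b. a \<in> C \<Longrightarrow> b \<in> C \<Longrightarrow> m a b \<in> C"
    and mult: "\<And>i a b. i \<in> I \<Longrightarrow> a \<in> C \<Longrightarrow> b \<in> C \<Longrightarrow> \<chi> i (m a b) = \<chi> i a * \<chi> i b"
    and nz: "\<And>i. i \<in> I \<Longrightarrow> \<exists>a\<in>C. \<chi> i a \<noteq> 0"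
    and distinct: "\<And>i j. i \<in> I \<Longrightarrow> j \<in> I \<Longrightarrow> i \<noteq> j \<Longrightarrow> \<exists>a\<in>C. \<chi> i a \<noteq> \<chi> j a"
    and "finite I" and "\<And>a. a \<in> C \<Longrightarrow> (\<Sum>i\<in>I. c i * \<chi> i a) = 0" and "i \<in> I"
  shows "c i = 0"
  using assms(5) mult nz distinct assms(6,7)
proof (induction I arbitrary: c i rule: finite_induct)
  case (insert j I)
  have zero: "c i = 0" if "i \<in> I" for i
  proof -
    have "i \<noteq> j"
      using insert.hyps that by blast
    with that have "\<exists>b\<in>C. \<chi> i b \<noteq> \<chi> j b"
      by (intro insert.prems(3)) auto
    then obtain b where b: "b \<in> C" "\<chi> i b \<noteq> \<chi> j b"
      by blast
    \<comment> \<open>Subtracting \<open>\<chi> j b\<close> times the relation at \<open>a\<close>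
      from the relation at \<open>m a b\<close> eliminates \<open>j\<close>.\<close>
    have "(\<Sum>i\<in>I. c i * (\<chi> i b - \<chi> j b) * \<chi> i a) = 0" if a: "a \<in> C" for a
    proof -
      have "(\<Sum>i\<in>insert j I. c i * \<chi> i (m a b)) = 0" "(\<Sum>i\<in>insert j I. c i * \<chi> i a) = 0"
        using insert.prems(4) closed [OF a b(1)] a by blast+
      moreover have "(\<Sum>i\<in>insert j I. c i * \<chi> i (m a b)) = (\<Sum>i\<in>insert j I. c i * (\<chi> i a * \<chi> i b))"
        using insert.prems(1) a b(1) by (intro sum.cong refl) simp
      ultimately have "(\<Sum>i\<in>insert j I. c i * (\<chi> i a * \<chi> i b)) - \<chi> j b * (\<Sum>i\<in>insert j I. c i * \<chi> i a) = 0"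
        by simp
      then show ?thesis
        using insert.hyps by (simp add: sum_distrib_left sum_subtractf [symmetric] algebra_simps)
    qed
    then have "c i * (\<chi> i b - \<chi> j b) = 0"
      using insert.prems that by (intro insert.IH [of "\<lambda>i. c i * (\<chi> i b - \<chi> j b)" i]) auto
    then show ?thesis
      using b by simp
  qed
  obtain a where a: "a \<in> C" "\<chi> j a \<noteq> 0"
    using insert.prems(2) [of j] by blast
  have "(\<Sum>i\<in>insert j I. c i * \<chi> i a) = 0"
    by (rule insert.prems(4)) (rule a)
  then have "c j = 0"
    using a insert.hyps zero by simp
  then show ?case
    using zero insert.prems(5) by auto
qed simp

text \<open>The coefficients are indexed by positions, not by vectors, so a repeated vector is
  itself a dependence, with coefficients 1 and -1.\<close>

lemma (in finite_dimensional_vector_space) sequence_dependent: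
  fixes w :: "nat \<Rightarrow> 'b"
  shows "\<exists>I c. finite I \<and> (\<exists>i\<in>I. c i \<noteq> 0) \<and> (\<Sum>i\<in>I. scale (c i) (w i)) = 0"
proof (cases "inj w")
  case True
  then have "infinite (range w)"
    using finite_imageD infinite_UNIV_nat by blast
  then have "dependent (range w)"
    using finiteI_independent by blast
  then obtain T u where T: "finite T" "T \<subseteq> range w" "\<exists>v\<in>T. u v \<noteq> 0" "(\<Sum>v\<in>T. scale (u v) v) = 0"
    by (auto simp: dependent_explicit)
  obtain I where I: "T = w ` I" "finite I"
    using finite_subset_image [OF T(1,2)] by blast
  have "(\<Sum>i\<in>I. scale (u (w i)) (w i)) = 0"
    using T(4) inj_on_subset [OF True] by (simp add: I(1) sum.reindex)
  then show ?thesis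
    using I T(3) by (intro exI [of _ I] exI [of _ "\<lambda>i. u (w i)"]) auto
next
  case False
  then obtain i j where ij: "i \<noteq> j" "w i = w j"
    by (auto simp: inj_def)
  then show ?thesis
    by (intro exI [of _ "{i, j}"] exI [of _ "\<lambda>k. if k = i then 1 else - 1"]) auto
qed

lemma funpow_comp_commute:
  fixes f g :: "'a \<Rightarrow> 'a"
  assumes "\<And>x. f (g x) = g (f x)"
  shows "((\<lambda>x. f (g x)) ^^ n) x = (f ^^ n) ((g ^^ n) x)"
proof (induction n arbitrary: x)
  case (Suc n)
  have "(f ^^ n) (g y) = g ((f ^^ n) y)" for y
    by (induction n arbitrary: y) (simp_all add: assms)
  then show ?case
    by (simp add: Suc)
qed simp

lemma funpow_order_mult: "(\<And>x. (f ^^ n) x = x) \<Longrightarrow> (f ^^ (n * k)) x = x"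
  by (induction k arbitrary: x) (simp_all add: funpow_add)

section \<open>Finite order of windings and of group-like elements\<close>

context fd_hopf
begin

text \<open>Left winding, \<open>al x1 * x2\<close> in Sweedler notation. For a character
  \<open>al\<close> it is an algebra automorphism.\<close>

definition wind :: "('h \<Rightarrow> 'k) \<Rightarrow> 'h \<Rightarrow> 'h" where
  "wind al x = sw (\<lambda>u v. scale (al u) v) x"

definition character :: "('h \<Rightarrow> 'k) \<Rightarrow> bool" where
  "character al \<longleftrightarrow> lin al \<and> al 1 = 1 \<and> (\<forall>a b. al (a * b) = al a * al b)"

lemma characterD:
  assumes "character al"
  shows "lin al" "al 1 = 1" "al (a * b) = al a * al b"
  using assms by (simp_all add: character_def)

lemma lin_wind: "lin \<psi> \<Longrightarrow> \<psi> (wind al x) = sw (\<lambda>u v. al u * \<psi> v) x"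
  by (simp add: wind_def lin_sw linD)

lemma wind_linear:
  assumes "lin al"
  shows "wind al (x + y) = wind al x + wind al y" "wind al (scale c x) = scale c (wind al x)"
proof -
  note [simp] = linD [OF assms]
  show "wind al (x + y) = wind al x + wind al y"
  proof (rule lin_ext)
    fix \<psi> assume \<psi>: "lin \<psi>"
    note [simp] = linD [OF \<psi>]
    show "\<psi> (wind al (x + y)) = \<psi> (wind al x + wind al y)"
      by (simp add: lin_wind [OF \<psi>] multilinear_simps)
  qed
  show "wind al (scale c x) = scale c (wind al x)"
  proof (rule lin_ext)
    fix \<psi> assume \<psi>: "lin \<psi>"
    note [simp] = linD [OF \<psi>]
    show "\<psi> (wind al (scale c x)) = \<psi> (scale c (wind al x))"
      by (simp add: lin_wind [OF \<psi>] multilinear_simps)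
  qed
qed

lemma wind_mult:
  assumes al: "character al"
  shows "wind al (x * y) = wind al x * wind al y"
proof (rule lin_ext)
  fix \<psi> assume \<psi>: "lin \<psi>"
  note [simp] = linD [OF \<psi>] linD [OF characterD(1) [OF al]]
  have L: "lin (\<lambda>t. \<psi> (a * t))" "lin (\<lambda>t. \<psi> (t * a))" for a
    by (simp_all add: multilinear_simps)
  have "\<psi> (wind al (x * y)) = sw (\<lambda>u v. sw (\<lambda>u' v'. al u * al u' * \<psi> (v * v')) y) x"
    unfolding lin_wind [OF \<psi>] by (subst sw_mult) (simp_all add: multilinear_simps characterD(3) [OF al])
  also have "\<dots> = sw (\<lambda>u v. al u * \<psi> (v * wind al y)) x"
    by (simp add: lin_wind [OF L(1)] mult.assoc sw_mult_left)
  also have "\<dots> = \<psi> (wind al x * wind al y)"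
    by (rule lin_wind [OF L(2), symmetric])
  finally show "\<psi> (wind al (x * y)) = \<psi> (wind al x * wind al y)" .
qed

lemma wind_one:
  assumes al: "character al"
  shows "wind al 1 = 1"
proof (rule lin_ext)
  fix \<psi> assume \<psi>: "lin \<psi>"
  note [simp] = linD [OF \<psi>] linD [OF characterD(1) [OF al]]
  show "\<psi> (wind al 1) = \<psi> 1"
    unfolding lin_wind [OF \<psi>] by (subst sw_one) (simp_all add: multilinear_simps characterD(2) [OF al])
qed

lemma wind_eps: "wind \<epsilon> x = x"
  by (simp add: wind_def sw_def counit_l)

lemma wind_wind:
  assumes al: "lin al" and be: "lin be"
  shows "wind al (wind be x) = wind (\<lambda>t. al (wind be t)) x"
proof (rule lin_ext)
  fix \<psi> assume \<psi>: "lin \<psi>"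
  note [simp] = linD [OF \<psi>] linD [OF al] linD [OF be]
  have "\<psi> (wind al (wind be x)) = sw (\<lambda>p q. be p * sw (\<lambda>u v. al u * \<psi> v) q) x"
  proof -
    have "lin (\<lambda>t. \<psi> (wind al t))"
      by (simp add: multilinear_simps wind_linear [OF al])
    then show ?thesis
      using lin_wind [of "\<lambda>t. \<psi> (wind al t)" be x] by (simp add: lin_wind [OF \<psi>])
  qed
  also have "\<dots> = sw (\<lambda>p q. sw (\<lambda>u v. be p * (al u * \<psi> v)) q) x"
    by (simp add: sw_mult_left)
  also have "\<dots> = sw (\<lambda>t v. sw (\<lambda>p u. be p * (al u * \<psi> v)) t) x"
    by (rule sw_coassoc [symmetric]) (simp add: multilinear_simps)
  also have "\<dots> = sw (\<lambda>t v. al (wind be t) * \<psi> v) x"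
    by (simp add: lin_wind [OF al] sw_mult_right mult.assoc [symmetric])
  also have "\<dots> = \<psi> (wind (\<lambda>t. al (wind be t)) x)"
    by (rule lin_wind [OF \<psi>, symmetric])
  finally show "\<psi> (wind al (wind be x)) = \<psi> (wind (\<lambda>t. al (wind be t)) x)" .
qed

lemma wind_inverse:
  assumes al: "character al"
  shows "wind al (wind (\<lambda>t. al (S t)) x) = x" "wind (\<lambda>t. al (S t)) (wind al x) = x"
proof -
  note al' = characterD [OF al]
  note [simp] = linD [OF al'(1)]
  have alS: "lin (\<lambda>t. al (S t))"
    by (simp add: multilinear_simps)
  have "al (wind (\<lambda>t. al (S t)) t) = \<epsilon> t" "al (S (wind al t)) = \<epsilon> t" for t
    using sw_S_left [OF al'(1), of t] sw_S_right [OF al'(1), of t]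
    by (simp_all add: lin_wind [OF al'(1)] lin_wind [OF alS] al'(2,3))
  then show "wind al (wind (\<lambda>t. al (S t)) x) = x" "wind (\<lambda>t. al (S t)) (wind al x) = x"
    by (simp_all add: wind_wind al'(1) alS wind_eps)
qed

text \<open>The powers of \<open>wind al\<close> are windings by the convolution powers of
  \<open>al\<close>, all of which are characters. In finite dimension distinct characters are
  independent, so two powers coincide, and injectivity turns the coincidence into a period.\<close>

lemma wind_order:
  assumes al: "character al"
  shows "\<exists>n>0. \<forall>x. (wind al ^^ n) x = x"
proof -
  note al' = characterD [OF al]
  \<comment> \<open>This is the \<open>i\<close>-th convolution power of \<open>al\<close>, since
    \<open>\<epsilon> (wind al x) = al x\<close>.\<close>
  define \<chi> where "\<chi> i x = \<epsilon> ((wind al ^^ i) x)" for i x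
  have chi_add: "\<chi> i (x + y) = \<chi> i x + \<chi> i y" and chi_scale: "\<chi> i (scale c x) = c * \<chi> i x"
    and chi_mult: "\<chi> i (x * y) = \<chi> i x * \<chi> i y" and chi_one: "\<chi> i 1 = 1" for i x y c
    unfolding \<chi>_def
    by (induction i arbitrary: x y)
      (simp_all add: eps_add eps_scale eps_mult eps_one funpow_swap1 wind_linear [OF al'(1)] wind_mult [OF al] wind_one [OF al])
  have chi_lin: "lin (\<chi> i)" for i
    by (simp add: linear_into_def chi_add chi_scale)
  have wind_chi: "(wind al ^^ i) x = wind (\<chi> i) x" for i x
  proof (induction i arbitrary: x)
    case (Suc i)
    have "(wind al ^^ Suc i) x = wind (\<chi> i) (wind al x)"
      by (simp add: funpow_swap1 Suc [symmetric])
    also have "\<dots> = wind (\<chi> (Suc i)) x"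
      by (simp add: wind_wind [OF chi_lin al'(1)]) (simp add: \<chi>_def [abs_def] funpow_swap1)
    finally show ?case .
  qed (simp add: \<chi>_def [abs_def] wind_eps)
  \<comment> \<open>Functionals are encoded as vectors of H by their values on the basis.\<close>
  obtain I c where I: "finite I" "\<exists>i\<in>I. c i \<noteq> 0" "(\<Sum>i\<in>I. scale (c i) (\<Sum>b\<in>B. scale (\<chi> i b) b)) = 0"
    using fd.sequence_dependent [of "\<lambda>i. \<Sum>b\<in>B. scale (\<chi> i b) b"] by blast
  have dep: "(\<Sum>i\<in>I. c i * \<chi> i x) = 0" for x
  proof -
    have "crd b (\<Sum>d\<in>B. scale (k d) d) = k b" if "b \<in> B" for b k
    proof -
      have "crd b d = (if b = d then 1 else 0)" if "d \<in> B" for d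
        using that by (simp add: crd_def representation_basis [OF fd.independent_Basis])
      then have "crd b (\<Sum>d\<in>B. scale (k d) d) = (\<Sum>d\<in>B. if b = d then k d else 0)"
        unfolding lin_sum [OF crd_lin] linD [OF crd_lin] by (intro sum.cong) auto
      then show ?thesis
        using that by (simp add: fd.finite_Basis)
    qed
    then have b: "(\<Sum>i\<in>I. c i * \<chi> i b) = 0" if "b \<in> B" for b
      using arg_cong [OF I(3), of "crd b"] that
      by (simp add: lin_sum [OF crd_lin] linD [OF crd_lin] lin_zero [OF crd_lin])
    have "(\<Sum>i\<in>I. c i * \<chi> i x) = (\<Sum>i\<in>I. c i * (\<Sum>b\<in>B. crd b x * \<chi> i b))"
      by (simp add: lin_expand [OF chi_lin])
    also have "\<dots> = (\<Sum>b\<in>B. crd b x * (\<Sum>i\<in>I. c i * \<chi> i b))"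
      unfolding sum_distrib_left by (subst sum.swap) (simp add: mult.left_commute)
    finally show ?thesis
      by (simp add: b)
  qed
  have "\<exists>i\<in>I. \<exists>j\<in>I. i \<noteq> j \<and> (\<forall>x. \<chi> i x = \<chi> j x)"
  proof (rule ccontr)
    assume none: "\<not> ?thesis"
    have "c i = 0" if "i \<in> I" for i
    proof (rule characters_independent [of UNIV "(*)" I \<chi> c i])
      show "\<exists>x\<in>UNIV. \<chi> i x \<noteq> 0" for i
        using chi_one [of i] by (intro bexI [of _ 1]) auto
      show "\<exists>x\<in>UNIV. \<chi> i x \<noteq> \<chi> j x" if "i \<in> I" "j \<in> I" "i \<noteq> j" for i j
        using none that by blast
    qed (use that I(1) dep chi_mult in simp_all)
    then show False
      using I(2) by blast
  qed
  then obtain i0 j0 where ij0: "i0 \<noteq> j0" "\<And>x. \<chi> i0 x = \<chi> j0 x"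
    by blast
  then have "i0 < j0 \<or> j0 < i0"
    by auto
  with ij0(2) have "\<exists>i j. i < j \<and> (\<forall>x. \<chi> i x = \<chi> j x)"
    by (elim disjE) (intro exI conjI, assumption, simp)+
  then obtain i j where "i < j" "\<And>x. \<chi> i x = \<chi> j x"
    by blast
  then have ij: "i < j" "\<And>x. (wind al ^^ i) x = (wind al ^^ j) x"
    unfolding wind_chi by (auto simp: wind_def)
  have inj: "inj (wind al)"
    by (rule inj_on_inverseI) (rule wind_inverse(2) [OF al])
  have "(wind al ^^ (j - i)) x = x" for x
  proof -
    have "(wind al ^^ i) ((wind al ^^ (j - i)) x) = (wind al ^^ i) x"
      using funpow_add [of i "j - i" "wind al"] ij by simp
    then show ?thesis
      by (rule injD [OF inj_fn [OF inj]])
  qed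
  then show ?thesis
    using ij(1) by (intro exI [of _ "j - i"]) auto
qed

definition grouplike :: "'h \<Rightarrow> bool" where
  "grouplike g \<longleftrightarrow> \<epsilon> g = 1 \<and> (\<forall>F. bilin F \<longrightarrow> sw F g = F g g)"

lemma grouplike_inverse:
  assumes g: "grouplike g"
  shows "S g * g = 1" "g * S g = 1"
proof -
  have b: "bilin (\<lambda>x y. \<psi> (S x * y))" "bilin (\<lambda>x y. \<psi> (x * S y))" if "lin \<psi>" for \<psi>
    using linD [OF that] by (simp_all add: multilinear_simps)
  show "S g * g = 1" "g * S g = 1"
    using g b sw_S_left [of _ g] sw_S_right [of _ g] by (auto intro!: lin_ext simp: grouplike_def)
qed

lemma bilin_mult:
  assumes "lin \<phi>" "lin \<psi>"
  shows "bilin (\<lambda>x y. \<phi> x * \<psi> y)"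
proof -
  note [simp] = linD [OF assms(1)] linD [OF assms(2)]
  show ?thesis
    by (simp add: multilinear_simps)
qed

text \<open>Dual to \<open>wind_order\<close>: evaluation at a power of \<open>g\<close> is a
  character of the convolution algebra of linear functionals, because powers of \<open>g\<close> are
  group-like. Two powers must coincide, and \<open>S g\<close> inverts \<open>g\<close>.\<close>

lemma grouplike_order:
  assumes g: "grouplike g"
  shows "\<exists>n>0. g ^ n = 1"
proof -
  have power: "grouplike (g ^ i)" for i
  proof (induction i)
    case 0
    show ?case
      by (simp add: grouplike_def eps_one sw_one)
  next
    case (Suc i)
    show ?case
      unfolding grouplike_def
    proof (intro conjI allI impI)
      show "\<epsilon> (g ^ Suc i) = 1"
        using g Suc by (simp add: grouplike_def eps_mult)
      fix F assume F: "bilin F"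
      then have "sw F (g ^ Suc i) = sw (\<lambda>x y. sw (\<lambda>x' y'. F (x * x') (y * y')) (g ^ i)) g"
        by (simp add: sw_mult)
      also have "\<dots> = sw (\<lambda>x y. F (x * g ^ i) (y * g ^ i)) g"
      proof -
        have "bilin (\<lambda>x' y'. F (x * x') (y * y'))" for x y
          using F by (simp add: multilinear_simps)
        then show ?thesis
          using Suc by (simp add: grouplike_def)
      qed
      also have "\<dots> = F (g ^ Suc i) (g ^ Suc i)"
      proof -
        have "bilin (\<lambda>x y. F (x * g ^ i) (y * g ^ i))"
          using F by (simp add: multilinear_simps)
        then show ?thesis
          using g by (simp add: grouplike_def)
      qed
      finally show "sw F (g ^ Suc i) = F (g ^ Suc i) (g ^ Suc i)" .
    qed
  qed
  obtain I c where I: "finite I" "\<exists>i\<in>I. c i \<noteq> 0" "(\<Sum>i\<in>I. scale (c i) (g ^ i)) = 0"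
    using fd.sequence_dependent [of "\<lambda>i. g ^ i"] by blast
  have dep: "(\<Sum>i\<in>I. c i * \<psi> (g ^ i)) = 0" if "lin \<psi>" for \<psi>
    using arg_cong [OF I(3), of \<psi>] unfolding lin_sum [OF that] linD(2) [OF that] lin_zero [OF that] .
  have "\<exists>i\<in>I. \<exists>j\<in>I. i \<noteq> j \<and> g ^ i = g ^ j"
  proof (rule ccontr)
    assume *: "\<not> ?thesis"
    have "c i = 0" if i: "i \<in> I" for i
    proof (rule characters_independent [of "{\<psi>. lin \<psi>}" "\<lambda>\<phi> \<psi>. sw (\<lambda>x y. \<phi> x * \<psi> y)" I "\<lambda>i \<psi>. \<psi> (g ^ i)" c i])
      fix \<phi> \<psi> :: "'h \<Rightarrow> 'k" assume l: "\<phi> \<in> {\<psi>. lin \<psi>}" "\<psi> \<in> {\<psi>. lin \<psi>}"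
      then have b: "bilin (\<lambda>x y. \<phi> x * \<psi> y)"
        by (intro bilin_mult) simp_all
      then show "sw (\<lambda>x y. \<phi> x * \<psi> y) \<in> {\<psi>. lin \<psi>}"
        by (simp add: lin_sw_fun)
      show "sw (\<lambda>x y. \<phi> x * \<psi> y) (g ^ i) = \<phi> (g ^ i) * \<psi> (g ^ i)" for i
        using power b by (simp add: grouplike_def)
    next
      show "\<exists>\<psi>\<in>{\<psi>. lin \<psi>}. \<psi> (g ^ i) \<noteq> 0" for i
        using eps_linear power [of i] by (intro bexI [of _ \<epsilon>]) (auto simp: grouplike_def)
      show "\<exists>\<psi>\<in>{\<psi>. lin \<psi>}. \<psi> (g ^ i) \<noteq> \<psi> (g ^ j)" if "i \<in> I" "j \<in> I" "i \<noteq> j" for i j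
      proof (rule ccontr)
        assume "\<not> (\<exists>\<psi>\<in>{\<psi>. lin \<psi>}. \<psi> (g ^ i) \<noteq> \<psi> (g ^ j))"
        then have "\<psi> (g ^ i) = \<psi> (g ^ j)" if "lin \<psi>" for \<psi>
          using that by simp
        then have "g ^ i = g ^ j"
          by (rule lin_ext)
        with * that show False
          by blast
      qed
      show "(\<Sum>i\<in>I. c i * \<psi> (g ^ i)) = 0" if "\<psi> \<in> {\<psi>. lin \<psi>}" for \<psi>
        using that by (intro dep) simp
    qed (fact I(1), fact i)
    then show False
      using I(2) by blast
  qed
  then obtain i0 j0 where ij0: "i0 \<noteq> j0" "g ^ i0 = g ^ j0"
    by blast
  then have "i0 < j0 \<or> j0 < i0"
    by auto
  with ij0(2) have "\<exists>i j. i < j \<and> g ^ i = g ^ j"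
    by (elim disjE) (intro exI conjI, assumption, simp)+
  then obtain i j where ij: "i < j" "g ^ i = g ^ j"
    by blast
  have "S g ^ n * g ^ n = 1" for n
  proof (induction n)
    case (Suc n)
    have "S g ^ Suc n * g ^ Suc n = S g ^ n * (S g * g) * g ^ n"
      by (simp only: power_Suc2 [of "S g"] power_Suc [of g] mult.assoc)
    then show ?case
      by (simp add: grouplike_inverse [OF g] Suc)
  qed simp
  then have "g ^ (j - i) = S g ^ i * g ^ i * g ^ (j - i)"
    by simp
  also have "\<dots> = S g ^ i * g ^ j"
    using ij(1) by (simp add: mult.assoc power_add [symmetric])
  also have "\<dots> = 1"
    unfolding ij(2) [symmetric] by fact
  finally show ?thesis
    using ij(1) by (intro exI [of _ "j - i"]) auto
qed

end

lemma funpow_twice: "((\<lambda>x. f (f x)) ^^ n) x = (f ^^ (2 * n)) x"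
  by (induction n) simp_all

section \<open>The co-opposite Hopf algebra and Radford's formula\<close>

context fd_hopf
begin

lemma S_sw: "S (sw f a) = sw (\<lambda>x y. S (f x y)) a"
proof -
  have "S 0 = 0"
    using S_scale [of 0 0] by simp
  then have "S (\<Sum>(x, y)\<leftarrow>ps. f x y) = (\<Sum>(x, y)\<leftarrow>ps. S (f x y))" for ps
    by (induction ps) (auto simp: S_add)
  then show ?thesis
    by (simp add: sw_def)
qed

abbreviation S' :: "'h \<Rightarrow> 'h" where
  "S' \<equiv> inv_into UNIV S"

abbreviation cop_D :: "'h \<Rightarrow> ('h \<times> 'h) list" where
  "cop_D \<equiv> \<lambda>a. map (\<lambda>(x, y). (y, x)) (D a)"

lemma cop_sum: "(\<Sum>(x, y)\<leftarrow>cop_D a. f x y) = sw (\<lambda>x y. f y x) a"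
proof -
  have "(\<Sum>(x, y)\<leftarrow>map (\<lambda>(x, y). (y, x)) ps. f x y) = (\<Sum>(x, y)\<leftarrow>ps. f y x)" for ps :: "('h \<times> 'h) list"
    by (induction ps) auto
  then show ?thesis
    by (simp add: sw_def)
qed

text \<open>With the tensor factors reversed, the inverse of \<open>S\<close> satisfies the antipode
  axioms; they are checked after applying \<open>S\<close>, which reverses products.\<close>

lemma cop_hopf: "fd_hopf scale cop_D \<epsilon> S' B"
proof (rule fd_hopf.intro, rule k_algebra_axioms, rule fd_hopf_axioms.intro, unfold cop_sum)
  have S_inv: "S (S' x) = x" for x
    using bij_S by (simp add: bij_is_surj surj_f_inv_f)
  have inj: "S x = S y \<Longrightarrow> x = y" for x y
    using bij_S by (simp add: bij_is_inj inj_eq)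
  show "sw (\<lambda>x y. f y x) (a + b) = sw (\<lambda>x y. f y x) a + sw (\<lambda>x y. f y x) b"
    "sw (\<lambda>x y. f y x) (scale c a) = c * sw (\<lambda>x y. f y x) a"
    "sw (\<lambda>x y. f y x) 1 = f 1 1"
    "sw (\<lambda>x y. f y x) (a * b) = sw (\<lambda>x y. sw (\<lambda>x' y'. f (y * y') (x * x')) b) a"
    if f: "bilin f" for f a b c
  proof -
    have "bilin (\<lambda>x y. f y x)"
      using f by (simp add: bilinear_into_def)
    then show "sw (\<lambda>x y. f y x) (a + b) = sw (\<lambda>x y. f y x) a + sw (\<lambda>x y. f y x) b"
      "sw (\<lambda>x y. f y x) (scale c a) = c * sw (\<lambda>x y. f y x) a"
      "sw (\<lambda>x y. f y x) 1 = f 1 1"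
      "sw (\<lambda>x y. f y x) (a * b) = sw (\<lambda>x y. sw (\<lambda>x' y'. f (y * y') (x * x')) b) a"
      by (rule sw_add, rule sw_scale, rule sw_one, rule sw_mult)
  qed
  show "sw (\<lambda>x y. sw (\<lambda>u v. g v u x) y) a = sw (\<lambda>x y. sw (\<lambda>u v. g y v u) x) a"
    if g: "trilin g" for g a
    by (rule sw_coassoc [where g = "\<lambda>u v y. g y v u", symmetric]) (use g in \<open>simp add: trilinear_into_def\<close>)
  show "linear_into scale (*) \<epsilon>" "\<epsilon> 1 = 1" "\<epsilon> (a * b) = \<epsilon> a * \<epsilon> b"
    "finite_dimensional_vector_space scale B" for a b
    by (rule eps_linear, rule eps_one, rule eps_mult, rule finite_basis)
  show "sw (\<lambda>x y. scale (\<epsilon> y) x) a = a" "sw (\<lambda>x y. scale (\<epsilon> x) y) a = a" for a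
    by (simp_all add: sw_def counit_l counit_r)
  show "linear_into scale scale S'"
    unfolding linear_into_def by (auto intro: inj simp: S_inv S_add S_scale)
  have "S (sw (\<lambda>x y. S' y * x) a) = S (scale (\<epsilon> a) 1)" for a
    unfolding S_sw S_mult S_inv by (simp add: sw_def antipode_l S_scale S_one)
  then show "sw (\<lambda>x y. S' y * x) a = scale (\<epsilon> a) 1" for a
    by (rule inj)
  have "S (sw (\<lambda>x y. y * S' x) a) = S (scale (\<epsilon> a) 1)" for a
    unfolding S_sw S_mult S_inv by (simp add: sw_def antipode_r S_scale S_one)
  then show "sw (\<lambda>x y. y * S' x) a = scale (\<epsilon> a) 1" for a
    by (rule inj)
qed

lemma cop_sw: "fd_hopf.sw cop_D f a = sw (\<lambda>x y. f y x) a"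
  by (simp only: fd_hopf.sw_def [OF cop_hopf] cop_sum)

lemma wind_grouplike:
  assumes "grouplike g" "lin al"
  shows "wind al g = scale (al g) g"
proof (rule lin_ext)
  fix \<psi> assume \<psi>: "lin \<psi>"
  show "\<psi> (wind al g) = \<psi> (scale (al g) g)"
    using assms(1) bilin_mult [OF assms(2) \<psi>] by (simp add: lin_wind [OF \<psi>] grouplike_def linD [OF \<psi>])
qed

lemma grouplike_S:
  assumes g: "grouplike g"
  shows "grouplike (S g)"
proof -
  have "\<epsilon> (S g) * \<epsilon> g = 1"
    by (simp add: eps_mult [symmetric] grouplike_inverse [OF g] eps_one)
  moreover have "sw F (S g) = F (S g) (S g)" if F: "bilin F" for F
  proof -
    have "bilin (\<lambda>x y. F (S y) (S x))"
      using F by (simp add: multilinear_simps)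
    then show ?thesis
      using g by (simp add: sw_S [OF F] grouplike_def)
  qed
  ultimately show ?thesis
    using g by (simp add: grouplike_def)
qed

text \<open>The scalars \<open>al g\<close> and \<open>al (S g)\<close> by which winding acts on the
  two outer factors are inverse to each other.\<close>

lemma wind_conjugate:
  assumes g: "grouplike g" and al: "character al"
  shows "wind al (g * y * S g) = g * wind al y * S g"
proof -
  have "al g * al (S g) = 1"
    by (simp add: characterD [OF al] grouplike_inverse [OF g] flip: characterD(3) [OF al])
  then show ?thesis
    by (simp add: wind_mult [OF al] wind_grouplike [OF g characterD(1) [OF al]]
        wind_grouplike [OF grouplike_S [OF g] characterD(1) [OF al]] scale_mult_left scale_mult_right mult.commute)
qed

lemma cop_grouplike: "grouplike g \<Longrightarrow> fd_hopf.grouplike scale cop_D \<epsilon> g"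
  unfolding fd_hopf.grouplike_def [OF cop_hopf] cop_sw
  by (auto simp: grouplike_def bilinear_into_def)

text \<open>
  By \<open>nakayama_formula\<close>, \<open>nu\<close> followed by the right winding \<open>R\<close> is \<open>S\<^sup>2\<close>. The same formula for the
  co-opposite Hopf algebra, whose left integrals are the translates \<open>lam (\<cdot> g)\<close> of \<open>lam\<close>, expresses
  the inverse of \<open>S\<^sup>2\<close> by \<open>nu\<close> followed by a conjugation and the left winding. Together they give
  Radford's formula for \<open>S\<^sup>4\<close> and show that the inverse of \<open>nu\<^sup>2\<close> is a product of commuting maps of
  finite order.
\<close>

lemma nakayama_finite_order:
  assumes lam: "lint lam" "lam x0 \<noteq> 0" and nu: "\<And>a b. lam (a * b) = lam (b * nu a)"
  shows "\<exists>N>0. \<forall>x. (nu ^^ N) x = x"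
proof -
  interpret cop: fd_hopf scale cop_D \<epsilon> "S'" B
    by (rule cop_hopf)
  have inv_S: "S' (S x) = x" for x
    using bij_S by (simp add: bij_is_inj)
  note lin_lam = lint_lin [OF lam(1)]
  note [simp] = linD [OF lin_lam]
  \<comment> \<open>The element that represents \<open>\<epsilon>\<close> is a left integral of H
    itself (\<open>t_left\<close>), normalized by \<open>lam t = 1\<close>.\<close>
  obtain t where t: "\<And>x. lam (x * t) = \<epsilon> x"
    using lint_surj [OF lam eps_linear] by blast
  \<comment> \<open>The modular character: \<open>t * b\<close> is again a left integral and equals
    \<open>al b\<close> times \<open>t\<close> (\<open>t_right\<close>).\<close>
  define al where "al b = lam (t * b)" for b
  have lam_t: "lam t = 1"
    using t [of 1] by (simp add: eps_one)
  have t_left: "y * t = scale (\<epsilon> y) t" for y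
    by (rule lint_cancel [OF lam]) (simp add: mult.assoc [symmetric] t eps_mult scale_mult_right)
  have t_right: "t * b = scale (al b) t" for b
  proof (rule lint_cancel [OF lam])
    fix x
    have "lam (x * (t * b)) = \<epsilon> x * al b"
      by (simp add: mult.assoc [symmetric] t_left scale_mult_left al_def)
    then show "lam (x * (t * b)) = lam (x * scale (al b) t)"
      by (simp add: scale_mult_right t)
  qed
  have al: "character al"
    unfolding character_def linear_into_def
  proof (intro conjI allI)
    show "al (a * b) = al a * al b" for a b
    proof -
      have "al (a * b) = lam (t * a * b)"
        by (simp add: al_def mult.assoc)
      also have "\<dots> = lam (scale (al a) (t * b))"
        by (simp only: t_right [of a] scale_mult_left)
      also have "\<dots> = al a * al b"
        by (simp add: al_def)
      finally show ?thesis .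
    qed
  qed (simp_all add: al_def distrib_left scale_mult_right lam_t)
  note lin_al = characterD(1) [OF al]
  note [simp] = linD [OF lin_al]
  have cop_al: "cop.character al"
    using al by (simp add: character_def cop.character_def)
  \<comment> \<open>The distinguished group-like element. For each \<open>\<psi>\<close> the
    functional \<open>\<psi> (lam x1 * x2)\<close> is a left integral, hence a multiple of
    \<open>lam\<close>; evaluating at \<open>t\<close>, where \<open>lam t = 1\<close>, shows that
    the factor is \<open>\<psi> g\<close>.\<close>
  define g where "g = wind lam t"
  have G: "sw (\<lambda>x1 x2. lam x1 * \<psi> x2) x = lam x * \<psi> g" if \<psi>: "lin \<psi>" for \<psi> x
  proof -
    note [simp] = linD [OF \<psi>]
    define mu where "mu x = sw (\<lambda>x1 x2. lam x1 * \<psi> x2) x" for x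
    have "lint mu"
      unfolding lint_def
    proof (intro conjI allI impI)
      show "lin mu"
        unfolding mu_def by (rule lin_sw_fun) (rule bilin_mult [OF lin_lam \<psi>])
      fix \<chi> x assume \<chi>: "lin \<chi>"
      note [simp] = linD [OF \<chi>]
      have "sw (\<lambda>x1 x2. \<chi> x1 * mu x2) x = sw (\<lambda>x1 r. sw (\<lambda>x2 x3. \<chi> x1 * (lam x2 * \<psi> x3)) r) x"
        by (simp add: mu_def sw_mult_left)
      also have "\<dots> = sw (\<lambda>r x3. sw (\<lambda>x1 x2. \<chi> x1 * (lam x2 * \<psi> x3)) r) x"
        by (rule sw_coassoc [symmetric]) (simp add: multilinear_simps)
      also have "\<dots> = sw (\<lambda>r x3. \<chi> 1 * lam r * \<psi> x3) x"
        by (simp add: mult.assoc [symmetric] sw_mult_right lintD [OF lam(1) \<chi>])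
      also have "\<dots> = \<chi> 1 * mu x"
        by (simp add: mu_def mult.assoc sw_mult_left)
      finally show "sw (\<lambda>x1 x2. \<chi> x1 * mu x2) x = \<chi> 1 * mu x" .
    qed
    then obtain c where c: "\<And>x. mu x = c * lam x"
      using lint_unique [OF lam] by blast
    have "c = mu t"
      by (simp add: c lam_t)
    also have "\<dots> = \<psi> g"
      by (simp add: g_def mu_def lin_wind [OF \<psi>])
    finally show ?thesis
      using c [of x] by (simp add: mu_def mult.commute)
  qed
  have g: "grouplike g"
    unfolding grouplike_def
  proof (intro conjI allI impI)
    have "sw (\<lambda>x1 x2. \<epsilon> x2 * lam x1) t = lam t"
      by (rule sw_eps_right [OF lin_lam])
    then show "\<epsilon> g = 1"
      using G [OF eps_linear, of t] by (simp add: lam_t mult.commute)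
    fix F assume F: "bilin F"
    have [simp]: "F (x + x') y = F x y + F x' y" "F x (y + y') = F x y + F x y'"
      "F (scale c x) y = c * F x y" "F x (scale c y) = c * F x y" for x x' y y' c
      using F by (auto simp: multilinear_defs)
    have Fl: "lin (\<lambda>y. F y z)" "lin (F g)" for z
      using F by (simp_all add: bilinear_into_def)
    have "sw F g = sw (\<lambda>x1 r. sw (\<lambda>y z. lam x1 * F y z) r) t"
      using G [OF lin_sw_fun [OF F], of t] by (simp add: lam_t sw_mult_left)
    also have "\<dots> = sw (\<lambda>r z. sw (\<lambda>x1 y. lam x1 * F y z) r) t"
      by (rule sw_coassoc [symmetric]) (simp add: multilinear_simps)
    also have "\<dots> = sw (\<lambda>r z. lam r * F g z) t"
      by (simp add: G [OF Fl(1)])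
    also have "\<dots> = F g g"
      by (simp add: G [OF Fl(2)] lam_t)
    finally show "sw F g = F g g" .
  qed
  note g_inv = grouplike_inverse [OF g]
  \<comment> \<open>The right winding \<open>x1 * al x2\<close> is the left winding of the
    co-opposite Hopf algebra, so its properties need no second proof.\<close>
  define R where "R = cop.wind al"
  have lin_R: "\<psi> (R x) = sw (\<lambda>u v. al v * \<psi> u) x" if "lin \<psi>" for \<psi> x
    unfolding R_def cop.lin_wind [OF that] cop_sw ..
  have R_mult: "R (x * y) = R x * R y" for x y
    unfolding R_def by (rule cop.wind_mult [OF cop_al])
  have lam_R: "lam (R x) = al g * lam x" for x
    using G [OF lin_al, of x] by (simp add: lin_R [OF lin_lam] mult.commute)
  have R_surj: "\<exists>y. x = R y" for x
    unfolding R_def using cop.wind_inverse(1) [OF cop_al, of x] by metis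
  \<comment> \<open>\<open>R\<close> is multiplicative and onto and multiplies \<open>lam\<close> by
    the constant \<open>al g\<close>, so it is compatible with the equation that defines
    \<open>nu\<close>.\<close>
  have R_nu: "nu (R a) = R (nu a)" for a
  proof (rule lint_cancel [OF lam])
    fix x
    obtain y where y: "x = R y"
      using R_surj by blast
    have "lam (x * nu (R a)) = lam (R a * R y)"
      by (simp only: nu [symmetric] y)
    also have "\<dots> = al g * lam (a * y)"
      by (simp only: R_mult [symmetric] lam_R)
    also have "\<dots> = lam (x * R (nu a))"
      by (simp only: nu [of a] y R_mult [symmetric] lam_R)
    finally show "lam (x * nu (R a)) = lam (x * R (nu a))" .
  qed
  have SS: "R (nu x) = S (S x)" for x
  proof (rule lin_ext)
    fix \<psi> assume \<psi>: "lin \<psi>"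
    show "\<psi> (R (nu x)) = \<psi> (S (S x))"
      using nakayama_formula [OF lam(1) t al_def [symmetric] nu \<psi>, of x]
      by (simp add: lin_R [OF \<psi>] mult.commute)
  qed
  define A where "A y = g * y * S g" for y
  \<comment> \<open>Translation by \<open>g\<close> compensates the factor \<open>g\<close> in
    \<open>G\<close>: the result satisfies the integral condition on the other side.\<close>
  have lint_rho: "cop.lint (\<lambda>x. lam (x * g))"
    unfolding cop.lint_def cop_sw
  proof (intro conjI allI impI)
    show "lin (\<lambda>x. lam (x * g))"
      by (simp add: multilinear_simps)
    fix \<psi> x assume \<psi>: "lin \<psi>"
    note [simp] = linD [OF \<psi>]
    have l: "lin (\<lambda>y. \<psi> (y * S g))"
      by (simp add: multilinear_simps)
    have "bilin (\<lambda>g1 g2. lam (x1 * g1) * \<psi> (x2 * (g2 * S g)))" for x1 x2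
      by (simp add: multilinear_simps)
    then have "sw (\<lambda>g1 g2. lam (x1 * g1) * \<psi> (x2 * (g2 * S g))) g = lam (x1 * g) * \<psi> x2" for x1 x2
      using g by (simp add: grouplike_def g_inv)
    then have "sw (\<lambda>y1 y2. lam y1 * \<psi> (y2 * S g)) (x * g) = sw (\<lambda>x1 x2. lam (x1 * g) * \<psi> x2) x"
      by (subst sw_mult) (simp_all add: multilinear_simps)
    then show "sw (\<lambda>x y. \<psi> y * lam (x * g)) x = \<psi> 1 * lam (x * g)"
      using G [OF l, of "x * g"] by (simp add: g_inv mult.commute)
  qed
  \<comment> \<open>For the translated form, the counit is represented by \<open>t * S g\<close>,
    the modular function is still \<open>al\<close>, and the Nakayama map is \<open>nu\<close>
    followed by conjugation with \<open>g\<close>.\<close>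
  have inv_SS: "wind al (A (nu x)) = S' (S' x)" for x
  proof (rule lin_ext)
    fix \<psi> assume \<psi>: "lin \<psi>"
    have "cop.sw (\<lambda>u v. \<psi> u * al v) (A (nu x)) = \<psi> (S' (S' x))"
    proof (rule cop.nakayama_formula [OF lint_rho, where t = "t * S g"])
      show "lam (y * (t * S g) * g) = \<epsilon> y" for y
        by (simp add: mult.assoc g_inv t)
      show "lam (t * S g * b * g) = al b" for b
      proof -
        have "lam (t * S g * b * g) = al (S g * b * g)"
          by (simp add: al_def mult.assoc)
        also have "\<dots> = al b * al (S g * g)"
          by (simp add: characterD(3) [OF al])
        finally show ?thesis
          by (simp add: g_inv characterD(2) [OF al])
      qed
      show "lam (a * b * g) = lam (b * A (nu a) * g)" for a b
      proof -
        have "lam (a * b * g) = lam (b * g * nu a)"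
          by (simp only: mult.assoc nu [of a])
        also have "\<dots> = lam (b * (g * nu a * (S g * g)))"
          by (simp add: g_inv mult.assoc)
        finally show ?thesis
          by (simp add: A_def mult.assoc)
      qed
    qed (rule \<psi>)
    then show "\<psi> (wind al (A (nu x))) = \<psi> (S' (S' x))"
      by (simp add: lin_wind [OF \<psi>] cop_sw mult.commute)
  qed
  \<comment> \<open>\<open>inv_SS\<close> is used at \<open>R (nu x)\<close>, which is
    \<open>S (S x)\<close> by \<open>SS\<close>; the antipodes cancel, and \<open>R_nu\<close>
    collects the two copies of \<open>nu\<close>.\<close>
  have E: "wind al (A (R (nu (nu x)))) = x" for x
    unfolding R_nu [of "nu x", symmetric] using inv_SS [of "R (nu x)"] by (simp only: SS inv_S)
  have comm_LA: "wind al (A y) = A (wind al y)" for y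
    unfolding A_def by (rule wind_conjugate [OF g al])
  have comm_RA: "R (A y) = A (R y)" for y
  proof -
    have r: "R g = scale (al g) g" "R (S g) = scale (al (S g)) (S g)"
      unfolding R_def
      by (rule cop.wind_grouplike [OF cop_grouplike [OF g] lin_al],
          rule cop.wind_grouplike [OF cop_grouplike [OF grouplike_S [OF g]] lin_al])
    have "al g * al (S g) = 1"
      using characterD(3) [OF al, of g "S g"] characterD(2) [OF al] by (simp add: g_inv)
    then show ?thesis
      by (simp add: A_def R_mult r scale_mult_left scale_mult_right mult.commute)
  qed
  have comm_LR: "wind al (R x) = R (wind al x)" for x
  proof (rule lin_ext)
    fix \<psi> assume \<psi>: "lin \<psi>"
    note [simp] = linD [OF \<psi>]
    have l: "lin (\<lambda>t. \<psi> (wind al t))"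
      by (simp add: multilinear_simps wind_linear [OF lin_al])
    have r: "lin (\<lambda>t. \<psi> (R t))"
      by (simp add: multilinear_simps lin_R [OF \<psi>])
    have "\<psi> (wind al (R x)) = sw (\<lambda>p q. sw (\<lambda>u v. al q * (al u * \<psi> v)) p) x"
      unfolding lin_R [OF l] by (simp add: lin_wind [OF \<psi>] sw_mult_left)
    also have "\<dots> = sw (\<lambda>u p. sw (\<lambda>v q. al q * (al u * \<psi> v)) p) x"
      by (rule sw_coassoc) (simp add: multilinear_simps)
    also have "\<dots> = sw (\<lambda>u p. sw (\<lambda>v q. al u * (al q * \<psi> v)) p) x"
      by (simp only: mult.left_commute)
    also have "\<dots> = \<psi> (R (wind al x))"
      unfolding lin_wind [OF r] by (simp add: lin_R [OF \<psi>] sw_mult_left)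
    finally show "\<psi> (wind al (R x)) = \<psi> (R (wind al x))" .
  qed
  obtain n1 where n1: "n1 > 0" "\<And>x. (wind al ^^ n1) x = x"
    using wind_order [OF al] by blast
  obtain n2 where n2: "n2 > 0" "\<And>x. (R ^^ n2) x = x"
    using cop.wind_order [OF cop_al] unfolding R_def by blast
  obtain n3 where n3: "n3 > 0" "g ^ n3 = 1"
    using grouplike_order [OF g] by blast
  \<comment> \<open>Iterated conjugation is multiplied by \<open>g ^ n\<close> on the right, which
    avoids powers of the inverse.\<close>
  have A_n3: "(A ^^ n3) y = y" for y
  proof -
    have "(A ^^ n) y * g ^ n = g ^ n * y" for n
    proof (induction n arbitrary: y)
      case (Suc n)
      have "(A ^^ Suc n) y * g ^ Suc n = (A ^^ n) (A y) * g ^ n * g"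
        by (simp add: funpow_swap1 power_Suc2 mult.assoc del: power_Suc)
      also have "\<dots> = g ^ n * (g * y * (S g * g))"
        unfolding Suc by (simp add: A_def mult.assoc)
      also have "\<dots> = g ^ Suc n * y"
        by (simp add: g_inv power_Suc2 mult.assoc del: power_Suc)
      finally show ?case .
    qed simp
    from this [of n3] show ?thesis
      by (simp add: n3)
  qed
  \<comment> \<open>A common multiple of the three orders suffices, because the three maps
    commute.\<close>
  define n where "n = n1 * (n2 * n3)"
  have "((\<lambda>x. wind al (A (R x))) ^^ n) x = x" for x
  proof -
    have "((\<lambda>x. wind al (A (R x))) ^^ n) x = (wind al ^^ n) (((\<lambda>x. A (R x)) ^^ n) x)"
      by (rule funpow_comp_commute [where g = "\<lambda>x. A (R x)"]) (simp add: comm_LA comm_LR)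
    also have "((\<lambda>x. A (R x)) ^^ n) x = (A ^^ n) ((R ^^ n) x)"
      by (rule funpow_comp_commute) (simp add: comm_RA)
    also have "(R ^^ n) x = x"
      using funpow_order_mult [of n2 R "n1 * n3" x, OF n2(2)] by (simp add: n_def mult_ac)
    also have "(A ^^ n) x = x"
      using funpow_order_mult [of n3 A "n1 * n2" x, OF A_n3] by (simp add: n_def mult_ac)
    also have "(wind al ^^ n) x = x"
      unfolding n_def by (rule funpow_order_mult [OF n1(2)])
    finally show ?thesis .
  qed
  moreover have "((\<lambda>x. wind al (A (R x))) ^^ k) (((\<lambda>x. nu (nu x)) ^^ k) x) = x" for k x
  proof (induction k)
    case (Suc k)
    then show ?case
      by (subst funpow_Suc_right [of k "\<lambda>x. wind al (A (R x))"]) (simp add: E)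
  qed simp
  ultimately have "((\<lambda>x. nu (nu x)) ^^ n) x = x" for x
    by metis
  \<comment> \<open>Only the square of \<open>nu\<close> is controlled, hence the factor 2.\<close>
  then show ?thesis
    using n1(1) n2(1) n3(1) by (intro exI [of _ "2 * n"]) (simp add: funpow_twice n_def)
qed

text \<open>Additivity, homogeneity and multiplicativity of \<open>nu\<close> follow from its
  defining equation by cancelling \<open>lam\<close>. The finite order is
  \<open>nakayama_finite_order\<close>, and the hypothesis on the characteristic makes that order
  invertible.\<close>

lemma frobenius_form_exists:
  assumes char: "\<And>n::nat. n > 0 \<Longrightarrow> of_nat n \<noteq> (0::'k)"
  shows "\<exists>\<phi> \<nu> N. frobenius_form scale \<phi> \<nu> N"
proof -
  obtain lam x0 where lam: "lint lam" "lam x0 \<noteq> 0"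
    using lint_exists by blast
  note [simp] = linD [OF lint_lin [OF lam(1)]]
  have "\<exists>c. \<forall>b. lam (b * c) = lam (a * b)" for a
    by (rule lint_surj [OF lam]) (simp add: multilinear_simps)
  then obtain nu where nu: "\<And>a b. lam (a * b) = lam (b * nu a)"
    by metis
  obtain N where N: "N > 0" "\<And>x. (nu ^^ N) x = x"
    using nakayama_finite_order [OF lam nu] by blast
  have "frobenius_form scale lam nu N"
  proof (rule frobenius_form.intro, rule k_algebra_axioms, rule frobenius_form_axioms.intro)
    show "b = 0" if "\<And>a. lam (a * b) = 0" for b
      by (rule lint_cancel [OF lam]) (simp add: that lin_zero [OF lint_lin [OF lam(1)]])
    show "\<exists>c. \<forall>a. lam (a * c) = \<psi> a" if "\<And>a b. \<psi> (a + b) = \<psi> a + \<psi> b" "\<And>c a. \<psi> (scale c a) = c * \<psi> a" for \<psi>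
      by (rule lint_surj [OF lam]) (simp add: linear_into_def that)
    show "lam (a * b) = lam (b * nu a)" for a b
      by (rule nu)
    show "nu (a + b) = nu a + nu b" for a b
      by (rule lint_cancel [OF lam]) (simp add: nu [symmetric] distrib_left distrib_right)
    show "nu (scale c a) = scale c (nu a)" for c a
      by (rule lint_cancel [OF lam]) (simp add: nu [symmetric] scale_mult_left scale_mult_right)
    show "nu (a * b) = nu a * nu b" for a b
    proof (rule lint_cancel [OF lam])
      fix x
      have "lam (x * nu (a * b)) = lam (a * (b * x))"
        by (simp only: nu [symmetric] mult.assoc)
      also have "\<dots> = lam (b * (x * nu a))"
        by (simp only: nu [of a] mult.assoc)
      also have "\<dots> = lam (x * (nu a * nu b))"
        by (simp only: nu [of b] mult.assoc)
      finally show "lam (x * nu (a * b)) = lam (x * (nu a * nu b))" .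
    qed
    show "nu 1 = 1"
      by (rule lint_cancel [OF lam]) (simp add: nu [symmetric])
    show "(nu ^^ N) a = a" for a
      by (rule N(2))
    show "of_nat N \<noteq> (0::'k)"
      by (rule char [OF N(1)])
  qed simp_all
  then show ?thesis
    by blast
qed

end

theorem corollary5p9:
  fixes scale :: "'k::{alg_closed_field, field_char_0} \<Rightarrow> 'h::ring_1 \<Rightarrow> 'h"
    and comult :: "'h \<Rightarrow> ('h list \<Rightarrow>\<^sub>0 'k) set"
    and counit :: "'h \<Rightarrow> 'k"
    and antipode :: "'h \<Rightarrow> 'h"
  assumes "hopf_algebra scale comult counit antipode"
    and "\<exists>B. finite_dimensional_vector_space scale B"
  shows "bv_algebra (HH scale) (HH_cup scale) (HH_unit scale) (HH_bracket scale)"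
proof -
  obtain B where "finite_dimensional_vector_space scale B"
    using assms(2) by blast
  then obtain D where D: "fd_hopf scale D counit antipode B"
    using hopf_algebra.fd_hopf_exists [OF assms(1)] by blast
  have "of_nat n \<noteq> (0::'k)" if "n > 0" for n
    using that by simp
  then obtain \<phi> \<nu> N where "frobenius_form scale \<phi> \<nu> N"
    using fd_hopf.frobenius_form_exists [OF D] by blast
  then show ?thesis
    by (rule frobenius_form.HH_bv_algebra)
qed

end
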